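(* Let $\mathcal L$ be a finite distributive lattice, $\mathcal I$ a poset ideal and $\mathcal J$ a poset coideal of $\mathcal L$ such that $\mathcal I\cup\mathcal J=\mathcal L$. If $H_{\mathcal I\cap\mathcal J}=H_{\mathcal I}\cap H_{\mathcal J}$, then the following are equivalent: (1) $H_{\mathcal I}\cap H_{\mathcal J}$ has a linear resolution; (2) for each $p\in\mathcal L$, either $p\in\mathcal I$ or $\bigwedge N(p)\in\mathcal J$; (3) for each $r\in\mathcal L$, either $r\in\mathcal J$ or $\bigvee M(r)\in\mathcal I$.
   Context: Let $P$ be the set of join-irreducible elements of $\mathcal L$ (elements with exactly one lower neighbor), with the induced order; for $p\in\mathcal L$ put $\ell(p)=\{q\in P:q\le p\}$. Let $K$ be a field and $S=K[x_p,y_p: p\in P]$ with all variables of degree 1. For $q\in\mathcal L$ put $u_q=\prod_{p\in\ell(q)}x_p\prod_{p\in P\setminus\ell(q)}y_p$, and for $\mathcal S\subseteq\mathcal L$ let $H_{\mathcal S}$ be the ideal generated by $\{u_q:q\in\mathcal S\}$. $N(p)$ is the set of lower neighbors of $p$ (elements covered by $p$), $M(r)$ the set of upper neighbors of $r$ (elements covering $r$); $\bigwedge N(p)$ is the meet of all elements of $N(p)$ and $\bigvee M(r)$ the join of all elements of $M(r)$. Poset ideals are closed downward, poset coideals upward. A graded ideal has a linear resolution if all its minimal generators have the same degree $d$ and in its graded minimal free resolution the $i$-th module is generated in degree $d+i$ for all $i$. *)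

theory Defs
  imports Main "HOL-Library.Poly_Mapping"
begin

type_synonym ('v, 'k) mpoly = "('v \<Rightarrow>\<^sub>0 nat) \<Rightarrow>\<^sub>0 'k"

definition mdeg :: "('v \<Rightarrow>\<^sub>0 nat) \<Rightarrow> nat" where
  "mdeg m = (\<Sum>v\<in>Poly_Mapping.keys m. Poly_Mapping.lookup m v)"

text \<open>homogeneous of degree e (the zero polynomial is homogeneous of every degree)\<close>
definition homog :: "nat \<Rightarrow> ('v, 'k::zero) mpoly \<Rightarrow> bool" where
  "homog e f \<longleftrightarrow> (\<forall>m\<in>Poly_Mapping.keys f. mdeg m = e)"

definition polyR :: "'v set \<Rightarrow> ('v, 'k::zero) mpoly set" where
  "polyR V = {f. \<forall>m\<in>Poly_Mapping.keys f. Poly_Mapping.keys m \<subseteq> V}"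

definition gen_ideal :: "'v set \<Rightarrow> ('v, 'k::comm_ring_1) mpoly set \<Rightarrow> ('v, 'k) mpoly set" where
  "gen_ideal V G = {(\<Sum>g\<in>F. c g * g) | F c. finite F \<and> F \<subseteq> G \<and> (\<forall>g\<in>F. c g \<in> polyR V)}"

definition fvec :: "'v set \<Rightarrow> nat \<Rightarrow> (nat \<Rightarrow> ('v, 'k::zero) mpoly) set" where
  "fvec V n = {v. (\<forall>j. v j \<in> polyR V) \<and> (\<forall>j\<ge>n. v j = 0)}"

definition dmap :: "(nat \<Rightarrow> nat \<Rightarrow> ('v, 'k::comm_ring_1) mpoly) \<Rightarrow> nat \<Rightarrow> nat
    \<Rightarrow> (nat \<Rightarrow> ('v, 'k) mpoly) \<Rightarrow> (nat \<Rightarrow> ('v, 'k) mpoly)" where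
  "dmap D m n w = (\<lambda>j. if j < m then (\<Sum>k<n. D j k * w k) else 0)"

text \<open>Linear resolution of an ideal Jd of K[V] (all variables of degree 1):
  there is a graded free resolution
    ... -> F_2 -> F_1 -> F_0 -> Jd -> 0,  F_i = K[V](-d-i)^(b i),
  i.e. generators of Jd of degree d (augmentation eps) and all differentials
  (delta i : F_(i+1) -> F_i) given by matrices of linear forms.  Such a
  resolution is automatically minimal, so this is exactly the statement that
  the i-th module of the minimal graded free resolution is generated in degree d+i.\<close>
definition lin_res :: "'v set \<Rightarrow> ('v, 'k::comm_ring_1) mpoly set \<Rightarrow> bool" where
  "lin_res V Jd \<longleftrightarrow> (\<exists>(d::nat) (b::nat \<Rightarrow> nat) eps delta.
     (\<forall>j<b 0. eps j \<in> polyR V \<and> homog d (eps j)) \<and>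
     (\<forall>i j k. j < b i \<and> k < b (Suc i) \<longrightarrow> delta i j k \<in> polyR V \<and> homog 1 (delta i j k)) \<and>
     gen_ideal V (eps ` {..<b 0}) = Jd \<and>
     {v \<in> fvec V (b 0). (\<Sum>j<b 0. v j * eps j) = 0}
        = dmap (delta 0) (b 0) (b 1) ` fvec V (b 1) \<and>
     (\<forall>i. {v \<in> fvec V (b (Suc i)). dmap (delta i) (b i) (b (Suc i)) v = (\<lambda>_. 0)}
        = dmap (delta (Suc i)) (b (Suc i)) (b (Suc (Suc i))) ` fvec V (b (Suc (Suc i)))))"

definition lower_nbrs :: "'a::order \<Rightarrow> 'a set" where
  "lower_nbrs p = {q. q < p \<and> \<not> (\<exists>z. q < z \<and> z < p)}"

definition upper_nbrs :: "'a::order \<Rightarrow> 'a set" where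
  "upper_nbrs r = {q. r < q \<and> \<not> (\<exists>z. r < z \<and> z < q)}"

definition join_irred :: "'a::order set" where
  "join_irred = {p. card (lower_nbrs p) = 1}"

definition lset :: "'a::order \<Rightarrow> 'a set" where
  "lset p = {q \<in> join_irred. q \<le> p}"

definition bigmeet :: "'a::bounded_lattice set \<Rightarrow> 'a" where
  "bigmeet A = Finite_Set.fold inf top A"

definition bigjoin :: "'a::bounded_lattice set \<Rightarrow> 'a" where
  "bigjoin A = Finite_Set.fold sup bot A"

definition poset_ideal :: "'a::order set \<Rightarrow> bool" where
  "poset_ideal I \<longleftrightarrow> (\<forall>x y. x \<in> I \<and> y \<le> x \<longrightarrow> y \<in> I)"

definition poset_coideal :: "'a::order set \<Rightarrow> bool" where
  "poset_coideal J \<longleftrightarrow> (\<forall>x y. x \<in> J \<and> x \<le> y \<longrightarrow> y \<in> J)"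

text \<open>variables: (p, True) is x_p, (p, False) is y_p, for p join-irreducible\<close>
definition hvars :: "('a::order \<times> bool) set" where
  "hvars = join_irred \<times> UNIV"

definition uexp :: "'a::order \<Rightarrow> ('a \<times> bool) \<Rightarrow>\<^sub>0 nat" where
  "uexp q = (\<Sum>p\<in>lset q. Poly_Mapping.single (p, True) 1)
          + (\<Sum>p\<in>join_irred - lset q. Poly_Mapping.single (p, False) 1)"

definition umon :: "'a::order \<Rightarrow> ('a \<times> bool, 'k::comm_ring_1) mpoly" where
  "umon q = Poly_Mapping.single (uexp q) 1"

definition Hid :: "'a::order set \<Rightarrow> ('a \<times> bool, 'k::comm_ring_1) mpoly set" where
  "Hid S = gen_ideal hvars (umon ` S)"

end

theory Submission
  imports Defs
begin

text \<open>
  Identify \<open>\<L>\<close> with the down-sets of \<open>P\<close> and call \<open>(B, T)\<close> a cell if all sets between \<open>B\<close>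
  and \<open>B \<union> T\<close> are down-sets. Conditions (2) and (3) both say that every cell satisfies
  \<open>B \<union> T \<in> \<I>\<close> or \<open>B \<in> \<J>\<close>.

  If they hold, the cells contained in \<open>\<I> \<inter> \<J>\<close> span a cubical complex with linear differential.
  It resolves the ideal: splitting off a maximal element \<open>m\<close> of \<open>P\<close> exhibits it as a mapping cone
  over three complexes of the same kind (\<open>m\<close> absent, \<open>m\<close> present, edges in direction \<open>m\<close>), and the
  only obstruction is that the ideals of the first two intersect in the ideal of the third.

  Conversely, let a cell have \<open>B \<notin> \<J>\<close> and \<open>B \<union> T \<notin> \<I>\<close>. By the hypothesis on \<open>H\<close>, the part of the
  fundamental cycle of the cross polytope on \<open>T\<close> indexed by \<open>\<I> - \<J>\<close> has its Koszul boundary in the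
  ideal. A linear resolution, through a zigzag with the Koszul complex, makes this boundary also that
  of a chain with coefficients in the ideal. The difference of the two chains is a cycle that is
  nonzero at \<open>B\<close> and zero at \<open>B \<union> T\<close>; but the coefficients of a cycle at adjacent facets agree up to sign.
\<close>

section \<open>Monomials and homogeneous polynomials\<close>

text \<open>The hypothesis on H enters the converse as an interpolation property: u_p u_q lies in
  both ideals, so whenever p \<le> q with p in I and q in J, some element of I \<inter> J lies
  between them. Hence an edge leaving I - J upwards ends in I \<inter> J; one leaving it downwards
  does so because I is closed downwards. This is why the boundary of the truncated cross-polytope
  cycle has coefficients in H. Their degree is one more than that of the generators, and there the
  Koszul homology of H, which is Tor against K, has to vanish if the resolution is linear.

  For exactness the obstacle is the induction. After splitting off m, the edge piece pairs the ideal
  shifted by m with the unshifted coideal, on down-sets forced to contain everything below m.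
  \<open>linked\<close> is the form of the cell condition that all three pieces inherit.

  The characteristic is arbitrary. Alternating functions must therefore vanish on repetitions by
  definition, and lifts must respect negation even where v = - v.\<close>

declare One_nat_def [simp del]

abbreviation var :: "'v \<Rightarrow> ('v, 'k::comm_ring_1) mpoly" where
  "var v \<equiv> Poly_Mapping.single (Poly_Mapping.single v 1) 1"

abbreviation lk :: "('a, 'b::zero) poly_mapping \<Rightarrow> 'a \<Rightarrow> 'b" where
  "lk \<equiv> Poly_Mapping.lookup"

lemma lookup_single_mult:
  fixes p :: "('v, 'k::comm_ring_1) mpoly"
  shows "lk (Poly_Mapping.single m c * p) (m + n) = c * lk p n"
proof -
  have "lk (Poly_Mapping.single m c * p) (m + n)
      = (\<Sum>l. (c * (\<Sum>q. lk p q when m + n = l + q)) when m = l)"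
    by (simp only: lookup_mult lookup_single when_mult)
  also have "\<dots> = c * (\<Sum>q. lk p q when m + n = m + q)"
    by (rule Sum_any_when_equal')
  also have "\<dots> = c * (\<Sum>q. lk p q when n = q)" by (simp only: add_left_cancel)
  also have "\<dots> = c * lk p n" by (simp only: Sum_any_when_equal')
  finally show ?thesis .
qed

lemma lookup_single_mult_nz:
  fixes p :: "('v, 'k::comm_ring_1) mpoly"
  assumes "lk (Poly_Mapping.single m c * p) n \<noteq> 0"
  shows "\<exists>r. n = m + r \<and> lk p r \<noteq> 0"
proof -
  have "n \<in> Poly_Mapping.keys (Poly_Mapping.single m c * p)" using assms by (simp add: in_keys_iff)
  then obtain a b where "n = a + b" "a \<in> Poly_Mapping.keys (Poly_Mapping.single m c)" "b \<in> Poly_Mapping.keys p"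
    using keys_mult by fastforce
  then show ?thesis by (auto simp: in_keys_iff lookup_single when_def split: if_splits)
qed

lemma var_split:
  fixes n :: "'v \<Rightarrow>\<^sub>0 nat"
  assumes "lk n v > 0"
  shows "\<exists>r. n = Poly_Mapping.single v 1 + r"
proof
  show "n = Poly_Mapping.single v 1 + (n - Poly_Mapping.single v 1)"
    by (rule poly_mapping_eqI) (use assms in \<open>auto simp: lookup_add lookup_minus lookup_single when_def\<close>)
qed

lemma lookup_var_mult_nz:
  fixes p :: "('v, 'k::comm_ring_1) mpoly"
  assumes "lk (var v * p) n \<noteq> 0"
  shows "lk n v > 0"
  using lookup_single_mult_nz[OF assms] by (auto simp: lookup_add)

lemma var_mult_cancel:
  fixes p q :: "('v, 'k::comm_ring_1) mpoly"
  assumes "var v * p = var v * q"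
  shows "p = q"
proof (rule poly_mapping_eqI)
  fix n
  have "1 * lk p n = 1 * lk q n"
    using assms lookup_single_mult[of "Poly_Mapping.single v 1" 1 p n]
      lookup_single_mult[of "Poly_Mapping.single v 1" 1 q n] by simp
  then show "lk p n = lk q n" by simp
qed

lemma var_factor:
  fixes p :: "('v, 'k::comm_ring_1) mpoly"
  assumes "\<And>n. n \<in> Poly_Mapping.keys p \<Longrightarrow> lk n v > 0"
  shows "\<exists>q. p = var v * q"
proof -
  let ?s = "Poly_Mapping.single v 1 :: 'v \<Rightarrow>\<^sub>0 nat"
  \<comment> \<open>The quotient pulls the coefficients back along multiplication by
    \<open>v\<close>; on monomials free of \<open>v\<close> both sides are zero.\<close>
  define q where "q = Poly_Mapping.map_key (\<lambda>n. ?s + n) p"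
  have inj: "inj (\<lambda>n. ?s + n)" by (auto simp: inj_on_def)
  have q: "lk q n = lk p (?s + n)" for n
    unfolding q_def using map_key.rep_eq[OF inj] by (metis comp_apply)
  have "p = var v * q"
  proof (rule poly_mapping_eqI)
    fix n
    show "lk p n = lk (var v * q) n"
    proof (cases "lk n v > 0")
      case True
      obtain r where "n = ?s + r" using var_split[OF True] by (elim exE)
      then show ?thesis by (simp only: lookup_single_mult q mult_1)
    next
      case False
      then have "lk p n = 0" "lk (var v * q) n = 0"
        using assms[of n] lookup_var_mult_nz[of v q n] by (auto simp only: in_keys_iff)
      then show ?thesis by simp
    qed
  qed
  then show ?thesis by blast
qed

lemma keys_plus_nat:
  fixes m n :: "'v \<Rightarrow>\<^sub>0 nat"
  shows "Poly_Mapping.keys (m + n) = Poly_Mapping.keys m \<union> Poly_Mapping.keys n"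
  by (auto simp: in_keys_iff lookup_add)

lemma mdeg_superset:
  assumes "finite A" "Poly_Mapping.keys m \<subseteq> A"
  shows "mdeg m = (\<Sum>v\<in>A. lk m v)"
  unfolding mdeg_def using assms
  by (intro sum.mono_neutral_left) (auto simp: in_keys_iff)

lemma mdeg_plus: "mdeg (m + n) = mdeg m + mdeg n"
proof -
  let ?A = "Poly_Mapping.keys m \<union> Poly_Mapping.keys n"
  have "mdeg (m + n) = (\<Sum>v\<in>?A. lk (m + n) v)"
    by (rule mdeg_superset) (auto simp: keys_plus_nat)
  also have "\<dots> = (\<Sum>v\<in>?A. lk m v) + (\<Sum>v\<in>?A. lk n v)"
    by (simp add: lookup_add sum.distrib)
  also have "\<dots> = mdeg m + mdeg n"
    using mdeg_superset[of ?A m] mdeg_superset[of ?A n] by simp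
  finally show ?thesis .
qed

lemma mdeg_single [simp]: "mdeg (Poly_Mapping.single v n) = n"
  by (simp add: mdeg_def)

lemma mdeg_zero [simp]: "mdeg 0 = 0"
  by (simp add: mdeg_def)

lemma mdeg_sum: "mdeg (sum f A) = (\<Sum>x\<in>A. mdeg (f x))"
  by (induction A rule: infinite_finite_induct) (auto simp: mdeg_plus)

lemma mdeg_eq_0: "mdeg m = 0 \<Longrightarrow> m = 0"
  unfolding mdeg_def by (metis finite_keys in_keys_iff keys_eq_empty sum_eq_0_iff ex_in_conv)

section \<open>Polynomials in a given set of variables, and homogeneity\<close>

lemma polyR_zero [simp]: "0 \<in> polyR V"
  by (simp add: polyR_def)

lemma polyR_uminus: "p \<in> polyR V \<Longrightarrow> - p \<in> polyR (V :: 'v set)" for p :: "('v, 'k::comm_ring_1) mpoly"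
  by (auto simp: polyR_def in_keys_iff)

lemma polyR_add: "p \<in> polyR V \<Longrightarrow> q \<in> polyR V \<Longrightarrow> p + q \<in> polyR V" for p :: "('v, 'k::comm_ring_1) mpoly"
  using keys_add[of p q] by (auto simp: polyR_def)

lemma polyR_diff: "p \<in> polyR V \<Longrightarrow> q \<in> polyR V \<Longrightarrow> p - q \<in> polyR V" for p :: "('v, 'k::comm_ring_1) mpoly"
  using polyR_add[of p V "- q"] polyR_uminus[of q V] by simp

lemma polyR_sum: "(\<And>x. x \<in> A \<Longrightarrow> f x \<in> polyR V) \<Longrightarrow> sum f A \<in> polyR V" for f :: "'b \<Rightarrow> ('v, 'k::comm_ring_1) mpoly"
  by (induction A rule: infinite_finite_induct) (auto intro: polyR_add)

lemma polyR_mult: "p \<in> polyR V \<Longrightarrow> q \<in> polyR V \<Longrightarrow> p * q \<in> polyR V" for p :: "('v, 'k::comm_ring_1) mpoly"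
  using keys_mult[of p q] by (fastforce simp: polyR_def keys_plus_nat)

lemma polyR_single: "Poly_Mapping.keys m \<subseteq> V \<Longrightarrow> Poly_Mapping.single m c \<in> polyR V"
  by (auto simp: polyR_def split: if_splits)

lemma polyR_var: "v \<in> V \<Longrightarrow> var v \<in> polyR V"
  by (rule polyR_single) auto

lemma polyR_one [simp]: "1 \<in> polyR V"
  by (auto simp: polyR_def)

lemma polyR_var_cancel:
  fixes p :: "('v, 'k::comm_ring_1) mpoly"
  assumes "var v * p \<in> polyR V"
  shows "p \<in> polyR V"
  unfolding polyR_def
proof (intro CollectI ballI)
  fix m assume "m \<in> Poly_Mapping.keys p"
  then have "Poly_Mapping.single v 1 + m \<in> Poly_Mapping.keys (var v * p)"
    using lookup_single_mult[of "Poly_Mapping.single v 1" 1 p m] by (simp add: in_keys_iff)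
  then have "Poly_Mapping.keys (Poly_Mapping.single v 1 + m) \<subseteq> V"
    using assms unfolding polyR_def by blast
  then show "Poly_Mapping.keys m \<subseteq> V" unfolding keys_plus_nat by blast
qed

lemma homog_zero [simp]: "homog e 0"
  by (simp add: homog_def)

lemma homog_uminus: "homog e p \<Longrightarrow> homog e (- p)" for p :: "('v, 'k::comm_ring_1) mpoly"
  by (auto simp: homog_def in_keys_iff)

lemma homog_add: "homog e p \<Longrightarrow> homog e q \<Longrightarrow> homog e (p + q)" for p :: "('v, 'k::comm_ring_1) mpoly"
  using keys_add[of p q] by (auto simp: homog_def)

lemma homog_diff: "homog e p \<Longrightarrow> homog e q \<Longrightarrow> homog e (p - q)" for p :: "('v, 'k::comm_ring_1) mpoly"
  using homog_add[of e p "- q"] homog_uminus[of e q] by simp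

lemma homog_sum: "(\<And>x. x \<in> A \<Longrightarrow> homog e (f x)) \<Longrightarrow> homog e (sum f A)" for f :: "'b \<Rightarrow> ('v, 'k::comm_ring_1) mpoly"
  by (induction A rule: infinite_finite_induct) (auto intro: homog_add)

lemma homog_mult: "homog d p \<Longrightarrow> homog e q \<Longrightarrow> homog (d + e) (p * q)" for p :: "('v, 'k::comm_ring_1) mpoly"
  using keys_mult[of p q] by (fastforce simp: homog_def mdeg_plus)

lemma homog_single: "mdeg m = e \<Longrightarrow> homog e (Poly_Mapping.single m c)"
  by (auto simp: homog_def split: if_splits)

lemma homog_var: "homog 1 (var v)"
  by (rule homog_single) simp

text \<open>\<open>lin_res\<close> states exactness for arbitrary vectors, whereas the zigzag needs
  lifts of prescribed degree; taking a component makes them homogeneous.\<close>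

definition hcomp :: "nat \<Rightarrow> ('v, 'k::comm_ring_1) mpoly \<Rightarrow> ('v, 'k) mpoly" where
  "hcomp e p = Poly_Mapping.mapp (\<lambda>m c. if mdeg m = e then c else 0) p"

lemma lookup_hcomp: "lk (hcomp e p) m = (if mdeg m = e then lk p m else 0)"
  by (auto simp: hcomp_def lookup_mapp when_def in_keys_iff)

lemma homog_hcomp: "homog e (hcomp e p)"
  by (auto simp: homog_def in_keys_iff lookup_hcomp split: if_splits)

lemma polyR_hcomp: "p \<in> polyR V \<Longrightarrow> hcomp e p \<in> polyR V"
  by (auto simp: polyR_def in_keys_iff lookup_hcomp split: if_splits)

lemma hcomp_sum: "hcomp e (sum f A) = (\<Sum>x\<in>A. hcomp e (f x))"
  by (rule poly_mapping_eqI) (auto simp: lookup_hcomp lookup_sum)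

lemma hcomp_homog: "homog e p \<Longrightarrow> hcomp e p = p"
  by (rule poly_mapping_eqI) (auto simp: lookup_hcomp homog_def in_keys_iff)

lemma hcomp_add: "hcomp e (p + q) = hcomp e p + hcomp e q"
  by (rule poly_mapping_eqI) (auto simp: lookup_hcomp lookup_add)

text \<open>A factor of degree \<open>d\<close> shifts all degrees by \<open>d\<close>, so the part
  of \<open>q\<close> outside degree \<open>e\<close> never reaches degree
  \<open>d + e\<close>.\<close>

lemma hcomp_homog_mult:
  fixes p q :: "('v, 'k::comm_ring_1) mpoly"
  assumes "homog d p"
  shows "hcomp (d + e) (p * q) = p * hcomp e q"
proof -
  define r where "r = q - hcomp e q"
  have r: "lk r m = 0" if "mdeg m = e" for m
    using that by (simp add: r_def lookup_minus lookup_hcomp)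
  have "hcomp (d + e) (p * r) = 0"
  proof (rule poly_mapping_eqI)
    fix m
    have "lk (p * r) m = 0" if "mdeg m = d + e"
    proof (rule ccontr)
      assume "lk (p * r) m \<noteq> 0"
      then obtain a b where "m = a + b" "a \<in> Poly_Mapping.keys p" "b \<in> Poly_Mapping.keys r"
        using keys_mult[of p r] by (auto simp: in_keys_iff)
      then show False using assms that r[of b] by (auto simp: homog_def mdeg_plus in_keys_iff)
    qed
    then show "lk (hcomp (d + e) (p * r)) m = lk 0 m" by (simp add: lookup_hcomp)
  qed
  moreover have "p * q = p * r + p * hcomp e q" by (simp add: r_def algebra_simps)
  ultimately show ?thesis
    using hcomp_homog[OF homog_mult[OF assms homog_hcomp[of e q]]] by (simp add: hcomp_add)
qed

section \<open>Cubical complexes\<close>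

text \<open>On sets avoiding \<open>m\<close> this is the half of \<open>F\<close> whose members
  contain \<open>m\<close>, moved to the cube without the direction \<open>m\<close>.\<close>

definition slice :: "'a \<Rightarrow> 'a set set \<Rightarrow> 'a set set" where
  "slice m F = {A. insert m A \<in> F}"

text \<open>A word of length \<open>length xs\<close> encodes a face of the cube of subsets of \<open>set xs\<close>: a position is
  present (\<open>Some True\<close>), absent (\<open>Some False\<close>) or free (\<open>None\<close>). All vertices of the face must lie in \<open>F\<close>.\<close>
fun cellp :: "'a list \<Rightarrow> 'a set set \<Rightarrow> bool option list \<Rightarrow> bool" where
  "cellp [] F [] \<longleftrightarrow> {} \<in> F"
| "cellp (m # xs) F (Some False # w) \<longleftrightarrow> cellp xs F w"
| "cellp (m # xs) F (Some True # w) \<longleftrightarrow> cellp xs (slice m F) w"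
| "cellp (m # xs) F (None # w) \<longleftrightarrow> cellp xs (F \<inter> slice m F) w"
| "cellp _ _ _ \<longleftrightarrow> False"

type_synonym ('a, 'k) chain = "bool option list \<Rightarrow> ('a \<times> bool, 'k) mpoly"

text \<open>An edge in direction \<open>m\<close> has boundary x_m times its absent end minus y_m
  times its present end, the syzygy between the weights y_m and x_m of the two ends in
  \<open>aug\<close>. \<open>bd\<close> is the differential of the tensor product of these two-term
  complexes over all directions; the minus sign in the \<open>None\<close> clause is the usual one
  that makes it square to zero.\<close>

fun bd :: "'a list \<Rightarrow> ('a, 'k::comm_ring_1) chain \<Rightarrow> ('a, 'k) chain" where
  "bd (m # xs) z (Some False # w) = bd xs (\<lambda>w. z (Some False # w)) w + var (m, True) * z (None # w)"
| "bd (m # xs) z (Some True # w) = bd xs (\<lambda>w. z (Some True # w)) w - var (m, False) * z (None # w)"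
| "bd (m # xs) z (None # w) = - bd xs (\<lambda>w. z (None # w)) w"
| "bd _ _ _ = 0"

fun aug :: "'a list \<Rightarrow> ('a, 'k::comm_ring_1) chain \<Rightarrow> ('a \<times> bool, 'k) mpoly" where
  "aug [] z = z []"
| "aug (m # xs) z = var (m, False) * aug xs (\<lambda>w. z (Some False # w))
      + var (m, True) * aug xs (\<lambda>w. z (Some True # w))"

definition is_chain :: "'a list \<Rightarrow> 'a set set \<Rightarrow> ('a \<times> bool) set \<Rightarrow> ('a, 'k::comm_ring_1) chain \<Rightarrow> bool" where
  "is_chain xs F V z \<longleftrightarrow> (\<forall>w. z w \<in> polyR V \<and> (z w \<noteq> 0 \<longrightarrow> cellp xs F w))"

text \<open>The last clause makes the monomial ideals of \<open>F\<close> and \<open>slice m F\<close> intersect in that of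
  \<open>F \<inter> slice m F\<close>.\<close>
fun good :: "'a list \<Rightarrow> 'a set set \<Rightarrow> bool" where
  "good [] F \<longleftrightarrow> True"
| "good (m # xs) F \<longleftrightarrow> good xs F \<and> good xs (slice m F) \<and> good xs (F \<inter> slice m F) \<and>
     (\<forall>A\<in>F. \<forall>B\<in>slice m F. A \<subseteq> set xs \<longrightarrow> B \<subseteq> set xs \<longrightarrow>
        (\<exists>C\<in>F \<inter> slice m F. A \<inter> B \<subseteq> C \<and> C \<subseteq> A \<union> B))"

lemma word_cases:
  assumes "w = [] \<Longrightarrow> P" "\<And>v. w = Some False # v \<Longrightarrow> P" "\<And>v. w = Some True # v \<Longrightarrow> P"
    "\<And>v. w = None # v \<Longrightarrow> P"
  shows P
  using assms by (metis (full_types) neq_Nil_conv option.exhaust)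

section \<open>Chains of a cubical complex, their boundary and augmentation\<close>

lemma cellp_mono: "cellp xs F w \<Longrightarrow> F \<subseteq> G \<Longrightarrow> cellp xs G w"
proof (induction xs F w arbitrary: G rule: cellp.induct)
  case (3 m xs F w)
  then have "slice m F \<subseteq> slice m G" by (auto simp: slice_def)
  with 3 show ?case by simp
next
  case (4 m xs F w)
  then have "F \<inter> slice m F \<subseteq> G \<inter> slice m G" by (auto simp: slice_def)
  with 4 show ?case by simp
qed auto

lemma cellp_length: "cellp xs F w \<Longrightarrow> length w = length xs"
  by (induction xs F w rule: cellp.induct) auto

lemma bd_Nil [simp]: "bd [] z w = 0"
  by simp

lemma bd_word_Nil [simp]: "bd xs z [] = 0"
  by (cases xs) auto

lemma bd_zero: "bd xs (\<lambda>w. 0) w = 0"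
  by (induction xs "(\<lambda>w. 0) :: ('a, 'k::comm_ring_1) chain" w rule: bd.induct) auto

lemma bd_add: "bd xs (\<lambda>w. z w + z' w) w = bd xs z w + bd xs z' w"
proof (induction xs arbitrary: z z' w)
  case (Cons m xs)
  then show ?case
    by (cases w rule: word_cases) (auto simp: algebra_simps)
qed simp

lemma bd_mult: "bd xs (\<lambda>w. c * z w) w = c * bd xs z w"
proof (induction xs arbitrary: z w)
  case (Cons m xs)
  then show ?case
    by (cases w rule: word_cases) (auto simp: algebra_simps)
qed simp

lemma bd_minus: "bd xs (\<lambda>w. - z w) w = - bd xs z w"
  using bd_mult[of xs "-1" z w] by simp

lemma bd_diff: "bd xs (\<lambda>w. z w - z' w) w = bd xs z w - bd xs z' w"
  using bd_add[of xs z "\<lambda>w. - z' w" w] by (simp add: bd_minus)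

lemma bd_sum: "bd xs (\<lambda>w. \<Sum>a\<in>A. z a w) w = (\<Sum>a\<in>A. bd xs (z a) w)"
  by (induction A rule: infinite_finite_induct) (auto simp: bd_zero bd_add)

lemma aug_zero: "aug xs (\<lambda>w. 0) = 0"
  by (induction xs) auto

lemma aug_add: "aug xs (\<lambda>w. z w + z' w) = aug xs z + aug xs z'"
  by (induction xs arbitrary: z z') (auto simp: algebra_simps)

lemma aug_mult: "aug xs (\<lambda>w. c * z w) = c * aug xs z"
  by (induction xs arbitrary: z) (auto simp: algebra_simps)

lemma aug_minus: "aug xs (\<lambda>w. - z w) = - aug xs z"
  using aug_mult[of xs "-1" z] by simp

lemma aug_diff: "aug xs (\<lambda>w. z w - z' w) = aug xs z - aug xs z'"
  using aug_add[of xs z "\<lambda>w. - z' w"] by (simp add: aug_minus)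

lemma aug_sum: "aug xs (\<lambda>w. \<Sum>a\<in>A. z a w) = (\<Sum>a\<in>A. aug xs (z a))"
  by (induction A rule: infinite_finite_induct) (auto simp: aug_zero aug_add)

lemma bd_bd: "bd xs (bd xs z) w = 0"
proof (induction xs arbitrary: z w)
  case (Cons m xs)
  show ?case
    by (cases w rule: word_cases) (auto simp: Cons.IH bd_add bd_diff bd_minus bd_mult)
qed simp

lemma aug_bd: "aug xs (bd xs z) = 0"
proof (induction xs arbitrary: z)
  case (Cons m xs)
  show ?case
    by (auto simp: Cons.IH aug_add aug_diff aug_minus aug_mult mult.left_commute)
qed simp

lemma is_chain_zero: "is_chain xs F V (\<lambda>w. 0)"
  by (auto simp: is_chain_def)

lemma is_chain_add: "is_chain xs F V z \<Longrightarrow> is_chain xs F V z' \<Longrightarrow> is_chain xs F V (\<lambda>w. z w + z' w)"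
  unfolding is_chain_def by (metis add_0 add_0_right polyR_add)

lemma is_chain_mult: "is_chain xs F V z \<Longrightarrow> c \<in> polyR V \<Longrightarrow> is_chain xs F V (\<lambda>w. c * z w)"
  unfolding is_chain_def by (metis mult_zero_right polyR_mult)

lemma is_chain_minus: "is_chain xs F V z \<Longrightarrow> is_chain xs F V (\<lambda>w. - z w)"
  unfolding is_chain_def by (metis neg_equal_0_iff_equal polyR_uminus)

lemma is_chain_diff: "is_chain xs F V z \<Longrightarrow> is_chain xs F V z' \<Longrightarrow> is_chain xs F V (\<lambda>w. z w - z' w)"
  using is_chain_add[of xs F V z "\<lambda>w. - z' w"] is_chain_minus[of xs F V z'] by simp

lemma is_chain_mono: "is_chain xs F V z \<Longrightarrow> F \<subseteq> G \<Longrightarrow> is_chain xs G V z"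
  unfolding is_chain_def by (blast intro: cellp_mono)

lemma is_chain_Cons:
  "is_chain (m # xs) F V z \<longleftrightarrow> z [] = 0 \<and> is_chain xs F V (\<lambda>w. z (Some False # w)) \<and>
    is_chain xs (slice m F) V (\<lambda>w. z (Some True # w)) \<and>
    is_chain xs (F \<inter> slice m F) V (\<lambda>w. z (None # w))" (is "?l \<longleftrightarrow> ?r")
proof
  assume ?l
  then show ?r unfolding is_chain_def
    by (metis cellp.simps(2-4) cellp.simps(5))
next
  assume r: ?r
  show ?l unfolding is_chain_def
  proof (intro allI)
    fix w
    show "z w \<in> polyR V \<and> (z w \<noteq> 0 \<longrightarrow> cellp (m # xs) F w)"
      by (cases w rule: word_cases) (use r in \<open>auto simp: is_chain_def\<close>)
  qed
qed

lemma is_chain_bd: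
  assumes "is_chain xs F V z" "set xs \<times> UNIV \<subseteq> V"
  shows "is_chain xs F V (bd xs z)"
  using assms
proof (induction xs arbitrary: F z)
  case Nil
  then show ?case by (simp add: is_chain_zero)
next
  case (Cons m xs)
  have c: "is_chain xs F V (\<lambda>w. z (Some False # w))" "is_chain xs (slice m F) V (\<lambda>w. z (Some True # w))"
    "is_chain xs (F \<inter> slice m F) V (\<lambda>w. z (None # w))"
    using Cons.prems(1) by (auto simp: is_chain_Cons)
  then have c': "is_chain xs F V (\<lambda>w. z (None # w))" "is_chain xs (slice m F) V (\<lambda>w. z (None # w))"
    by (auto elim: is_chain_mono)
  have V: "set xs \<times> UNIV \<subseteq> V" "(m, b) \<in> V" for b using Cons.prems(2) by auto
  show ?case unfolding is_chain_Cons
    using Cons.IH[OF c(1) V(1)] Cons.IH[OF c(2) V(1)] Cons.IH[OF c(3) V(1)] c'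
    by (auto intro!: is_chain_add is_chain_diff is_chain_minus is_chain_mult polyR_var V(2))
qed

lemma polyR_aug:
  assumes "is_chain xs F V z" "set xs \<times> UNIV \<subseteq> V"
  shows "aug xs z \<in> polyR V"
  using assms
proof (induction xs arbitrary: F z)
  case (Cons m xs)
  have V: "(m, b) \<in> V" "set xs \<times> UNIV \<subseteq> V" for b using Cons.prems(2) by auto
  have c: "is_chain xs F V (\<lambda>w. z (Some False # w))" "is_chain xs (slice m F) V (\<lambda>w. z (Some True # w))"
    using Cons.prems(1) by (auto simp: is_chain_Cons)
  show ?case using Cons.IH[OF c(1) V(2)] Cons.IH[OF c(2) V(2)]
    by (simp add: polyR_add polyR_mult polyR_var V(1))
qed (auto simp: is_chain_def)

text \<open>For polynomials over the variables at hand this is membership in the monomial ideal of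
  \<open>F\<close>: each monomial is divisible by the monomial of some vertex \<open>A\<close>.
  Divisibility is stated exponent by exponent, so that one direction can be split off.\<close>

definition mon_mem :: "'a list \<Rightarrow> 'a set set \<Rightarrow> ('a \<times> bool, 'k::comm_ring_1) mpoly \<Rightarrow> bool" where
  "mon_mem xs F h \<longleftrightarrow> (\<forall>n\<in>Poly_Mapping.keys h. \<exists>A\<in>F. A \<subseteq> set xs \<and> (\<forall>t\<in>set xs. lk n (t, t \<in> A) > 0))"

lemma mon_memD:
  assumes "mon_mem xs F h" "lk h n \<noteq> 0"
  obtains A where "A \<in> F" "A \<subseteq> set xs" "\<And>t. t \<in> set xs \<Longrightarrow> lk n (t, t \<in> A) > 0"
proof -
  have "n \<in> Poly_Mapping.keys h" using assms(2) by (simp add: in_keys_iff)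
  then show thesis using assms(1) that unfolding mon_mem_def by blast
qed

lemma mon_memI:
  assumes "\<And>n. lk h n \<noteq> 0 \<Longrightarrow> \<exists>A\<in>F. A \<subseteq> set xs \<and> (\<forall>t\<in>set xs. lk n (t, t \<in> A) > 0)"
  shows "mon_mem xs F h"
  unfolding mon_mem_def
proof
  fix n assume "n \<in> Poly_Mapping.keys h"
  then show "\<exists>A\<in>F. A \<subseteq> set xs \<and> (\<forall>t\<in>set xs. lk n (t, t \<in> A) > 0)"
    by (intro assms) (simp add: in_keys_iff)
qed

lemma mon_mem_add: "mon_mem xs F h \<Longrightarrow> mon_mem xs F h' \<Longrightarrow> mon_mem xs F (h + h')"
  using keys_add[of h h'] unfolding mon_mem_def by blast

lemma mon_mem_minus: "mon_mem xs F (- h) \<longleftrightarrow> mon_mem xs F h"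
  unfolding mon_mem_def by (simp add: in_keys_iff)

lemma mon_mem_var_mult:
  assumes "mon_mem xs F h"
  shows "mon_mem xs F (var v * h)"
proof (rule mon_memI)
  fix n assume "lk (var v * h) n \<noteq> 0"
  from lookup_single_mult_nz[OF this]
  obtain r where r: "n = Poly_Mapping.single v 1 + r" "lk h r \<noteq> 0" by (elim exE conjE)
  obtain A where "A\<in>F" "A \<subseteq> set xs" "\<And>t. t\<in>set xs \<Longrightarrow> lk r (t, t \<in> A) > 0"
    using mon_memD[OF assms r(2)] by blast
  then show "\<exists>A\<in>F. A \<subseteq> set xs \<and> (\<forall>t\<in>set xs. lk n (t, t \<in> A) > 0)"
    by (intro bexI[of _ A]) (simp_all add: r(1) lookup_add)
qed

text \<open>Divisibility is tested only in the directions of \<open>xs\<close>, and a variable in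
  another direction leaves those exponents alone.\<close>

lemma mon_mem_var_cancel:
  assumes "mon_mem xs F (var (m, b) * h)" "m \<notin> set xs"
  shows "mon_mem xs F h"
proof (rule mon_memI)
  fix n assume "lk h n \<noteq> 0"
  then have "lk (var (m, b) * h) (Poly_Mapping.single (m, b) 1 + n) \<noteq> 0"
    by (simp only: lookup_single_mult mult_1 not_False_eq_True)
  note nz = this
  obtain A where A: "A\<in>F" "A \<subseteq> set xs"
      "\<And>t. t\<in>set xs \<Longrightarrow> lk (Poly_Mapping.single (m, b) 1 + n) (t, t \<in> A) > 0"
    using mon_memD[OF assms(1) nz] by blast
  have "lk n (t, t \<in> A) > 0" if "t \<in> set xs" for t
  proof -
    have "m \<noteq> t" using that assms(2) by blast
    then show ?thesis using A(3)[OF that] by (simp add: lookup_add lookup_single)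
  qed
  then show "\<exists>A\<in>F. A \<subseteq> set xs \<and> (\<forall>t\<in>set xs. lk n (t, t \<in> A) > 0)"
    using A by (intro bexI[of _ A]) auto
qed

lemma mon_mem_aug:
  assumes "distinct xs" "is_chain xs F V z"
  shows "mon_mem xs F (aug xs z)"
  using assms
proof (induction xs arbitrary: F z)
  case Nil
  then show ?case by (auto simp: mon_mem_def is_chain_def in_keys_iff dest: spec[of _ "[]"])
next
  case (Cons m xs)
  have h0: "mon_mem xs F (aug xs (\<lambda>w. z (Some False # w)))" (is "mon_mem xs F ?a")
    and h1: "mon_mem xs (slice m F) (aug xs (\<lambda>w. z (Some True # w)))" (is "mon_mem xs _ ?b")
    using Cons by (auto simp: is_chain_Cons)
  have m: "m \<notin> set xs" using Cons.prems by auto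
  have "mon_mem (m # xs) F (var (m, False) * ?a)"
  proof (rule mon_memI)
    fix n assume n: "lk (var (m, False) * ?a) n \<noteq> 0"
    obtain A where A: "A\<in>F" "A \<subseteq> set xs" "\<And>t. t\<in>set xs \<Longrightarrow> lk n (t, t \<in> A) > 0"
      using mon_memD[OF mon_mem_var_mult[OF h0] n] by blast
    have "m \<notin> A" using A(2) m by blast
    then show "\<exists>A\<in>F. A \<subseteq> set (m # xs) \<and> (\<forall>t\<in>set (m # xs). lk n (t, t \<in> A) > 0)"
      using A lookup_var_mult_nz[OF n] by (intro bexI[of _ A]) auto
  qed
  moreover have "mon_mem (m # xs) F (var (m, True) * ?b)"
  proof (rule mon_memI)
    fix n assume n: "lk (var (m, True) * ?b) n \<noteq> 0"
    obtain A where A: "A\<in>slice m F" "A \<subseteq> set xs" "\<And>t. t\<in>set xs \<Longrightarrow> lk n (t, t \<in> A) > 0"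
      using mon_memD[OF mon_mem_var_mult[OF h1] n] by blast
    have "t \<noteq> m" if "t \<in> set xs" for t using that m by blast
    then show "\<exists>A\<in>F. A \<subseteq> set (m # xs) \<and> (\<forall>t\<in>set (m # xs). lk n (t, t \<in> A) > 0)"
      using A lookup_var_mult_nz[OF n] by (intro bexI[of _ "insert m A"]) (auto simp: slice_def)
  qed
  ultimately show ?case by (auto intro: mon_mem_add)
qed

definition restr :: "('m \<Rightarrow> bool) \<Rightarrow> ('m \<Rightarrow>\<^sub>0 'k::comm_ring_1) \<Rightarrow> ('m \<Rightarrow>\<^sub>0 'k)" where
  "restr P p = Poly_Mapping.mapp (\<lambda>m c. if P m then c else 0) p"

lemma lookup_restr: "lk (restr P p) m = (if P m then lk p m else 0)"
  by (auto simp: restr_def lookup_mapp when_def in_keys_iff)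

lemma restr_split: "p = restr P p + restr (\<lambda>n. \<not> P n) p"
  by (rule poly_mapping_eqI) (simp add: lookup_add lookup_restr)

lemma polyR_restr: "p \<in> polyR V \<Longrightarrow> restr P p \<in> polyR V"
  by (auto simp: polyR_def in_keys_iff lookup_restr split: if_splits)

text \<open>Each monomial of \<open>h\<close> is charged to the half with \<open>m\<close> absent
  whenever this is possible and to the half with \<open>m\<close> present otherwise. Dividing the
  two parts by y_m and x_m leaves members of the ideals of \<open>F\<close> and
  \<open>slice m F\<close>. Only vertices receive coefficients, hence the boundary vanishes.\<close>

lemma aug_surj:
  assumes "distinct xs" "mon_mem xs F h" "h \<in> polyR V"
  shows "\<exists>z. is_chain xs F V z \<and> bd xs z = (\<lambda>_. 0) \<and> aug xs z = h"
  using assms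
proof (induction xs arbitrary: F h)
  case Nil
  show ?case
  proof (intro exI conjI)
    show "is_chain [] F V (\<lambda>w. if w = [] then h else 0)"
      using Nil by (auto simp: is_chain_def mon_mem_def)
  qed (auto)
next
  case (Cons m xs)
  define P where "P n \<longleftrightarrow> lk n (m, False) > 0 \<and> (\<exists>A\<in>F. A \<subseteq> set xs \<and> (\<forall>t\<in>set xs. lk n (t, t \<in> A) > 0))"
    for n :: "'a \<times> bool \<Rightarrow>\<^sub>0 nat"
  let ?a = "restr P h" and ?b = "restr (\<lambda>n. \<not> P n) h"
  have m: "m \<notin> set xs" and dist: "distinct xs" using Cons.prems by auto
  have key: "lk n (m, True) > 0 \<and> (\<exists>A\<in>slice m F. A \<subseteq> set xs \<and> (\<forall>t\<in>set xs. lk n (t, t \<in> A) > 0))"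
    if "n \<in> Poly_Mapping.keys ?b" for n
  proof -
    have n: "n \<in> Poly_Mapping.keys h" "\<not> P n" using that by (auto simp: in_keys_iff lookup_restr split: if_splits)
    then obtain A where A: "A \<in> F" "A \<subseteq> insert m (set xs)" "\<forall>t\<in>insert m (set xs). lk n (t, t \<in> A) > 0"
      using Cons.prems(2) unfolding mon_mem_def by auto
    have "m \<in> A"
    proof (rule ccontr)
      assume "m \<notin> A"
      then have "P n" unfolding P_def using A by (intro conjI bexI[of _ A]) auto
      with n show False by simp
    qed
    then have "insert m (A - {m}) = A" by blast
    moreover have "t \<noteq> m" if "t \<in> set xs" for t using m that by blast
    ultimately show ?thesis using A m \<open>m \<in> A\<close>
      by (intro conjI bexI[of _ "A - {m}"]) (auto simp: slice_def)
  qed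
  have "\<exists>a. ?a = var (m, False) * a"
    by (rule var_factor) (auto simp: in_keys_iff lookup_restr P_def split: if_splits)
  then obtain a where a: "?a = var (m, False) * a" by (elim exE)
  have "\<exists>b. ?b = var (m, True) * b"
    by (rule var_factor) (rule key[THEN conjunct1])
  then obtain b where b: "?b = var (m, True) * b" by (elim exE)
  have "a \<in> polyR V" "b \<in> polyR V"
    using polyR_restr[OF Cons.prems(3)] a b polyR_var_cancel by metis+
  moreover have "mon_mem xs F a"
  proof (rule mon_mem_var_cancel[OF _ m])
    show "mon_mem xs F (var (m, False) * a)"
      unfolding a[symmetric] by (auto simp: mon_mem_def in_keys_iff lookup_restr P_def split: if_splits)
  qed
  moreover have "mon_mem xs (slice m F) b"
  proof (rule mon_mem_var_cancel[OF _ m])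
    show "mon_mem xs (slice m F) (var (m, True) * b)"
      unfolding b[symmetric] using key by (auto simp: mon_mem_def)
  qed
  ultimately obtain u v where u: "is_chain xs F V u" "bd xs u = (\<lambda>_. 0)" "aug xs u = a"
    and v: "is_chain xs (slice m F) V v" "bd xs v = (\<lambda>_. 0)" "aug xs v = b"
    using Cons.IH[OF dist] by blast
  define z where "z w = (case w of [] \<Rightarrow> 0 | None # w \<Rightarrow> 0 | Some False # w \<Rightarrow> u w | Some True # w \<Rightarrow> v w)" for w
  have z: "z [] = 0" "\<And>w. z (None # w) = 0" "\<And>w. z (Some False # w) = u w" "\<And>w. z (Some True # w) = v w"
    by (auto simp: z_def)
  have "is_chain (m # xs) F V z" by (simp add: is_chain_Cons z u v is_chain_zero)
  moreover have "bd (m # xs) z w = 0" for w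
    by (cases w rule: word_cases) (auto simp: z u v bd_zero)
  moreover have "aug (m # xs) z = h"
    using restr_split[of h P] by (simp add: z u v a b)
  ultimately show ?case by blast
qed

text \<open>A set between the intersection and the union agrees at each element with
  \<open>A\<close> or with \<open>B\<close>, so its monomial divides the least common multiple of
  theirs.\<close>

lemma mon_mem_Int:
  assumes "mon_mem xs F h" "mon_mem xs G h"
    and "\<And>A B. A \<in> F \<Longrightarrow> B \<in> G \<Longrightarrow> A \<subseteq> set xs \<Longrightarrow> B \<subseteq> set xs \<Longrightarrow> \<exists>C\<in>F \<inter> G. A \<inter> B \<subseteq> C \<and> C \<subseteq> A \<union> B"
  shows "mon_mem xs (F \<inter> G) h"
  unfolding mon_mem_def
proof
  fix n assume n: "n \<in> Poly_Mapping.keys h"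
  obtain A where A: "A\<in>F" "A \<subseteq> set xs" "\<forall>t\<in>set xs. lk n (t, t \<in> A) > 0"
    using assms(1) n unfolding mon_mem_def by blast
  obtain B where B: "B\<in>G" "B \<subseteq> set xs" "\<forall>t\<in>set xs. lk n (t, t \<in> B) > 0"
    using assms(2) n unfolding mon_mem_def by blast
  obtain C where C: "C\<in>F \<inter> G" "A \<inter> B \<subseteq> C" "C \<subseteq> A \<union> B" using assms(3) A B by blast
  have "lk n (t, t \<in> C) > 0" if "t \<in> set xs" for t
  proof -
    have "(t \<in> C) = (t \<in> A) \<or> (t \<in> C) = (t \<in> B)" using C by blast
    then show ?thesis
    proof
      assume "(t \<in> C) = (t \<in> A)"
      then show ?thesis using A(3) that by simp
    next
      assume "(t \<in> C) = (t \<in> B)"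
      then show ?thesis using B(3) that by simp
    qed
  qed
  then show "\<exists>A\<in>F \<inter> G. A \<subseteq> set xs \<and> (\<forall>t\<in>set xs. lk n (t, t \<in> A) > 0)"
    using A(2) B(2) C by (intro bexI[of _ C]) auto
qed

text \<open>The free component \<open>z2\<close> of a cycle is itself a cycle, hence a boundary \<open>bd w2\<close>; correcting by \<open>w2\<close> leaves
  two cycles on the faces \<open>m\<close> absent and \<open>m\<close> present, whose augmentations \<open>X h\<close> and \<open>- Y h\<close>
  are removed by an edge chain augmenting to \<open>h\<close>.\<close>
theorem cube_complex_exact:
  fixes z :: "('a, 'k::comm_ring_1) chain"
  assumes "distinct xs" "good xs F" "set xs \<times> UNIV \<subseteq> V" "is_chain xs F V z"
    "\<And>w. bd xs z w = 0" "aug xs z = 0"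
  shows "\<exists>y. is_chain xs F V y \<and> bd xs y = z"
  using assms
proof (induction xs arbitrary: F z)
  case Nil
  have "z w = 0" for w
    using Nil by (cases w) (auto simp: is_chain_def)
  then show ?case using is_chain_zero[of "[]" F V] by (intro exI[of _ "\<lambda>_. 0"]) (auto simp: fun_eq_iff)
next
  case (Cons m xs)
  let ?X = "var (m, True) :: ('a \<times> bool, 'k) mpoly" and ?Y = "var (m, False) :: ('a \<times> bool, 'k) mpoly"
  let ?G = "slice m F" and ?H = "F \<inter> slice m F"
  have m: "m \<notin> set xs" and dist: "distinct xs" using Cons.prems by auto
  have g: "good xs F" "good xs ?G" "good xs ?H" using Cons.prems by auto
  have V: "set xs \<times> UNIV \<subseteq> V" using Cons.prems(3) by auto
  have XV: "?X \<in> polyR V" "?Y \<in> polyR V" using Cons.prems(3) by (auto intro: polyR_var)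
  define z0 z1 z2 where "z0 = (\<lambda>w. z (Some False # w))" and "z1 = (\<lambda>w. z (Some True # w))"
    and "z2 = (\<lambda>w. z (None # w))"
  have c: "is_chain xs F V z0" "is_chain xs ?G V z1" "is_chain xs ?H V z2" and z_Nil: "z [] = 0"
    using Cons.prems(4) by (auto simp: is_chain_Cons z0_def z1_def z2_def)
  have b0: "bd xs z0 w = - (?X * z2 w)" for w
    using Cons.prems(5)[of "Some False # w"] by (simp add: z0_def z2_def eq_neg_iff_add_eq_0)
  have b1: "bd xs z1 w = ?Y * z2 w" for w
    using Cons.prems(5)[of "Some True # w"] by (simp add: z1_def z2_def)
  have b2: "bd xs z2 w = 0" for w
    using Cons.prems(5)[of "None # w"] by (simp add: z2_def)
  have ag: "?Y * aug xs z0 + ?X * aug xs z1 = 0"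
    using Cons.prems(6) by (simp add: z0_def z1_def)
  have "aug xs (\<lambda>w. ?X * z2 w) = 0"
    using aug_bd[of xs z0] by (simp add: b0[abs_def] aug_minus)
  then have "?X * aug xs z2 = ?X * 0" by (simp only: aug_mult mult_zero_right)
  then have "aug xs z2 = 0" by (rule var_mult_cancel)
  then obtain w2 where w2: "is_chain xs ?H V w2" "bd xs w2 = z2"
    using Cons.IH[OF dist g(3) V c(3) b2] by blast
  define a0 where "a0 = (\<lambda>w. z0 w + ?X * w2 w)"
  define a1 where "a1 = (\<lambda>w. z1 w - ?Y * w2 w)"
  have w2': "is_chain xs F V w2" "is_chain xs ?G V w2" using w2(1) by (auto elim: is_chain_mono)
  have ca: "is_chain xs F V a0" "is_chain xs ?G V a1"
    unfolding a0_def a1_def using c w2' XV by (auto intro!: is_chain_add is_chain_diff is_chain_mult)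
  have ba: "bd xs a0 w = 0" "bd xs a1 w = 0" for w
    by (simp_all add: a0_def a1_def bd_add bd_diff bd_mult b0 b1 w2)
  have aga: "?Y * aug xs a0 + ?X * aug xs a1 = 0"
    using ag unfolding a0_def a1_def aug_add aug_diff aug_mult by (simp add: algebra_simps)
  \<comment> \<open>By \<open>aga\<close>, x_m divides y_m times this augmentation; as y_m carries
    no x_m, it divides the augmentation itself.\<close>
  have "\<exists>h. aug xs a0 = ?X * h"
  proof (rule var_factor)
    fix n assume "n \<in> Poly_Mapping.keys (aug xs a0)"
    then have "lk (?Y * aug xs a0) (Poly_Mapping.single (m, False) 1 + n) \<noteq> 0"
      using lookup_single_mult[of "Poly_Mapping.single (m, False) 1" 1 "aug xs a0" n]
      by (simp add: in_keys_iff)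
    moreover have "?Y * aug xs a0 = ?X * - aug xs a1"
      using aga by (simp add: eq_neg_iff_add_eq_0)
    ultimately have "lk (Poly_Mapping.single (m, False) (1::nat) + n) (m, True) > 0"
      using lookup_var_mult_nz[of "(m, True)" "- aug xs a1"] by metis
    then show "lk n (m, True) > 0" by (simp add: lookup_add lookup_single when_def)
  qed
  then obtain h where h0: "aug xs a0 = ?X * h" by blast
  have "?X * aug xs a1 = ?X * - (?Y * h)"
    using aga unfolding h0 by (simp add: eq_neg_iff_add_eq_0 algebra_simps)
  then have h1: "aug xs a1 = - (?Y * h)" by (rule var_mult_cancel)
  have "mon_mem xs F h"
    using mon_mem_aug[OF dist ca(1)] m unfolding h0 by (rule mon_mem_var_cancel)
  moreover have "mon_mem xs ?G h"
    using mon_mem_aug[OF dist ca(2)] m unfolding h1 mon_mem_minus by (rule mon_mem_var_cancel)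
  \<comment> \<open>This is the use of the last clause of \<open>good\<close>: without it
    \<open>h\<close> need not be the augmentation of an edge chain.\<close>
  ultimately have "mon_mem xs ?H h"
    by (rule mon_mem_Int) (use Cons.prems(2) in auto)
  moreover have "h \<in> polyR V"
  proof (rule polyR_var_cancel)
    show "?X * h \<in> polyR V" using polyR_aug[OF ca(1) V] unfolding h0 .
  qed
  ultimately obtain v where v: "is_chain xs ?H V v" "bd xs v = (\<lambda>_. 0)" "aug xs v = h"
    using aug_surj[OF dist] by blast
  have v': "is_chain xs F V v" "is_chain xs ?G V v" using v(1) by (auto elim: is_chain_mono)
  have "\<exists>y. is_chain xs F V y \<and> bd xs y = (\<lambda>w. a0 w - ?X * v w)"
  proof (rule Cons.IH[OF dist g(1) V])
    show "is_chain xs F V (\<lambda>w. a0 w - ?X * v w)" using ca v' XV by (auto intro!: is_chain_diff is_chain_mult)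
  qed (simp_all add: bd_diff bd_mult ba v aug_diff aug_mult h0)
  then obtain y0 where y0: "is_chain xs F V y0" "bd xs y0 = (\<lambda>w. a0 w - ?X * v w)" by blast
  have "\<exists>y. is_chain xs ?G V y \<and> bd xs y = (\<lambda>w. a1 w + ?Y * v w)"
  proof (rule Cons.IH[OF dist g(2) V])
    show "is_chain xs ?G V (\<lambda>w. a1 w + ?Y * v w)" using ca v' XV by (auto intro!: is_chain_add is_chain_mult)
  qed (simp_all add: bd_add bd_mult ba v aug_add aug_mult h1)
  then obtain y1 where y1: "is_chain xs ?G V y1" "bd xs y1 = (\<lambda>w. a1 w + ?Y * v w)" by blast
  \<comment> \<open>The edge part contains \<open>- w2\<close> because \<open>bd\<close> acts on
    edges with a minus sign, and the cycle \<open>v\<close> to undo the corrections by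
    \<open>?X * v\<close> and \<open>?Y * v\<close> made at the two ends.\<close>
  define y where "y w = (case w of [] \<Rightarrow> 0 | None # w \<Rightarrow> v w - w2 w | Some False # w \<Rightarrow> y0 w | Some True # w \<Rightarrow> y1 w)" for w
  have y: "y [] = 0" "\<And>w. y (None # w) = v w - w2 w" "\<And>w. y (Some False # w) = y0 w" "\<And>w. y (Some True # w) = y1 w"
    by (auto simp: y_def)
  have "is_chain (m # xs) F V y"
    by (auto simp: is_chain_Cons y y0 y1 intro: is_chain_diff v w2)
  moreover have "bd (m # xs) y w = z w" for w
    by (cases w rule: word_cases)
      (simp_all add: z_Nil y y0 y1 bd_diff v w2 a0_def a1_def, simp_all add: z0_def z1_def z2_def algebra_simps)
  ultimately show ?case by blast
qed

section \<open>From the ungraded cubical complex to a graded resolution\<close>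

definition rk :: "bool option list \<Rightarrow> nat" where
  "rk w = length (filter (\<lambda>a. a = None) w)"

lemma rk_simps [simp]: "rk [] = 0" "rk (Some b # w) = rk w" "rk (None # w) = Suc (rk w)"
  by (auto simp: rk_def)

lemma bd_rank_0: "bd xs (\<lambda>w. if rk w = 0 then y w else 0) w = 0"
proof (induction xs arbitrary: y w)
  case (Cons m xs)
  then show ?case by (cases w rule: word_cases) (simp_all add: bd_zero)
qed simp

text \<open>\<open>cube_complex_exact\<close> yields primitives of mixed dimension. Since
  \<open>bd\<close> lowers the number of free directions by exactly one, they can be cut down to a
  single homological degree.\<close>

lemma bd_rank_Suc:
  "bd xs (\<lambda>w. if rk w = Suc i then y w else 0) w = (if rk w = i then bd xs y w else 0)"
proof (induction xs arbitrary: y w i)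
  case (Cons m xs)
  show ?case
  proof (cases w rule: word_cases)
    case (4 v)
    then show ?thesis by (cases i) (simp_all add: Cons bd_rank_0)
  qed (simp_all add: Cons)
qed simp

lemma aug_rank: "aug xs (\<lambda>w. if rk w = 0 then y w else 0) = aug xs y"
  by (induction xs arbitrary: y) simp_all

lemma homog_bd:
  assumes "\<And>w. homog e (z w)"
  shows "homog (1 + e) (bd xs z w)"
  using assms
proof (induction xs arbitrary: z w)
  case (Cons m xs)
  then show ?case
    by (cases w rule: word_cases) (auto intro!: homog_add homog_diff homog_uminus homog_mult homog_var)
qed simp

lemma homog_aug:
  assumes "\<And>w. homog e (z w)"
  shows "homog (length xs + e) (aug xs z)"
  using assms
proof (induction xs arbitrary: z)
  case (Cons m xs)
  have "homog (1 + (length xs + e)) (aug (m # xs) z)"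
    using Cons by (auto intro!: homog_add homog_mult homog_var)
  then show ?case by (simp add: One_nat_def)
qed simp

definition unit_chain :: "bool option list \<Rightarrow> ('a, 'k::comm_ring_1) chain" where
  "unit_chain w = (\<lambda>w'. if w' = w then 1 else 0)"

definition enc :: "'a list \<Rightarrow> 'a set \<Rightarrow> bool option list" where
  "enc xs A = map (\<lambda>m. Some (m \<in> A)) xs"

definition uexps :: "'a set \<Rightarrow> 'a set \<Rightarrow> ('a \<times> bool) \<Rightarrow>\<^sub>0 nat" where
  "uexps X A = (\<Sum>m\<in>X. Poly_Mapping.single (m, m \<in> A) 1)"

lemma homog_one: "homog 0 (1 :: ('v, 'k::comm_ring_1) mpoly)"
  by (simp add: homog_def)

lemma aug_unit_enc:
  "distinct xs \<Longrightarrow> aug xs (unit_chain (enc xs A)) = Poly_Mapping.single (uexps (set xs) A) (1::'k::comm_ring_1)"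
proof (induction xs)
  case Nil
  show ?case by (simp add: unit_chain_def enc_def uexps_def)
next
  case (Cons m xs)
  have "(\<lambda>w. unit_chain (enc (m # xs) A) (Some b # w)) =
      (if b = (m \<in> A) then unit_chain (enc xs A) else (\<lambda>_. 0 :: ('a \<times> bool, 'k) mpoly))" for b
    by (auto simp: unit_chain_def enc_def fun_eq_iff)
  then have "aug (m # xs) (unit_chain (enc (m # xs) A))
      = var (m, m \<in> A) * (aug xs (unit_chain (enc xs A)) :: ('a \<times> bool, 'k) mpoly)"
    by (cases "m \<in> A") (simp_all add: aug_zero)
  then show ?case using Cons by (simp add: mult_single uexps_def)
qed

lemma cellp_rank_0:
  assumes "distinct xs"
  shows "{w. cellp xs F w \<and> rk w = 0} = enc xs ` {A \<in> F. A \<subseteq> set xs}"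
  using assms
proof (induction xs arbitrary: F)
  case Nil
  have c: "cellp [] F w \<longleftrightarrow> w = [] \<and> {} \<in> F" for w by (cases w) auto
  have "{w. cellp [] F w \<and> rk w = 0} = (if {} \<in> F then {[]} else {})" unfolding c by auto
  moreover have "{A \<in> F. A \<subseteq> set []} = (if {} \<in> F then {{}} else {})" by auto
  ultimately show ?case by (simp add: enc_def)
next
  case (Cons m xs)
  have m: "m \<notin> set xs" and dist: "distinct xs" using Cons.prems by auto
  have IH: "cellp xs G w \<and> rk w = 0 \<longleftrightarrow> w \<in> enc xs ` {A \<in> G. A \<subseteq> set xs}" for G w
    unfolding Cons.IH[OF dist, of G, symmetric] by simp
  have enc_cong: "enc xs (insert m A) = enc xs A" "enc xs (A - {m}) = enc xs A" for A
    using m by (auto simp: enc_def)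
  show ?case
  proof (intro set_eqI iffI)
    fix w assume w: "w \<in> {w. cellp (m # xs) F w \<and> rk w = 0}"
    show "w \<in> enc (m # xs) ` {A \<in> F. A \<subseteq> set (m # xs)}"
    proof (cases w rule: word_cases)
      case (2 v)
      then obtain A where A: "A \<in> F" "A \<subseteq> set xs" "v = enc xs A" using w IH[of F v] by auto
      then have "m \<notin> A" using m by blast
      then show ?thesis using A 2 by (intro image_eqI[of _ _ A]) (auto simp: enc_def)
    next
      case (3 v)
      then obtain A where A: "insert m A \<in> F" "A \<subseteq> set xs" "v = enc xs A"
        using w IH[of "slice m F" v] by (auto simp: slice_def)
      then have "w = enc (m # xs) (insert m A)" using enc_cong(1)[of A] 3 by (simp add: enc_def)
      then show ?thesis using A by (intro image_eqI[of _ _ "insert m A"]) auto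
    qed (use w in auto)
  next
    fix w assume "w \<in> enc (m # xs) ` {A \<in> F. A \<subseteq> set (m # xs)}"
    then obtain A where A: "A \<in> F" "A \<subseteq> insert m (set xs)" "w = Some (m \<in> A) # enc xs A"
      by (auto simp: enc_def)
    show "w \<in> {w. cellp (m # xs) F w \<and> rk w = 0}"
    proof (cases "m \<in> A")
      case True
      then have "insert m (A - {m}) = A" by blast
      then have "enc xs A \<in> enc xs ` {A \<in> slice m F. A \<subseteq> set xs}"
        using A enc_cong(2)[of A] by (intro image_eqI[of _ _ "A - {m}"]) (auto simp: slice_def)
      then show ?thesis using True A IH[of "slice m F" "enc xs A"] by simp
    next
      case False
      then have "enc xs A \<in> enc xs ` {A \<in> F. A \<subseteq> set xs}" using A by blast
      then show ?thesis using False A IH[of F "enc xs A"] by simp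
    qed
  qed
qed

definition cells :: "'a list \<Rightarrow> 'a set set \<Rightarrow> nat \<Rightarrow> bool option list set" where
  "cells xs F i = {w. cellp xs F w \<and> rk w = i}"

lemma finite_cells: "finite (cells xs F i)"
proof (rule finite_subset)
  show "cells xs F i \<subseteq> {w. set w \<subseteq> UNIV \<and> length w = length xs}"
    by (auto simp: cells_def cellp_length)
qed (rule finite_lists_length_eq, simp)

text \<open>Numbering the cells of each dimension turns chains into vectors and \<open>bd\<close>
  into matrices of linear forms. The generators have degree \<open>length xs\<close>, one variable
  for each direction.\<close>

theorem good_lin_res:
  fixes V :: "('a \<times> bool) set"
  assumes dist: "distinct xs" and good: "good xs F" and V: "set xs \<times> UNIV \<subseteq> V"
  shows "lin_res V (gen_ideal V ((\<lambda>A. Poly_Mapping.single (uexps (set xs) A) (1::'k::comm_ring_1)) ` {A \<in> F. A \<subseteq> set xs}))"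
proof -
  define b where "b i = card (cells xs F i)" for i
  have "\<exists>h. bij_betw h {..<b i} (cells xs F i)" for i
    using ex_bij_betw_nat_finite[OF finite_cells] unfolding b_def atLeast0LessThan .
  then obtain en where en: "\<And>i. bij_betw (en i) {..<b i} (cells xs F i)" by metis
  have en_cell: "en i j \<in> cells xs F i" if "j < b i" for i j
    using en that by (auto simp: bij_betw_def)
  have en_ex: "\<exists>j<b i. w = en i j" if "w \<in> cells xs F i" for i w
    using en[of i] that by (auto simp: bij_betw_def)
  have en_inj: "en i j = en i k \<longleftrightarrow> j = k" if "j < b i" "k < b i" for i j k
    using en[of i] that by (auto simp: bij_betw_def inj_on_def)
  define eps where "eps j = (aug xs (unit_chain (en 0 j)) :: ('a \<times> bool, 'k) mpoly)" for j
  define delta where "delta i j k = (bd xs (unit_chain (en (Suc i) k)) (en i j) :: ('a \<times> bool, 'k) mpoly)" for i j k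
  define ch where "ch i v = (\<lambda>w. \<Sum>j<b i. v j * (unit_chain (en i j) w :: ('a \<times> bool, 'k) mpoly))" for i v
  have unit: "is_chain xs F V (unit_chain (en i j) :: ('a, 'k) chain)" if "j < b i" for i j
    using en_cell[OF that] by (auto simp: is_chain_def unit_chain_def cells_def)
  have unit_homog: "homog 0 (unit_chain w w' :: ('a \<times> bool, 'k) mpoly)" for w w'
    by (simp add: unit_chain_def homog_one)
  have ch_en: "ch i v (en i j) = v j" if "j < b i" for i v j
  proof -
    have "ch i v (en i j) = (\<Sum>k<b i. if j = k then v k else 0)"
      unfolding ch_def using that by (intro sum.cong) (auto simp: unit_chain_def en_inj)
    then show ?thesis using that by simp
  qed
  have ch_out: "ch i v w = 0" if "w \<notin> cells xs F i" for i v w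
    unfolding ch_def using that en_cell by (intro sum.neutral) (auto simp: unit_chain_def)
  have ch_chain: "is_chain xs F V (ch i v)" if "v \<in> fvec V (b i)" for i v
    unfolding is_chain_def
  proof (intro allI conjI impI)
    fix w
    show "ch i v w \<in> polyR V" unfolding ch_def
      using that by (intro polyR_sum polyR_mult) (auto simp: fvec_def unit_chain_def)
    assume "ch i v w \<noteq> 0"
    then show "cellp xs F w" using ch_out[of w i v] by (auto simp: cells_def)
  qed
  have ch_eqI: "ch i v = z" if "\<And>w. z w \<noteq> 0 \<Longrightarrow> w \<in> cells xs F i" "\<And>j. j < b i \<Longrightarrow> z (en i j) = v j" for i v z
  proof
    fix w
    show "ch i v w = z w"
    proof (cases "w \<in> cells xs F i")
      case True
      then obtain j where "j < b i" "w = en i j" using en_ex by blast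
      then show ?thesis using that(2) ch_en by simp
    next
      case False
      then show ?thesis using that(1)[of w] ch_out by metis
    qed
  qed
  have ch_rank: "ch i v = (\<lambda>w. if rk w = i then ch i v w else 0)" for i v
    using ch_out[of _ i v] by (intro ext) (auto simp: cells_def)
  have bd_ch: "bd xs (ch (Suc i) v) w = (\<Sum>k<b (Suc i). v k * bd xs (unit_chain (en (Suc i) k)) w)" for i v w
    unfolding ch_def by (simp add: bd_sum bd_mult)
  have aug_ch: "aug xs (ch 0 v) = (\<Sum>j<b 0. v j * eps j)" for v
    unfolding ch_def eps_def by (simp add: aug_sum aug_mult)
  have bd_ch_out: "w \<in> cells xs F i" if "v \<in> fvec V (b (Suc i))" "bd xs (ch (Suc i) v) w \<noteq> 0" for i v w
  proof -
    have "bd xs (ch (Suc i) v) w = (if rk w = i then bd xs (ch (Suc i) v) w else 0)"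
      by (subst ch_rank) (rule bd_rank_Suc)
    then have "rk w = i" using that(2) by metis
    moreover have "cellp xs F w" using is_chain_bd[OF ch_chain[OF that(1)] V] that(2) by (simp add: is_chain_def)
    ultimately show ?thesis by (simp add: cells_def)
  qed
  have dmap_delta: "dmap (delta i) (b i) (b (Suc i)) v j = bd xs (ch (Suc i) v) (en i j)" if "j < b i" for i v j
    using that by (simp add: dmap_def delta_def bd_ch mult.commute)
  have dmap_fvec: "dmap (delta i) (b i) (b (Suc i)) v \<in> fvec V (b i)" if "v \<in> fvec V (b (Suc i))" for i v
    using is_chain_bd[OF ch_chain[OF that] V] dmap_delta[of _ i v]
    by (auto simp: fvec_def is_chain_def) (auto simp: dmap_def)
  have ch_dmap: "ch i (dmap (delta i) (b i) (b (Suc i)) v) = bd xs (ch (Suc i) v)" if "v \<in> fvec V (b (Suc i))" for i v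
    by (rule ch_eqI) (use bd_ch_out[OF that] dmap_delta in auto)
  \<comment> \<open>Serves both exactness claims: in dimension 0 the condition on the boundary is
    automatic, in positive dimension the one on the augmentation.\<close>
  have lift: "\<exists>u\<in>fvec V (b (Suc i)). v = dmap (delta i) (b i) (b (Suc i)) u"
    if v: "v \<in> fvec V (b i)" and z: "\<And>w. bd xs (ch i v) w = 0" "aug xs (ch i v) = 0" for i v
  proof -
    obtain y where y: "is_chain xs F V y" "bd xs y = ch i v"
      using cube_complex_exact[OF dist good V ch_chain[OF v] z] by blast
    define y' where "y' w = (if rk w = Suc i then y w else 0)" for w
    define u where "u j = (if j < b (Suc i) then y (en (Suc i) j) else 0)" for j
    have u: "u \<in> fvec V (b (Suc i))" using y(1) by (auto simp: u_def fvec_def is_chain_def)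
    have "ch (Suc i) u = y'"
      by (rule ch_eqI) (use y(1) en_cell[of _ "Suc i"] in \<open>auto simp: y'_def u_def is_chain_def cells_def split: if_splits\<close>)
    moreover have "bd xs y' w = ch i v w" for w
      unfolding y'_def bd_rank_Suc y(2) by (simp add: fun_cong[OF ch_rank[of i v], symmetric])
    ultimately have "dmap (delta i) (b i) (b (Suc i)) u j = v j" if "j < b i" for j
      using dmap_delta[OF that, of u] ch_en[OF that, of v] by simp
    then have "dmap (delta i) (b i) (b (Suc i)) u j = v j" for j
      using v by (cases "j < b i") (auto simp: dmap_def fvec_def)
    then have "v = dmap (delta i) (b i) (b (Suc i)) u" by auto
    then show ?thesis using u by blast
  qed
  have 1: "\<forall>j<b 0. eps j \<in> polyR V \<and> homog (length xs) (eps j)"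
    using polyR_aug[OF unit V] homog_aug[OF unit_homog] unfolding eps_def by fastforce
  have 2: "\<forall>i j k. j < b i \<and> k < b (Suc i) \<longrightarrow> delta i j k \<in> polyR V \<and> homog 1 (delta i j k)"
    using is_chain_bd[OF unit V] homog_bd[OF unit_homog] unfolding delta_def is_chain_def by fastforce
  have "eps ` {..<b 0} = (\<lambda>w. aug xs (unit_chain w)) ` cells xs F 0"
    using en[of 0] unfolding eps_def bij_betw_def by (metis image_image)
  also have "\<dots> = (\<lambda>A. Poly_Mapping.single (uexps (set xs) A) 1) ` {A \<in> F. A \<subseteq> set xs}"
    unfolding cells_def cellp_rank_0[OF dist] image_image by (intro image_cong refl aug_unit_enc[OF dist])
  finally have 3: "gen_ideal V (eps ` {..<b 0}) =
      gen_ideal V ((\<lambda>A. Poly_Mapping.single (uexps (set xs) A) 1) ` {A \<in> F. A \<subseteq> set xs})" by simp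
  have 4: "{v \<in> fvec V (b 0). (\<Sum>j<b 0. v j * eps j) = 0} = dmap (delta 0) (b 0) (b 1) ` fvec V (b 1)"
  proof (intro set_eqI iffI)
    fix v assume "v \<in> {v \<in> fvec V (b 0). (\<Sum>j<b 0. v j * eps j) = 0}"
    then have v: "v \<in> fvec V (b 0)" "aug xs (ch 0 v) = 0" by (simp_all add: aug_ch)
    have "bd xs (ch 0 v) w = 0" for w by (subst ch_rank) (rule bd_rank_0)
    from lift[OF v(1) this v(2)] show "v \<in> dmap (delta 0) (b 0) (b 1) ` fvec V (b 1)"
      by (auto simp: One_nat_def)
  next
    fix v assume "v \<in> dmap (delta 0) (b 0) (b 1) ` fvec V (b 1)"
    then obtain u where u: "u \<in> fvec V (b (Suc 0))" "v = dmap (delta 0) (b 0) (b (Suc 0)) u"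
      by (auto simp: One_nat_def)
    have "aug xs (ch 0 v) = 0" unfolding u(2) ch_dmap[OF u(1)] by (rule aug_bd)
    then show "v \<in> {v \<in> fvec V (b 0). (\<Sum>j<b 0. v j * eps j) = 0}"
      using dmap_fvec[OF u(1)] u(2) by (simp add: aug_ch)
  qed
  have 5: "\<forall>i. {v \<in> fvec V (b (Suc i)). dmap (delta i) (b i) (b (Suc i)) v = (\<lambda>_. 0)}
        = dmap (delta (Suc i)) (b (Suc i)) (b (Suc (Suc i))) ` fvec V (b (Suc (Suc i)))"
  proof (intro allI set_eqI iffI)
    fix i v assume v: "v \<in> {v \<in> fvec V (b (Suc i)). dmap (delta i) (b i) (b (Suc i)) v = (\<lambda>_. 0)}"
    then have v': "v \<in> fvec V (b (Suc i))" by simp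
    have z: "bd xs (ch (Suc i) v) w = 0" for w
    proof (rule ccontr)
      assume nz: "bd xs (ch (Suc i) v) w \<noteq> 0"
      then obtain j where "j < b i" "w = en i j" using bd_ch_out[OF v'] en_ex by blast
      then show False using nz v dmap_delta[of j i v] by simp
    qed
    have "aug xs (ch (Suc i) v) = aug xs (\<lambda>w. if rk w = 0 then ch (Suc i) v w else 0)" by (rule aug_rank[symmetric])
    also have "(\<lambda>w. if rk w = 0 then ch (Suc i) v w else 0) = (\<lambda>w. 0)"
      using ch_out[of _ "Suc i" v] by (intro ext) (auto simp: cells_def)
    finally have "aug xs (ch (Suc i) v) = 0" by (simp add: aug_zero)
    from lift[OF v' z this] show "v \<in> dmap (delta (Suc i)) (b (Suc i)) (b (Suc (Suc i))) ` fvec V (b (Suc (Suc i)))"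
      by blast
  next
    fix i v assume "v \<in> dmap (delta (Suc i)) (b (Suc i)) (b (Suc (Suc i))) ` fvec V (b (Suc (Suc i)))"
    then obtain u where u: "u \<in> fvec V (b (Suc (Suc i)))" "v = dmap (delta (Suc i)) (b (Suc i)) (b (Suc (Suc i))) u"
      by blast
    have v: "v \<in> fvec V (b (Suc i))" using dmap_fvec[OF u(1)] u(2) by simp
    have "bd xs (ch (Suc i) v) w = 0" for w unfolding u(2) ch_dmap[OF u(1)] by (rule bd_bd)
    then have "dmap (delta i) (b i) (b (Suc i)) v j = 0" for j
      using dmap_delta[of j i v] by (cases "j < b i") (auto simp: dmap_def)
    then show "v \<in> {v \<in> fvec V (b (Suc i)). dmap (delta i) (b i) (b (Suc i)) v = (\<lambda>_. 0)}"
      using v by auto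
  qed
  show ?thesis unfolding lin_res_def
    by (intro exI[of _ "length xs"] exI[of _ b] exI[of _ eps] exI[of _ delta] conjI 1 2 3 4 5)
qed

section \<open>Linear resolutions and the Koszul complex\<close>

text \<open>Alternating functions on lists of variables play the role of elements of the exterior powers; in
  this form the Koszul differential \<open>kd\<close> below needs no signs.\<close>
definition alt :: "('v list \<Rightarrow> 'm::ab_group_add) \<Rightarrow> bool" where
  "alt f \<longleftrightarrow> (\<forall>us a b ws. f (us @ a # b # ws) = - f (us @ b # a # ws)) \<and>
             (\<forall>us a ws. f (us @ a # a # ws) = 0)"

text \<open>An element of the Koszul complex in exterior degree \<open>j\<close> with coefficients
  of polynomial degree \<open>e\<close>, listed by its coefficients on wedge products of
  variables.\<close>

definition form :: "'v set \<Rightarrow> nat \<Rightarrow> nat \<Rightarrow> ('v list \<Rightarrow> ('v, 'k::comm_ring_1) mpoly) \<Rightarrow> bool" where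
  "form V e j f \<longleftrightarrow> alt f \<and>
     (\<forall>w. f w \<in> polyR V \<and> homog e (f w) \<and> (f w \<noteq> 0 \<longrightarrow> length w = j \<and> set w \<subseteq> V))"

definition kd :: "'v set \<Rightarrow> ('v list \<Rightarrow> ('v, 'k::comm_ring_1) mpoly) \<Rightarrow> 'v list \<Rightarrow> ('v, 'k) mpoly" where
  "kd V f w = (\<Sum>v\<in>V. var v * f (v # w))"

lemma alt_swap: "alt f \<Longrightarrow> f (us @ a # b # ws) = - f (us @ b # a # ws)"
  unfolding alt_def by blast

lemma alt_rep: "alt f \<Longrightarrow> f (us @ a # a # ws) = 0"
  unfolding alt_def by blast

lemma alt_kd:
  assumes "alt f"
  shows "alt (kd V f)"
  unfolding alt_def kd_def
proof (intro conjI allI)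
  fix us a b ws
  have "f (v # us @ a # b # ws) = - f (v # us @ b # a # ws)" for v
    using alt_swap[OF assms, of "v # us" a b ws] by simp
  then show "(\<Sum>v\<in>V. var v * f (v # us @ a # b # ws)) = - (\<Sum>v\<in>V. var v * f (v # us @ b # a # ws))"
    by (simp add: sum_negf)
next
  fix us a ws
  have "f (v # us @ a # a # ws) = 0" for v
    using alt_rep[OF assms, of "v # us" a ws] by simp
  then show "(\<Sum>v\<in>V. var v * f (v # us @ a # a # ws)) = 0" by simp
qed

lemma form_kd:
  assumes "form V e (Suc j) f"
  shows "form V (Suc e) j (kd V f)"
  unfolding form_def
proof (intro conjI allI impI)
  show "alt (kd V f)" using assms alt_kd unfolding form_def by blast
  fix w
  show "kd V f w \<in> polyR V" unfolding kd_def
    using assms by (auto simp: form_def intro!: polyR_sum polyR_mult polyR_var)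
  have "homog (1 + e) (kd V f w)" unfolding kd_def
    using assms by (intro homog_sum homog_mult homog_var) (auto simp: form_def)
  then show "homog (Suc e) (kd V f w)" by (simp add: One_nat_def)
  assume "kd V f w \<noteq> 0"
  then obtain v where "v \<in> V" "f (v # w) \<noteq> 0" unfolding kd_def
    by (metis (no_types, lifting) mult_zero_right sum.neutral)
  then show "length w = j" "set w \<subseteq> V" using assms unfolding form_def by fastforce+
qed

lemma kd_0:
  assumes "form V e 0 f"
  shows "kd V f w = 0"
  using assms unfolding kd_def form_def by (metis (no_types, lifting) length_0_conv list.distinct(1) mult_zero_right sum.neutral)

text \<open>Antisymmetry makes the double sum equal to its own negative, which is not enough when 2
  is not cancellable. It is therefore split into two triangles that cancel and a diagonal that
  vanishes because \<open>f\<close> kills repetitions.\<close>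

lemma kd_kd:
  fixes f :: "'v list \<Rightarrow> ('v, 'k::comm_ring_1) mpoly"
  assumes "alt f" "finite V"
  shows "kd V (kd V f) w = 0"
proof -
  obtain h :: "'v \<Rightarrow> nat" where h: "inj_on h V" using assms(2) finite_imp_inj_to_nat_seg by blast
  define t where "t a b = var a * (var b * f (b # a # w))" for a b
  have anti: "t a b = - t b a" for a b
    using alt_swap[OF assms(1), of "[]" a b w] by (simp add: t_def mult.left_commute)
  have diag: "t a a = 0" for a using alt_rep[OF assms(1), of "[]" a w] by (simp add: t_def)
  let ?L = "{(a, b). a \<in> V \<and> b \<in> V \<and> h a < h b}" and ?G = "{(a, b). a \<in> V \<and> b \<in> V \<and> h b < h a}"
    and ?D = "{(a, b). a \<in> V \<and> b \<in> V \<and> h b = h a}"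
  have "?L \<subseteq> V \<times> V" "?G \<subseteq> V \<times> V" "?D \<subseteq> V \<times> V" by auto
  then have fin: "finite ?L" "finite ?G" "finite ?D"
    using assms(2) by (meson finite_SigmaI finite_subset)+
  have "kd V (kd V f) w = (\<Sum>(a, b)\<in>V \<times> V. t a b)"
    by (simp add: kd_def t_def sum_distrib_left sum.cartesian_product)
  also have "V \<times> V = (?L \<union> ?G) \<union> ?D" by auto
  also have "(\<Sum>(a, b)\<in>(?L \<union> ?G) \<union> ?D. t a b) = (\<Sum>(a, b)\<in>?L. t a b) + (\<Sum>(a, b)\<in>?G. t a b) + (\<Sum>(a, b)\<in>?D. t a b)"
    using fin by (subst sum.union_disjoint; (subst sum.union_disjoint)?) auto
  also have "(\<Sum>(a, b)\<in>?D. t a b) = 0"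
    using h diag by (intro sum.neutral) (auto dest: inj_onD)
  also have "(\<Sum>(a, b)\<in>?G. t a b) = (\<Sum>(a, b)\<in>?L. t b a)"
    by (rule sum.reindex_bij_witness[of _ prod.swap prod.swap]) auto
  also have "\<dots> = - (\<Sum>(a, b)\<in>?L. t a b)"
    unfolding sum_negf[symmetric] by (intro sum.cong refl) (simp only: split_beta, rule anti)
  finally show ?thesis by simp
qed

lemma single_add_single_eq:
  fixes a b c d :: 'v
  assumes "Poly_Mapping.single a (1::nat) + Poly_Mapping.single b 1 = Poly_Mapping.single c 1 + Poly_Mapping.single d 1"
  shows "(a = c \<and> b = d) \<or> (a = d \<and> b = c)"
proof -
  have e: "(1 when a = x) + (1 when b = x) = ((1::nat) when c = x) + (1 when d = x)" for x
    using arg_cong[OF assms, of "\<lambda>p. lk p x"] by (simp add: lookup_add lookup_single)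
  show ?thesis using e[of a] e[of b] e[of c] e[of d]
    by (auto simp: when_def split: if_splits)
qed

text \<open>Off the diagonal two ordered pairs produce the same quadratic monomial, on the diagonal
  only one. In \<open>koszul_linear_exact\<close> the first case gives antisymmetry and the second
  gives vanishing on repetitions.\<close>

lemma sum_lookup_pair:
  fixes c :: "'v \<Rightarrow> 'v \<Rightarrow> 'k::comm_ring_1"
  assumes "finite V" "a \<in> V" "b \<in> V"
  shows "lk (\<Sum>u\<in>V. \<Sum>v\<in>V. Poly_Mapping.single (Poly_Mapping.single u (1::nat) + Poly_Mapping.single v 1) (c u v))
      (Poly_Mapping.single a 1 + Poly_Mapping.single b 1) = (if a = b then c a a else c a b + c b a)"
proof -
  have e: "lk (Poly_Mapping.single (Poly_Mapping.single u (1::nat) + Poly_Mapping.single v 1) (c u v))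
      (Poly_Mapping.single a 1 + Poly_Mapping.single b 1) =
      (if u = a then (if v = b then c a b else 0) else 0)
      + (if a = b then 0 else if u = b then (if v = a then c b a else 0) else 0)" for u v
    using single_add_single_eq[of u v a b] by (auto simp: lookup_single when_def add.commute)
  have d: "(\<Sum>u\<in>V. \<Sum>v\<in>V. if u = x then (if v = y then r else 0) else 0) = r"
    if "x \<in> V" "y \<in> V" for x y and r :: 'k
  proof -
    have "(\<Sum>v\<in>V. if u = x then (if v = y then r else 0) else 0) = (if u = x then r else 0)" for u
      using assms(1) that by simp
    then show ?thesis using assms(1) that by simp
  qed
  show ?thesis
  proof (cases "a = b")
    case True
    show ?thesis
      by (simp only: lookup_sum e sum.distrib d[OF assms(2,3)]) (simp add: True)
  next
    case False
    then show ?thesis using assms(2,3) by (simp only: lookup_sum e sum.distrib d if_False)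
  qed
qed

text \<open>Exactness of the Koszul complex at linear coefficients: the coefficient array of a closed
  linear form is itself alternating in all arguments, so it is the required primitive.\<close>
lemma koszul_linear_exact:
  fixes f :: "'v list \<Rightarrow> ('v, 'k::comm_ring_1) mpoly"
  assumes f: "form V 1 j f" and V: "finite V" and closed: "\<And>w. kd V f w = 0"
  shows "\<exists>g. form V 0 (Suc j) g \<and> kd V g = f"
proof -
  define c where "c u w = lk (f w) (Poly_Mapping.single u 1)" for u w
  define g :: "'v list \<Rightarrow> ('v, 'k) mpoly" where
    "g w = (case w of [] \<Rightarrow> 0 | u # w \<Rightarrow> Poly_Mapping.single 0 (c u w))" for w
  have g: "g [] = 0" "g (u # w) = Poly_Mapping.single 0 (c u w)" for u w by (auto simp: g_def)
  have f_exp: "f w = (\<Sum>u\<in>V. var u * Poly_Mapping.single 0 (c u w))" for w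
  proof (rule poly_mapping_eqI)
    fix n
    have *: "lk (\<Sum>u\<in>V. var u * Poly_Mapping.single 0 (c u w)) n
        = (\<Sum>u\<in>V. c u w when Poly_Mapping.single u 1 = n)"
      by (simp add: lookup_sum mult_single lookup_single)
    show "lk (f w) n = lk (\<Sum>u\<in>V. var u * Poly_Mapping.single 0 (c u w)) n"
    proof (cases "\<exists>u\<in>V. n = Poly_Mapping.single u 1")
      case True
      then obtain u where u: "u \<in> V" "n = Poly_Mapping.single u 1" by blast
      have "(Poly_Mapping.single v (1::nat) = Poly_Mapping.single u 1) \<longleftrightarrow> v = u" for v
        by (metis lookup_single_eq lookup_single_not_eq one_neq_zero)
      then show ?thesis unfolding * using u V by (simp add: when_def c_def sum.delta')
    next
      case False
      have "lk (f w) n = 0"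
      proof (rule ccontr)
        assume "lk (f w) n \<noteq> 0"
        then have n: "n \<in> Poly_Mapping.keys (f w)" by (simp add: in_keys_iff)
        then have "mdeg n = 1" "Poly_Mapping.keys n \<subseteq> V" using f by (auto simp: form_def homog_def polyR_def)
        then have "Poly_Mapping.keys n \<noteq> {}" by (auto simp: mdeg_def)
        then obtain u where u: "u \<in> Poly_Mapping.keys n" by blast
        then obtain r where r: "n = Poly_Mapping.single u 1 + r"
          using var_split[of n u] by (auto simp: in_keys_iff)
        then have "r = 0" using \<open>mdeg n = 1\<close> mdeg_eq_0[of r] by (simp add: mdeg_plus)
        then show False using False r u \<open>Poly_Mapping.keys n \<subseteq> V\<close> by auto
      qed
      moreover have "(\<Sum>u\<in>V. c u w when Poly_Mapping.single u 1 = n) = 0"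
        using False by (intro sum.neutral) (auto simp: when_def)
      ultimately show ?thesis unfolding * by simp
    qed
  qed
  have c0: "c u w = 0" if "u \<notin> V" for u w
  proof -
    have "f w \<in> polyR V" using f by (simp add: form_def)
    then have "Poly_Mapping.single u 1 \<in> Poly_Mapping.keys (f w) \<Longrightarrow> u \<in> V"
      unfolding polyR_def by (force dest: bspec)
    then have "Poly_Mapping.single u 1 \<notin> Poly_Mapping.keys (f w)" using that by blast
    then show ?thesis by (simp add: c_def in_keys_iff)
  qed
  have cf: "c u w = 0" if "f w = 0" for u w using that by (simp add: c_def)
  have len: "f w = 0" if "\<not> (length w = j \<and> set w \<subseteq> V)" for w using that f by (auto simp: form_def)
  have kd_exp: "kd V f w = (\<Sum>u\<in>V. \<Sum>v\<in>V. Poly_Mapping.single (Poly_Mapping.single u 1 + Poly_Mapping.single v 1) (c v (u # w)))" for w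
    unfolding kd_def by (subst f_exp) (simp add: sum_distrib_left mult_single)
  have *: "lk (\<Sum>u\<in>V. \<Sum>v\<in>V. Poly_Mapping.single (Poly_Mapping.single u (1::nat) + Poly_Mapping.single v 1) (c v (u # w))) n = 0" for w n
    by (simp only: kd_exp[symmetric] closed lookup_zero)
  have c_anti: "c a (b # w) + c b (a # w) = 0" if "a \<noteq> b" for a b w
  proof (cases "a \<in> V \<and> b \<in> V")
    case True
    then show ?thesis
      using sum_lookup_pair[OF V, of a b "\<lambda>u v. c v (u # w)"] * that by (simp add: add.commute)
  next
    case False
    then show ?thesis using c0 cf len by (metis add_0 insert_subset list.set(2))
  qed
  have c_diag: "c a (a # w) = 0" for a w
  proof (cases "a \<in> V")
    case True
    then show ?thesis
      using sum_lookup_pair[OF V, of a a "\<lambda>u v. c v (u # w)"] * by simp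
  qed (simp add: c0)
  have altf: "alt f" using f by (simp add: form_def)
  have "alt g"
    unfolding alt_def
  proof (intro conjI allI)
    fix us a b ws
    show "g (us @ a # b # ws) = - g (us @ b # a # ws)"
    \<comment> \<open>Only an exchange involving the new first entry needs
      \<open>kd V f = 0\<close>; all later ones are inherited from \<open>f\<close>.\<close>
    proof (cases us)
      case Nil
      show ?thesis
      proof (cases "a = b")
        case True
        then show ?thesis using Nil by (simp add: g c_diag)
      next
        case False
        then have "c a (b # ws) = - c b (a # ws)" using c_anti[of a b ws] by (simp add: eq_neg_iff_add_eq_0)
        then show ?thesis using Nil by (simp add: g single_uminus)
      qed
    next
      case (Cons u us')
      then show ?thesis using alt_swap[OF altf, of us' a b ws] by (simp add: g c_def single_uminus)
    qed
  next
    fix us a ws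
    show "g (us @ a # a # ws) = 0"
    proof (cases us)
      case Nil
      then show ?thesis by (simp add: g c_diag)
    next
      case (Cons u us')
      then show ?thesis using alt_rep[OF altf, of us' a ws] by (simp add: g c_def)
    qed
  qed
  moreover have "g w \<in> polyR V \<and> homog 0 (g w) \<and> (g w \<noteq> 0 \<longrightarrow> length w = Suc j \<and> set w \<subseteq> V)" for w
  proof (cases w)
    case (Cons u w')
    have "length w' = j \<and> set w' \<subseteq> V \<and> u \<in> V" if "Poly_Mapping.single (0 :: 'v \<Rightarrow>\<^sub>0 nat) (c u w') \<noteq> 0"
      using that c0 cf len by (metis single_zero)
    then show ?thesis using Cons by (auto simp: g intro: polyR_single homog_single)
  qed (simp add: g)
  moreover have "kd V g = f" by (rule ext) (simp add: kd_def g f_exp[symmetric])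
  ultimately show ?thesis unfolding form_def by blast
qed

section \<open>Lifts that respect alternation\<close>

lemma neg_eq_transfer:
  fixes x y :: "('v, 'k::field) mpoly"
  assumes "- x = x" "x \<noteq> 0"
  shows "- y = y"
proof (rule poly_mapping_eqI)
  fix n
  obtain m where m: "lk x m \<noteq> 0" using assms(2) by (metis lookup_zero poly_mapping_eqI)
  have "lk x m + lk x m = 0" using arg_cong[OF assms(1), of "\<lambda>p. lk p m"] by (simp add: neg_eq_iff_add_eq_0)
  then have "2 * lk x m = 0" by (simp only: mult_2)
  then have "(2::'k) = 0" using m by simp
  then have "lk y n + lk y n = 0" by (simp only: mult_2[symmetric] mult_zero_left)
  then show "lk (- y) n = lk y n" by (simp add: neg_eq_iff_add_eq_0)
qed

text \<open>Lifts are chosen compatibly with negation, so that composing with them preserves alternation.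
  When \<open>v = - v \<noteq> 0\<close> the characteristic is two and every lift is its own negative.\<close>
lemma odd_section:
  fixes L :: "(nat \<Rightarrow> ('v, 'k::field) mpoly) \<Rightarrow> (nat \<Rightarrow> ('v, 'k) mpoly) \<Rightarrow> bool"
  assumes ex: "\<And>v. v \<in> W \<Longrightarrow> \<exists>u. L u v"
    and neg: "\<And>u v. L u v \<Longrightarrow> L (\<lambda>k. - u k) (\<lambda>k. - v k)" and zero: "L (\<lambda>_. 0) (\<lambda>_. 0)"
    and W: "\<And>v. v \<in> W \<Longrightarrow> (\<lambda>k. - v k) \<in> W"
  shows "\<exists>s. (\<forall>v\<in>W. L (s v) v \<and> s (\<lambda>k. - v k) = (\<lambda>k. - s v k)) \<and> s (\<lambda>_. 0) = (\<lambda>_. 0)"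
proof -
  define ng :: "(nat \<Rightarrow> ('v, 'k) mpoly) \<Rightarrow> nat \<Rightarrow> ('v, 'k) mpoly" where "ng v = (\<lambda>k. - v k)" for v
  have ng_ng: "ng (ng v) = v" for v by (simp add: ng_def)
  define l where "l v = (SOME u. L u v)" for v
  have l: "L (l v) v" if "v \<in> W" for v using ex[OF that] unfolding l_def by (rule someI_ex)
  \<comment> \<open>\<open>rep\<close> picks one of \<open>v\<close> and its negative, the same for
    both; the lift is chosen there and negated on the other side.\<close>
  define rep where "rep v = (SOME x. x = v \<or> x = ng v)" for v
  have rep: "rep v = v \<or> rep v = ng v" for v
    unfolding rep_def by (rule someI[of _ v]) simp
  have rep_ng: "rep (ng v) = rep v" for v
    unfolding rep_def ng_ng by (intro arg_cong[of _ _ Eps] ext) auto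
  define s where "s v = (if v = (\<lambda>_. 0) then (\<lambda>_. 0) else if rep v = v then l v else ng (l (ng v)))" for v
  have "L (s v) v \<and> s (ng v) = ng (s v)" if v: "v \<in> W" for v
  proof (cases "v = (\<lambda>_. 0)")
    case True
    then show ?thesis using zero by (simp add: s_def ng_def)
  next
    case False
    have nv: "ng v \<in> W" using W v by (simp add: ng_def)
    have False': "ng v \<noteq> (\<lambda>_. 0)" using False by (auto simp: ng_def fun_eq_iff)
    have "L (ng (l (ng v))) (ng (ng v))" using neg[OF l[OF nv]] by (simp add: ng_def)
    then have "L (s v) v" using l[OF v] False by (simp add: s_def ng_ng)
    moreover have "s (ng v) = ng (s v)"
    proof (cases "rep v = v")
      case True
      show ?thesis
      proof (cases "ng v = v")
        case sym: True
        obtain k where "v k \<noteq> 0" using False by auto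
        moreover have "- v k = v k" using fun_cong[OF sym, of k] by (simp add: ng_def)
        ultimately have "ng u = u" for u
          unfolding ng_def by (intro ext) (rule neg_eq_transfer)
        then show ?thesis by metis
      next
        case neq: False
        then show ?thesis using True False False' by (simp add: s_def rep_ng ng_ng)
      qed
    next
      case rv: False
      then have "rep v = ng v" using rep by blast
      then show ?thesis using rv False False' by (simp add: s_def rep_ng ng_ng)
    qed
    ultimately show ?thesis by blast
  qed
  then show ?thesis unfolding ng_def by (intro exI[of _ s]) (auto simp: s_def)
qed

text \<open>Elements of the double complex formed by a complex of free modules and the Koszul
  complex: vectors of \<open>n\<close> forms.\<close>

definition vform :: "'v set \<Rightarrow> nat \<Rightarrow> nat \<Rightarrow> nat \<Rightarrow> ('v list \<Rightarrow> nat \<Rightarrow> ('v, 'k::comm_ring_1) mpoly) \<Rightarrow> bool" where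
  "vform V e j n F \<longleftrightarrow> (\<forall>k. form V e j (\<lambda>w. F w k)) \<and> (\<forall>w k. n \<le> k \<longrightarrow> F w k = 0)"

definition vkd :: "'v set \<Rightarrow> ('v list \<Rightarrow> nat \<Rightarrow> ('v, 'k::comm_ring_1) mpoly) \<Rightarrow> 'v list \<Rightarrow> nat \<Rightarrow> ('v, 'k) mpoly" where
  "vkd V F w = (\<lambda>k. kd V (\<lambda>w. F w k) w)"

lemma form_zero: "form V e j (\<lambda>_. 0)"
  by (simp add: form_def alt_def)

lemma alt_add: "alt f \<Longrightarrow> alt g \<Longrightarrow> alt (\<lambda>w. f w + g w)"
  unfolding alt_def by (metis add.inverse_distrib_swap add.commute add_0)

lemma alt_sum: "(\<And>x. x \<in> A \<Longrightarrow> alt (f x)) \<Longrightarrow> alt (\<lambda>w. \<Sum>x\<in>A. f x w)"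
proof (induction A rule: infinite_finite_induct)
  case (insert x A)
  then show ?case by (simp add: alt_add)
qed (simp_all add: alt_def)

lemma alt_mult: "alt f \<Longrightarrow> alt (\<lambda>w. c * f w)" for f :: "'v list \<Rightarrow> ('w, 'k::comm_ring_1) mpoly"
  unfolding alt_def by (metis mult_minus_right mult_zero_right)

lemma form_sum:
  assumes "\<And>x. x \<in> A \<Longrightarrow> form V e j (f x)"
  shows "form V e j (\<lambda>w. \<Sum>x\<in>A. f x w)"
  unfolding form_def
proof (intro conjI allI impI)
  show "alt (\<lambda>w. \<Sum>x\<in>A. f x w)" using assms by (intro alt_sum) (simp add: form_def)
  fix w
  show "(\<Sum>x\<in>A. f x w) \<in> polyR V" using assms by (intro polyR_sum) (simp add: form_def)
  show "homog e (\<Sum>x\<in>A. f x w)" using assms by (intro homog_sum) (simp add: form_def)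
  assume "(\<Sum>x\<in>A. f x w) \<noteq> 0"
  then obtain x where "x \<in> A" "f x w \<noteq> 0" by (metis (no_types, lifting) sum.neutral)
  then show "length w = j" "set w \<subseteq> V" using assms unfolding form_def by blast+
qed

lemma form_mult:
  assumes "form V e j f" "c \<in> polyR V" "homog d c"
  shows "form V (d + e) j (\<lambda>w. c * f w)"
proof -
  have "f w \<noteq> 0" if "c * f w \<noteq> 0" for w using that by auto
  then show ?thesis using assms unfolding form_def
    by (simp add: alt_mult polyR_mult homog_mult)
qed

lemma form_diff:
  assumes "form V e j f" "form V e j g"
  shows "form V e j (\<lambda>w. f w - g w)"
proof -
  have "alt (\<lambda>w. (-1) * g w)" using assms(2) by (intro alt_mult) (simp add: form_def)
  then have "alt (\<lambda>w. f w + (-1) * g w)" using assms(1) by (intro alt_add) (simp_all add: form_def)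
  then have "alt (\<lambda>w. f w - g w)" by simp
  moreover have "f w \<noteq> 0 \<or> g w \<noteq> 0" if "f w - g w \<noteq> 0" for w using that by auto
  ultimately show ?thesis using assms unfolding form_def
    by (simp add: polyR_diff homog_diff) metis
qed

lemma kd_sum: "kd V (\<lambda>w. \<Sum>x\<in>A. c x * f x w) w = (\<Sum>x\<in>A. c x * kd V (f x) w)"
proof -
  have "kd V (\<lambda>w. \<Sum>x\<in>A. c x * f x w) w = (\<Sum>v\<in>V. \<Sum>x\<in>A. c x * (var v * f x (v # w)))"
    by (simp add: kd_def sum_distrib_left mult.left_commute)
  also have "\<dots> = (\<Sum>x\<in>A. \<Sum>v\<in>V. c x * (var v * f x (v # w)))" by (rule sum.swap)
  finally show ?thesis by (simp add: kd_def sum_distrib_left)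
qed

lemma kd_diff: "kd V (\<lambda>w. f w - g w) w = kd V f w - kd V g w"
  by (simp add: kd_def algebra_simps sum_subtractf)

lemma dmap_diff: "dmap D m n (\<lambda>k. u k - v k) = (\<lambda>j. dmap D m n u j - dmap D m n v j)"
  by (auto simp: dmap_def algebra_simps sum_subtractf)

lemma dmap_minus: "dmap D m n (\<lambda>k. - v k) = (\<lambda>j. - dmap D m n v j)"
  by (auto simp: dmap_def sum_negf)

lemma dmap_zero: "dmap D m n (\<lambda>k. 0) = (\<lambda>j. 0)"
  by (auto simp: dmap_def)

lemma kd_zero: "kd V (\<lambda>w. 0) w = 0"
  by (simp add: kd_def)

text \<open>The entries of \<open>D\<close> are scalars for the Koszul differential, so the two
  differentials of the double complex commute.\<close>

lemma dmap_vkd: "dmap D m n (vkd V F w) = vkd V (\<lambda>w. dmap D m n (F w)) w"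
  unfolding vkd_def dmap_def by (rule ext) (simp add: kd_sum kd_zero)

lemma vform_dmap:
  assumes "vform V e j n F" "\<And>j k. j < m \<Longrightarrow> k < n \<Longrightarrow> D j k \<in> polyR V \<and> homog d (D j k)"
  shows "vform V (d + e) j m (\<lambda>w. dmap D m n (F w))"
proof -
  have "form V (d + e) j (\<lambda>w. dmap D m n (F w) k)" for k
  proof (cases "k < m")
    case True
    then show ?thesis using assms unfolding vform_def dmap_def
      by (auto intro!: form_sum form_mult)
  qed (simp add: dmap_def form_zero)
  then show ?thesis unfolding vform_def by (simp add: dmap_def)
qed

lemma vform_vkd: "vform V e (Suc j) n F \<Longrightarrow> vform V (Suc e) j n (vkd V F)"
  unfolding vform_def vkd_def by (auto intro: form_kd simp: kd_zero)

lemma koszul_linear_exact_vec: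
  assumes "vform V 1 j n F" "finite V" "\<And>w. vkd V F w = (\<lambda>_. 0)"
  shows "\<exists>G. vform V 0 (Suc j) n G \<and> vkd V G = F"
proof -
  have "\<exists>g. form V 0 (Suc j) g \<and> kd V g = (\<lambda>w. F w k)" for k
    by (rule koszul_linear_exact) (use assms in \<open>auto simp: vform_def vkd_def fun_eq_iff\<close>)
  then obtain g where g: "\<And>k. form V 0 (Suc j) (g k)" "\<And>k. kd V (g k) = (\<lambda>w. F w k)" by metis
  define G where "G w k = (if k < n then g k w else 0)" for w k
  have "form V 0 (Suc j) (\<lambda>w. G w k)" for k
    by (cases "k < n") (auto simp: G_def g form_zero)
  then have "vform V 0 (Suc j) n G" by (auto simp: vform_def G_def)
  moreover have "vkd V G = F"
  proof (intro ext)
    fix w k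
    show "vkd V G w k = F w k"
      by (cases "k < n") (use assms(1) in \<open>auto simp: vkd_def G_def g kd_zero vform_def\<close>)
  qed
  ultimately show ?thesis by blast
qed

text \<open>A resolution with its augmentation counted as map 0. Map 0 has entries of degree
  \<open>d\<close>, all later maps are linear, and exactness starts at the module of generators,
  which has index \<open>Suc 0\<close>.\<close>

locale linear_complex =
  fixes V :: "'v set" and D :: "nat \<Rightarrow> nat \<Rightarrow> nat \<Rightarrow> ('v, 'k::field) mpoly" and B :: "nat \<Rightarrow> nat" and d :: nat
  assumes finV: "finite V"
    and D0: "\<And>j k. j < B 0 \<Longrightarrow> k < B 1 \<Longrightarrow> D 0 j k \<in> polyR V \<and> homog d (D 0 j k)"
    and DS: "\<And>i j k. j < B (Suc i) \<Longrightarrow> k < B (Suc (Suc i)) \<Longrightarrow> D (Suc i) j k \<in> polyR V \<and> homog 1 (D (Suc i) j k)"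
    and exact: "\<And>i. {v \<in> fvec V (B (Suc i)). dmap (D i) (B i) (B (Suc i)) v = (\<lambda>_. 0)}
        = dmap (D (Suc i)) (B (Suc i)) (B (Suc (Suc i))) ` fvec V (B (Suc (Suc i)))"
begin

abbreviation dd :: "nat \<Rightarrow> (nat \<Rightarrow> ('v, 'k) mpoly) \<Rightarrow> nat \<Rightarrow> ('v, 'k) mpoly" where
  "dd i \<equiv> dmap (D i) (B i) (B (Suc i))"

lemma dd_dd: "u \<in> fvec V (B (Suc (Suc i))) \<Longrightarrow> dd i (dd (Suc i) u) = (\<lambda>_. 0)"
  using exact[of i] by blast

lemma hcomp_lift:
  assumes "dmap M m n u = v" "\<And>j k. j < m \<Longrightarrow> k < n \<Longrightarrow> homog d' (M j k)" "\<And>j. homog (d' + e) (v j)"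
  shows "dmap M m n (\<lambda>k. hcomp e (u k)) = v"
proof
  fix j
  show "dmap M m n (\<lambda>k. hcomp e (u k)) j = v j"
  proof (cases "j < m")
    case True
    have "v j = hcomp (d' + e) (dmap M m n u j)" using assms(1,3) hcomp_homog by metis
    also have "\<dots> = (\<Sum>k<n. M j k * hcomp e (u k))"
      unfolding dmap_def using True assms(2) by (simp add: hcomp_sum hcomp_homog_mult)
    finally show ?thesis using True by (simp add: dmap_def)
  qed (use assms(1) in \<open>auto simp: dmap_def\<close>)
qed

lemma fvec_hcomp: "u \<in> fvec V n \<Longrightarrow> (\<lambda>k. hcomp e (u k)) \<in> fvec V n"
  by (auto simp: fvec_def polyR_hcomp hcomp_homog)

text \<open>The lift is taken value by value. Truncation to one degree makes it homogeneous, a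
  section commuting with negation keeps it alternating, and since the section sends 0 to 0 the
  length and the variables of the words are preserved.\<close>

lemma form_lift:
  fixes M :: "nat \<Rightarrow> nat \<Rightarrow> ('v, 'k) mpoly"
  assumes F: "vform V (d' + e) j m F" and M: "\<And>j k. j < m \<Longrightarrow> k < n \<Longrightarrow> homog d' (M j k)"
    and ex: "\<And>v. v \<in> W \<Longrightarrow> \<exists>u\<in>fvec V n. dmap M m n u = v"
    and W: "\<And>w. F w \<in> W" "\<And>v. v \<in> W \<Longrightarrow> (\<lambda>k. - v k) \<in> W"
  shows "\<exists>G. vform V e j n G \<and> (\<forall>w. dmap M m n (G w) = F w)"
proof -
  define L where "L u v \<longleftrightarrow> u \<in> fvec V n \<and> (\<forall>k. homog e (u k)) \<and> dmap M m n u = v" for u v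
  define W' where "W' = {v \<in> W. \<forall>k. homog (d' + e) (v k)}"
  have "\<exists>s. (\<forall>v\<in>W'. L (s v) v \<and> s (\<lambda>k. - v k) = (\<lambda>k. - s v k)) \<and> s (\<lambda>_. 0) = (\<lambda>_. 0)"
  proof (rule odd_section)
    fix v assume v: "v \<in> W'"
    then obtain u where u: "u \<in> fvec V n" "dmap M m n u = v" using ex unfolding W'_def by blast
    have "dmap M m n (\<lambda>k. hcomp e (u k)) = v"
      by (rule hcomp_lift[OF u(2) M]) (use v in \<open>auto simp: W'_def\<close>)
    then show "\<exists>u. L u v" unfolding L_def using fvec_hcomp[OF u(1)] homog_hcomp by blast
  next
    fix u v assume "L u v"
    then show "L (\<lambda>k. - u k) (\<lambda>k. - v k)"
      by (auto simp: L_def fvec_def polyR_uminus homog_uminus dmap_minus)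
  next
    show "L (\<lambda>_. 0) (\<lambda>_. 0)" by (auto simp: L_def fvec_def dmap_zero)
  next
    fix v assume "v \<in> W'"
    then show "(\<lambda>k. - v k) \<in> W'" using W(2) by (auto simp: W'_def homog_uminus)
  qed
  then obtain s where s: "\<And>v. v \<in> W' \<Longrightarrow> L (s v) v" "\<And>v. v \<in> W' \<Longrightarrow> s (\<lambda>k. - v k) = (\<lambda>k. - s v k)"
    "s (\<lambda>_. 0) = (\<lambda>_. 0)" by blast
  have FW: "F w \<in> W'" for w using F W(1) by (auto simp: W'_def vform_def form_def)
  define G where "G w = s (F w)" for w
  have G: "G w \<in> fvec V n" "homog e (G w k)" "dmap M m n (G w) = F w" for w k
    using s(1)[OF FW[of w]] by (auto simp: G_def L_def)
  have altF: "alt (\<lambda>w. F w k)" for k using F by (auto simp: vform_def form_def)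
  have "form V e j (\<lambda>w. G w k)" for k
    unfolding form_def
  proof (intro conjI allI impI)
    show "alt (\<lambda>w. G w k)"
      unfolding alt_def
    proof (intro conjI allI)
      fix us a b ws
      have "F (us @ a # b # ws) = (\<lambda>k. - F (us @ b # a # ws) k)"
        using alt_swap[OF altF] by blast
      then show "G (us @ a # b # ws) k = - G (us @ b # a # ws) k"
        unfolding G_def using s(2)[OF FW] by metis
    next
      fix us a ws
      have "F (us @ a # a # ws) = (\<lambda>k. 0)" using alt_rep[OF altF] by blast
      then show "G (us @ a # a # ws) k = 0" unfolding G_def using s(3) by metis
    qed
    fix w
    show "G w k \<in> polyR V" using G(1) by (auto simp: fvec_def)
    show "homog e (G w k)" by (rule G)
    assume "G w k \<noteq> 0"
    then have "F w \<noteq> (\<lambda>_. 0)" unfolding G_def using s(3) by metis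
    then obtain k' where "F w k' \<noteq> 0" by auto
    then show "length w = j" "set w \<subseteq> V" using F by (auto simp: vform_def form_def)
  qed
  then have "vform V e j n G" using G(1) by (auto simp: vform_def fvec_def)
  then show ?thesis using G(3) by blast
qed

lemma vform_fvec: "vform V e j n F \<Longrightarrow> F w \<in> fvec V n"
  by (auto simp: vform_def form_def fvec_def)

text \<open>Zigzag through the double complex, by induction on the exterior degree \<open>j\<close>.\<close>
lemma chase:
  assumes "vform V 1 j (B (Suc i)) F" "\<And>w. dd i (vkd V F w) = (\<lambda>_. 0)"
  shows "\<exists>G. vform V 0 (Suc j) (B (Suc i)) G \<and> (\<forall>w. dd i (\<lambda>k. F w k - vkd V G w k) = (\<lambda>_. 0))"
  using assms
proof (induction j arbitrary: i F)
  case 0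
  \<comment> \<open>A form of exterior degree 0 is Koszul closed, so \<open>F\<close> is itself a
    Koszul boundary.\<close>
  have "vkd V F w = (\<lambda>_. 0)" for w
    using 0(1) by (auto simp: vkd_def vform_def intro!: kd_0)
  then obtain G where "vform V 0 (Suc 0) (B (Suc i)) G" "vkd V G = F"
    using koszul_linear_exact_vec[OF 0(1) finV] by blast
  then show ?case by (intro exI[of _ G]) (simp add: dmap_zero)
next
  case (Suc j)
  let ?n = "B (Suc i)" and ?n' = "B (Suc (Suc i))"
  let ?W = "{v \<in> fvec V ?n. dd i v = (\<lambda>_. 0)}"
  \<comment> \<open>Here linearity enters: of the degree \<open>1 + 1\<close> one part is absorbed
    by the linear map \<open>D (Suc i)\<close>, so the lift \<open>F1\<close> has degree 1 again and
    the induction hypothesis applies to it.\<close>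
  have F': "vform V (1 + 1) j ?n (vkd V F)" using vform_vkd[OF Suc.prems(1)] by (simp add: One_nat_def)
  have "\<exists>F1. vform V 1 j ?n' F1 \<and> (\<forall>w. dd (Suc i) (F1 w) = vkd V F w)"
  proof (rule form_lift[OF F'])
    show "homog 1 (D (Suc i) j k)" if "j < ?n" "k < ?n'" for j k using DS that by blast
    show "\<exists>u\<in>fvec V ?n'. dd (Suc i) u = v" if "v \<in> ?W" for v
    proof -
      have "v \<in> dd (Suc i) ` fvec V ?n'" using that unfolding exact .
      then show ?thesis by (elim imageE) (rule bexI, rule sym)
    qed
    show "vkd V F w \<in> ?W" for w using vform_fvec[OF F'] Suc.prems(2) by blast
    show "(\<lambda>k. - v k) \<in> ?W" if "v \<in> ?W" for v
      using that by (auto simp: fvec_def dmap_minus polyR_uminus)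
  qed
  then obtain F1 where F1: "vform V 1 j ?n' F1" "\<And>w. dd (Suc i) (F1 w) = vkd V F w" by blast
  have kk: "vkd V (vkd V F) w = (\<lambda>_. 0)" for w
    using Suc.prems(1) finV by (auto simp: vkd_def vform_def form_def intro!: kd_kd)
  have "dd (Suc i) (vkd V F1 w) = (\<lambda>_. 0)" for w
    by (simp add: dmap_vkd F1(2) kk)
  then obtain G1 where G1: "vform V 0 (Suc j) ?n' G1"
      "\<And>w. dd (Suc i) (\<lambda>k. F1 w k - vkd V G1 w k) = (\<lambda>_. 0)"
    using Suc.IH[OF F1(1)] by blast
  \<comment> \<open>\<open>H\<close> is killed by the next differential and has the same Koszul
    boundary as \<open>F\<close>. Hence \<open>F - H\<close> is Koszul closed with linear
    coefficients, and its primitive \<open>G\<close> works for \<open>F\<close> as well.\<close>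
  define H where "H w = dd (Suc i) (G1 w)" for w
  have H: "vform V 1 (Suc j) ?n H"
    unfolding H_def using vform_dmap[OF G1(1), of ?n "D (Suc i)" 1] DS by simp
  have vH: "vkd V H w = vkd V F w" for w
  proof -
    have "dd (Suc i) (F1 w) k - dd (Suc i) (vkd V G1 w) k = 0" for k
      using fun_cong[OF G1(2)[of w], of k] unfolding dmap_diff .
    then show ?thesis unfolding H_def dmap_vkd[symmetric] F1(2) by (auto simp: fun_eq_iff)
  qed
  define F2 where "F2 w = (\<lambda>k. F w k - H w k)" for w
  have "vform V 1 (Suc j) ?n F2"
    using Suc.prems(1) H unfolding vform_def F2_def by (auto intro: form_diff)
  moreover have "vkd V F2 w = (\<lambda>_. 0)" for w
    using vH[of w] by (simp add: vkd_def F2_def kd_diff fun_eq_iff)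
  ultimately obtain G where G: "vform V 0 (Suc (Suc j)) ?n G" "vkd V G = F2"
    using koszul_linear_exact_vec[OF _ finV] by blast
  have "dd i (\<lambda>k. F w k - vkd V G w k) = (\<lambda>_. 0)" for w
  proof -
    have "(\<lambda>k. F w k - vkd V G w k) = dd (Suc i) (G1 w)" by (simp add: G(2) F2_def H_def)
    then show ?thesis using dd_dd[OF vform_fvec[OF G1(1)]] by simp
  qed
  then show ?case using G(1) by blast
qed

end

section \<open>Koszul cycles with coefficients in an ideal\<close>

lemma gen_ideal_insert_gens:
  assumes "finite F" "F \<subseteq> eps ` {..<b}" "\<forall>g\<in>F. c g \<in> polyR V"
  shows "\<exists>v\<in>fvec V b. (\<Sum>g\<in>F. c g * g) = (\<Sum>j<b. v j * (eps j :: ('v, 'k::comm_ring_1) mpoly))"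
  using assms
proof (induction F rule: finite_induct)
  case empty
  show ?case by (intro bexI[of _ "\<lambda>_. 0"]) (auto simp: fvec_def)
next
  case (insert g F)
  then obtain v where v: "v \<in> fvec V b" "(\<Sum>g\<in>F. c g * g) = (\<Sum>j<b. v j * eps j)" by auto
  obtain i where i: "i < b" "g = eps i" using insert.prems by auto
  let ?v = "v(i := v i + c g)"
  have "?v \<in> fvec V b" using v(1) i insert.prems by (auto simp: fvec_def polyR_add)
  moreover have "(\<Sum>j<b. ?v j * eps j) = (\<Sum>j<b. v j * eps j) + (\<Sum>j<b. if j = i then c g * g else 0)"
    unfolding sum.distrib[symmetric] using i by (intro sum.cong) (auto simp: algebra_simps)
  ultimately show ?case using insert.hyps i v(2) by (intro bexI[of _ ?v]) (auto simp: algebra_simps)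
qed

text \<open>\<open>gen_ideal\<close> sums over distinct generators, a resolution over positions, and
  \<open>eps\<close> may repeat a generator; coefficients at equal generators are added up.\<close>

lemma gen_ideal_image:
  "gen_ideal V (eps ` {..<b}) = (\<lambda>v. \<Sum>j<b. v j * (eps j :: ('v, 'k::comm_ring_1) mpoly)) ` fvec V b"
proof (intro set_eqI iffI)
  fix x assume "x \<in> gen_ideal V (eps ` {..<b})"
  then obtain F c where "finite F" "F \<subseteq> eps ` {..<b}" "\<forall>g\<in>F. c g \<in> polyR V" "x = (\<Sum>g\<in>F. c g * g)"
    unfolding gen_ideal_def by auto
  then show "x \<in> (\<lambda>v. \<Sum>j<b. v j * eps j) ` fvec V b"
    using gen_ideal_insert_gens[of F eps b c V] by blast
next
  fix x assume "x \<in> (\<lambda>v. \<Sum>j<b. v j * eps j) ` fvec V b"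
  then obtain v where v: "v \<in> fvec V b" "x = (\<Sum>j<b. v j * eps j)" by blast
  have "x = (\<Sum>g\<in>eps ` {..<b}. \<Sum>j\<in>{j. j \<in> {..<b} \<and> eps j = g}. v j * eps j)"
    unfolding v(2) by (rule sum.image_gen) simp
  also have "\<dots> = (\<Sum>g\<in>eps ` {..<b}. (\<Sum>j\<in>{j. j \<in> {..<b} \<and> eps j = g}. v j) * g)"
    by (intro sum.cong refl) (simp add: sum_distrib_right)
  finally have "x = (\<Sum>g\<in>eps ` {..<b}. (\<Sum>j\<in>{j. j \<in> {..<b} \<and> eps j = g}. v j) * g)" .
  moreover have "\<forall>g\<in>eps ` {..<b}. (\<Sum>j\<in>{j. j \<in> {..<b} \<and> eps j = g}. v j) \<in> polyR V"
    using v(1) by (auto intro!: polyR_sum simp: fvec_def)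
  ultimately show "x \<in> gen_ideal V (eps ` {..<b})"
    unfolding gen_ideal_def
    by (intro CollectI exI[of _ "eps ` {..<b}"] exI[of _ "\<lambda>g. \<Sum>j\<in>{j. j \<in> {..<b} \<and> eps j = g}. v j"]) auto
qed

lemma homog_mult_mdeg_le:
  fixes p q :: "('v, 'k::comm_ring_1) mpoly"
  assumes "homog d q" "m \<in> Poly_Mapping.keys (p * q)"
  shows "d \<le> mdeg m"
proof -
  obtain a b where "m = a + b" "b \<in> Poly_Mapping.keys q" using keys_mult[of p q] assms(2) by blast
  then show ?thesis using assms(1) by (simp add: homog_def mdeg_plus)
qed

text \<open>Vanishing of a Tor group in elementary form: when the resolution is linear with
  generators of degree \<open>n\<close>, Koszul homology with coefficients in the ideal lives in
  coefficient degree \<open>n\<close>, so a cycle with coefficients of degree \<open>Suc n\<close>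
  bounds inside the ideal.\<close>

theorem lin_res_koszul_exact:
  fixes M :: "('v, 'k::field) mpoly set"
  assumes lin: "lin_res V M" and V: "finite V"
    and deg: "\<And>f m. f \<in> M \<Longrightarrow> m \<in> Poly_Mapping.keys f \<Longrightarrow> n \<le> mdeg m"
    and f0: "f0 \<in> M" "f0 \<noteq> 0" "homog n f0"
    and z: "form V (Suc n) j z" "\<And>w. z w \<in> M" "\<And>w. kd V z w = 0"
  shows "\<exists>g. form V n (Suc j) g \<and> (\<forall>w. g w \<in> M) \<and> kd V g = z"
proof -
  obtain d :: nat and b :: "nat \<Rightarrow> nat" and eps delta where
    eps: "\<forall>j<b 0. eps j \<in> polyR V \<and> homog d (eps j)"
    and delta: "\<forall>i j k. j < b i \<and> k < b (Suc i) \<longrightarrow> delta i j k \<in> polyR V \<and> homog 1 (delta i j k)"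
    and gen: "gen_ideal V (eps ` {..<b 0}) = M"
    and ex0: "{v \<in> fvec V (b 0). (\<Sum>j<b 0. v j * eps j) = 0} = dmap (delta 0) (b 0) (b 1) ` fvec V (b 1)"
    and exS: "\<forall>i. {v \<in> fvec V (b (Suc i)). dmap (delta i) (b i) (b (Suc i)) v = (\<lambda>_. 0)}
        = dmap (delta (Suc i)) (b (Suc i)) (b (Suc (Suc i))) ` fvec V (b (Suc (Suc i)))"
    using lin unfolding lin_res_def by (elim exE conjE)
  have M: "M = (\<lambda>v. \<Sum>j<b 0. v j * eps j) ` fvec V (b 0)"
    unfolding gen[symmetric] gen_ideal_image ..
  \<comment> \<open>Counting the augmentation as map 0, with target of rank 1, shifts the indices of
    the resolution by one.\<close>
  define B where "B i = (case i of 0 \<Rightarrow> 1 | Suc i \<Rightarrow> b i)" for i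
  define D where "D i j k = (case i of 0 \<Rightarrow> eps k | Suc i \<Rightarrow> delta i j k)" for i j k
  have B: "B 0 = 1" "B (Suc i) = b i" for i by (auto simp: B_def)
  have D: "D 0 = (\<lambda>j k. eps k)" "D (Suc i) = delta i" for i by (auto simp: D_def fun_eq_iff)
  have D0_sum: "dmap (D 0) (B 0) (B (Suc 0)) v = (\<lambda>j. if j = 0 then \<Sum>k<b 0. v k * eps k else 0)" for v
    by (auto simp: dmap_def B D fun_eq_iff mult.commute)
  have "linear_complex V D B d"
  proof
    fix j k assume "j < B 0" "k < B 1"
    then show "D 0 j k \<in> polyR V \<and> homog d (D 0 j k)" using eps B(2)[of 0] by (simp add: D One_nat_def)
  next
    fix i j k assume "j < B (Suc i)" "k < B (Suc (Suc i))"
    then show "D (Suc i) j k \<in> polyR V \<and> homog 1 (D (Suc i) j k)" using delta by (simp add: B D)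
  next
    fix i
    show "{v \<in> fvec V (B (Suc i)). dmap (D i) (B i) (B (Suc i)) v = (\<lambda>_. 0)}
        = dmap (D (Suc i)) (B (Suc i)) (B (Suc (Suc i))) ` fvec V (B (Suc (Suc i)))"
    proof (cases i)
      case 0
      have "dmap (D 0) (B 0) (B (Suc 0)) v = (\<lambda>_. 0) \<longleftrightarrow> (\<Sum>j<b 0. v j * eps j) = 0" for v
        unfolding D0_sum by (auto simp: fun_eq_iff)
      then show ?thesis unfolding 0 using ex0 by (simp add: B D One_nat_def)
    next
      case (Suc i')
      then show ?thesis using exS[rule_format, of i'] by (simp add: B D)
    qed
  qed (rule V)
  then interpret linear_complex V D B d .
  obtain v0 where v0: "f0 = (\<Sum>j<b 0. v0 j * eps j)" using f0(1) unfolding M by blast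
  \<comment> \<open>The degree \<open>d\<close> comes from an existential statement. Some generator
    occurs in \<open>f0\<close>, which gives \<open>d \<le> n\<close>; that generator lies in
    \<open>M\<close>, which gives \<open>n \<le> d\<close>.\<close>
  have "d = n"
  proof (rule antisym)
    obtain m where m: "m \<in> Poly_Mapping.keys f0" using f0(2) by (metis ex_in_conv keys_eq_empty)
    have "lk f0 m \<noteq> 0" using m by (simp add: in_keys_iff)
    then obtain i where i: "i < b 0" "lk (v0 i * eps i) m \<noteq> 0"
      unfolding v0 lookup_sum by (metis (no_types, lifting) lessThan_iff sum.neutral)
    then have "d \<le> mdeg m" using eps homog_mult_mdeg_le[of d "eps i" m "v0 i"] by (simp add: in_keys_iff)
    then show "d \<le> n" using m f0(3) by (simp add: homog_def)
    have "eps i \<noteq> 0" using i(2) by auto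
    then obtain m' where m': "m' \<in> Poly_Mapping.keys (eps i)" by (metis ex_in_conv keys_eq_empty)
    have "eps i = (\<Sum>j<b 0. (if j = i then 1 else 0) * eps j)"
      using i(1) by (simp add: if_distrib[of "\<lambda>x. x * _"] cong: if_cong)
    moreover have "(\<lambda>j. if j = i then 1 else 0) \<in> fvec V (b 0)" using i(1) by (auto simp: fvec_def)
    ultimately have "eps i \<in> M" unfolding M by (rule image_eqI)
    then show "n \<le> d" using deg[OF _ m'] m' eps i(1) by (simp add: homog_def)
  qed
  define Z where "Z w = (\<lambda>k. if k = (0::nat) then z w else 0)" for w
  have Z: "vform V (d + 1) j (B 0) Z"
    unfolding vform_def
  proof (intro conjI allI impI)
    fix k show "form V (d + 1) j (\<lambda>w. Z w k)"
      using z(1) \<open>d = n\<close> by (cases "k = 0") (simp_all add: Z_def form_zero One_nat_def)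
  qed (simp add: Z_def B)
  let ?W = "{v. (\<exists>x\<in>M. v = (\<lambda>k. if k = (0::nat) then x else 0))}"
  have "\<exists>F. vform V 1 j (B (Suc 0)) F \<and> (\<forall>w. dd 0 (F w) = Z w)"
  proof (rule form_lift[OF Z])
    show "homog d (D 0 j k)" if "j < B 0" "k < B (Suc 0)" for j k using that eps by (simp add: B D)
    show "\<exists>u\<in>fvec V (B (Suc 0)). dd 0 u = v" if v: "v \<in> ?W" for v
    proof -
      obtain x where x: "x \<in> M" "v = (\<lambda>k. if k = 0 then x else 0)" using v by blast
      then obtain u where "u \<in> fvec V (b 0)" "x = (\<Sum>j<b 0. u j * eps j)" unfolding M by blast
      then show ?thesis unfolding D0_sum x(2) by (intro bexI[of _ u]) (simp_all add: B fun_eq_iff)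
    qed
    show "Z w \<in> ?W" for w using z(2) by (auto simp: Z_def)
    show "(\<lambda>k. - v k) \<in> ?W" if v: "v \<in> ?W" for v
    proof -
      obtain x where x: "x \<in> M" "v = (\<lambda>k. if k = 0 then x else 0)" using v by blast
      then obtain u where u: "u \<in> fvec V (b 0)" "x = (\<Sum>j<b 0. u j * eps j)" unfolding M by blast
      have "- x = (\<Sum>j<b 0. (- u j) * eps j)" by (simp add: u(2) sum_negf)
      moreover have "(\<lambda>j. - u j) \<in> fvec V (b 0)" using u(1) by (auto simp: fvec_def polyR_uminus)
      ultimately have "- x \<in> M" unfolding M by (rule image_eqI)
      moreover have "(\<lambda>k. - v k) = (\<lambda>k. if k = 0 then - x else 0)" unfolding x(2) by auto
      ultimately show ?thesis by blast
    qed
  qed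
  then obtain F where F: "vform V 1 j (B (Suc 0)) F" "\<And>w. dd 0 (F w) = Z w" by blast
  have kZ: "vkd V Z w = (\<lambda>_. 0)" for w
  proof
    fix k show "vkd V Z w k = 0"
      using z(3) by (cases "k = 0") (simp_all add: vkd_def Z_def kd_zero)
  qed
  have "dd 0 (vkd V F w) = (\<lambda>_. 0)" for w
    unfolding dmap_vkd F(2) by (rule kZ)
  then obtain G where G: "vform V 0 (Suc j) (B (Suc 0)) G" "\<And>w. dd 0 (\<lambda>k. F w k - vkd V G w k) = (\<lambda>_. 0)"
    using chase[OF F(1)] by blast
  define g where "g w = dd 0 (G w) 0" for w
  have "vform V (d + 0) (Suc j) (B 0) (\<lambda>w. dd 0 (G w))"
    by (rule vform_dmap[OF G(1)]) (use eps in \<open>simp add: B D\<close>)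
  then have "form V n (Suc j) g" unfolding vform_def g_def by (simp add: \<open>d = n\<close>)
  moreover have "g w \<in> M" for w
  proof -
    have "g w = (\<Sum>k<b 0. G w k * eps k)" unfolding g_def D0_sum by simp
    then show ?thesis unfolding M using vform_fvec[OF G(1)] by (auto simp: B)
  qed
  moreover have "kd V g = z"
  proof
    fix w
    have "dd 0 (F w) 0 - dd 0 (vkd V G w) 0 = 0" using fun_cong[OF G(2)[of w], of 0] unfolding dmap_diff .
    then show "kd V g w = z w" unfolding F(2) dmap_vkd by (simp add: Z_def g_def[abs_def] vkd_def)
  qed
  ultimately show ?thesis by blast
qed

section \<open>Cells in lattices of down-sets\<close>

text \<open>The set \<open>C\<close> records elements forced to be present. The half containing
  \<open>m\<close> forces everything below \<open>m\<close>, so with this parameter the recursion of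
  \<open>good\<close> stays within one class of families.\<close>

definition downs :: "'a::order set \<Rightarrow> 'a set \<Rightarrow> 'a set set" where
  "downs X C = {A. A \<subseteq> X \<and> C \<subseteq> A \<and> (\<forall>t\<in>A. \<forall>s\<in>X. s \<le> t \<longrightarrow> s \<in> A)}"

definition is_cell :: "'a set set \<Rightarrow> 'a set \<Rightarrow> 'a set \<Rightarrow> bool" where
  "is_cell L B T \<longleftrightarrow> B \<inter> T = {} \<and> (\<forall>U\<subseteq>T. B \<union> U \<in> L)"

text \<open>The cell condition in a form fit for induction: \<open>I\<close> and \<open>J\<close>
  are arbitrary families, constrained only on \<open>L\<close>, so that each may be shifted by
  \<open>m\<close> independently of the other.\<close>

definition linked :: "'a set set \<Rightarrow> 'a set set \<Rightarrow> 'a set set \<Rightarrow> bool" where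
  "linked L I J \<longleftrightarrow>
     (\<forall>A\<in>L. \<forall>B\<in>L. A \<subseteq> B \<longrightarrow> B \<in> I \<longrightarrow> A \<in> I) \<and>
     (\<forall>A\<in>L. \<forall>B\<in>L. A \<subseteq> B \<longrightarrow> A \<in> J \<longrightarrow> B \<in> J) \<and>
     (\<forall>B T. is_cell L B T \<longrightarrow> B \<union> T \<in> I \<or> B \<in> J)"

lemma linkedD:
  assumes "linked L I J"
  shows "A \<in> L \<Longrightarrow> B \<in> L \<Longrightarrow> A \<subseteq> B \<Longrightarrow> B \<in> I \<Longrightarrow> A \<in> I"
    and "A \<in> L \<Longrightarrow> B \<in> L \<Longrightarrow> A \<subseteq> B \<Longrightarrow> A \<in> J \<Longrightarrow> B \<in> J"
    and "is_cell L B T \<Longrightarrow> B \<union> T \<in> I \<or> B \<in> J"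
  using assms unfolding linked_def by blast+

lemma linked_pullback:
  assumes "linked L I J" and f: "\<And>A. A \<in> L' \<Longrightarrow> A \<in> L"
  shows "linked L' I J"
  using assms unfolding linked_def is_cell_def by meson

lemma linked_insert:
  assumes "linked L I J" and f: "\<And>A. A \<in> L' \<Longrightarrow> insert m A \<in> L \<and> m \<notin> A"
  shows "linked L' {A. insert m A \<in> I} {A. insert m A \<in> J}"
  unfolding linked_def
proof (intro conjI ballI allI impI)
  fix A B assume "A \<in> L'" "B \<in> L'" "A \<subseteq> B" "B \<in> {A. insert m A \<in> I}"
  then show "A \<in> {A. insert m A \<in> I}"
    using linkedD(1)[OF assms(1), of "insert m A" "insert m B"] f by blast
next
  fix A B assume "A \<in> L'" "B \<in> L'" "A \<subseteq> B" "A \<in> {A. insert m A \<in> J}"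
  then show "B \<in> {A. insert m A \<in> J}"
    using linkedD(2)[OF assms(1), of "insert m A" "insert m B"] f by blast
next
  fix B T assume c: "is_cell L' B T"
  have "is_cell L (insert m B) T"
    unfolding is_cell_def
  proof (intro conjI allI impI)
    have "m \<notin> B \<union> T" using c f unfolding is_cell_def by blast
    then show "insert m B \<inter> T = {}" using c unfolding is_cell_def by blast
    fix U assume "U \<subseteq> T"
    then have "insert m (B \<union> U) \<in> L" using c f unfolding is_cell_def by blast
    then show "insert m B \<union> U \<in> L" by simp
  qed
  from linkedD(3)[OF assms(1) this]
  show "B \<union> T \<in> {A. insert m A \<in> I} \<or> B \<in> {A. insert m A \<in> J}" by simp
qed

text \<open>By monotonicity an edge lies in I \<inter> J as soon as its upper end is in I and its
  lower end in J, hence the mixed pair. A cell \<open>(B, T)\<close> of edges in direction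
  \<open>m\<close> is the cell \<open>(B, insert m T)\<close> of \<open>L\<close>.\<close>

lemma linked_edge:
  assumes "linked L I J" and f: "\<And>A. A \<in> L' \<Longrightarrow> A \<in> L \<and> insert m A \<in> L \<and> m \<notin> A"
  shows "linked L' {A. insert m A \<in> I} J"
  unfolding linked_def
proof (intro conjI ballI allI impI)
  fix A B assume "A \<in> L'" "B \<in> L'" "A \<subseteq> B" "B \<in> {A. insert m A \<in> I}"
  then show "A \<in> {A. insert m A \<in> I}"
    using linkedD(1)[OF assms(1), of "insert m A" "insert m B"] f by blast
next
  fix A B assume "A \<in> L'" "B \<in> L'" "A \<subseteq> B" "A \<in> J"
  then show "B \<in> J"
    using linkedD(2)[OF assms(1), of A B] f by blast
next
  fix B T assume c: "is_cell L' B T"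
  have "is_cell L B (insert m T)"
    unfolding is_cell_def
  proof (intro conjI allI impI)
    have "m \<notin> B \<union> {}" using c f unfolding is_cell_def by blast
    then show "B \<inter> insert m T = {}" using c unfolding is_cell_def by blast
    fix U assume U: "U \<subseteq> insert m T"
    then have L': "B \<union> (U - {m}) \<in> L'" using c unfolding is_cell_def by blast
    show "B \<union> U \<in> L"
    proof (cases "m \<in> U")
      case True
      then have "B \<union> U = insert m (B \<union> (U - {m}))" by blast
      then show ?thesis using f[OF L'] by simp
    next
      case False
      then have "B \<union> U = B \<union> (U - {m})" by blast
      then show ?thesis using f[OF L'] by simp
    qed
  qed
  from linkedD(3)[OF assms(1) this]
  show "B \<union> T \<in> {A. insert m A \<in> I} \<or> B \<in> J" by simp
qed

text \<open>Climb from \<open>A\<close> to \<open>B\<close> by adding one minimal missing element at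
  a time. As long as the current set is outside \<open>J\<close>, the cell consisting of the next
  edge forces the next set into \<open>I\<close>; since \<open>B\<close> is in \<open>J\<close>, the
  climb meets \<open>J\<close>.\<close>

lemma linked_interpolate:
  assumes l: "linked (downs X C) I J" and X: "finite X"
  shows "A \<in> downs X C \<Longrightarrow> B \<in> downs X C \<Longrightarrow> A \<subseteq> B \<Longrightarrow> A \<in> I \<Longrightarrow> B \<in> J \<Longrightarrow>
    \<exists>E\<in>downs X C \<inter> I \<inter> J. A \<subseteq> E \<and> E \<subseteq> B"
proof (induction "card (B - A)" arbitrary: A rule: less_induct)
  case (less A)
  show ?case
  proof (cases "A \<in> J")
    case True
    then show ?thesis using less.prems by blast
  next
    case False
    then have "B - A \<noteq> {}" using less.prems by auto
    have BX: "B \<subseteq> X" using less.prems(2) by (simp add: downs_def)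
    then have fin: "finite (B - A)" using X by (meson finite_Diff finite_subset)
    obtain t where t: "t \<in> B - A" "\<And>s. s \<in> B - A \<Longrightarrow> s \<le> t \<Longrightarrow> t = s"
      using finite_has_minimal[OF fin \<open>B - A \<noteq> {}\<close>] by blast
    have At: "insert t A \<in> downs X C"
      unfolding downs_def
    proof (intro CollectI conjI ballI impI)
      show "insert t A \<subseteq> X" using t(1) BX less.prems(1) by (auto simp: downs_def)
      show "C \<subseteq> insert t A" using less.prems(1) by (auto simp: downs_def)
      fix r s assume r: "r \<in> insert t A" "s \<in> X" "s \<le> r"
      show "s \<in> insert t A"
      proof (cases "r = t")
        case True
        then have "s \<in> B" using r t(1) less.prems(2) by (auto simp: downs_def)
        then show ?thesis using t(2)[of s] r(3) True by blast
      next
        case False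
        then show ?thesis using r less.prems(1) by (auto simp: downs_def)
      qed
    qed
    have "is_cell (downs X C) A {t}"
      unfolding is_cell_def using t(1) At less.prems(1) by (auto simp: subset_singleton_iff)
    then have AtI: "insert t A \<in> I" using linkedD(3)[OF l, of A "{t}"] False by simp
    have "B - insert t A \<subset> B - A" using t(1) by blast
    then have "card (B - insert t A) < card (B - A)" using fin by (rule psubset_card_mono[rotated])
    then obtain E where "E\<in>downs X C \<inter> I \<inter> J" "insert t A \<subseteq> E" "E \<subseteq> B"
      using less.hyps[OF _ At less.prems(2) _ AtI less.prems(5)] t(1) less.prems(3) by blast
    then show ?thesis by blast
  qed
qed

text \<open>The head \<open>m\<close> of the list is maximal, so deleting it from a down-set leaves
  a down-set. \<open>F\<close> is prescribed only on subsets of \<open>set xs\<close>, because a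
  slice may also contain sets with \<open>m\<close>, which the recursion never looks at.\<close>

lemma good_linked:
  fixes xs :: "'a::order list"
  assumes "sorted_wrt (\<lambda>m s. \<not> m \<le> s) xs" "linked (downs (set xs) C) I J"
    "\<And>A. A \<subseteq> set xs \<Longrightarrow> A \<in> F \<longleftrightarrow> A \<in> downs (set xs) C \<and> A \<in> I \<and> A \<in> J"
  shows "good xs F"
  using assms
proof (induction xs arbitrary: C I J F)
  case (Cons m xs)
  let ?X = "set xs" and ?M = "{s \<in> set xs. s \<le> m}"
  let ?I1 = "{A. insert m A \<in> I}" and ?J1 = "{A. insert m A \<in> J}"
  let ?L = "downs (insert m ?X) C"
  have max: "\<not> m \<le> s" if "s \<in> ?X" for s using Cons.prems(1) that by simp
  then have m: "m \<notin> ?X" by blast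
  have sorted: "sorted_wrt (\<lambda>m s. \<not> m \<le> s) xs" using Cons.prems(1) by simp
  have l: "linked ?L I J" using Cons.prems(2) by simp
  have F: "A \<in> F \<longleftrightarrow> A \<in> ?L \<and> A \<in> I \<and> A \<in> J" if "A \<subseteq> insert m ?X" for A
    using Cons.prems(3) that by simp
  have D0: "A \<in> ?L \<longleftrightarrow> A \<in> downs ?X C" if "A \<subseteq> ?X" for A
  proof
    assume "A \<in> ?L"
    then show "A \<in> downs ?X C" using that by (auto simp: downs_def)
  next
    assume A: "A \<in> downs ?X C"
    have "\<not> m \<le> t" if "t \<in> A" for t using that max \<open>A \<subseteq> ?X\<close> by blast
    then show "A \<in> ?L" using A by (auto simp: downs_def)
  qed
  \<comment> \<open>\<open>m\<close> itself is supplied by the insertion and leaves the set of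
    forced elements; the elements below \<open>m\<close> enter it.\<close>
  have D1: "insert m A \<in> ?L \<longleftrightarrow> A \<in> downs ?X (C - {m} \<union> ?M)" if "A \<subseteq> ?X" for A
  proof
    assume "insert m A \<in> ?L"
    then show "A \<in> downs ?X (C - {m} \<union> ?M)" using that m by (auto simp: downs_def)
  next
    assume A: "A \<in> downs ?X (C - {m} \<union> ?M)"
    have "\<not> m \<le> t" if "t \<in> A" for t using that max \<open>A \<subseteq> ?X\<close> by blast
    then show "insert m A \<in> ?L" using A by (auto simp: downs_def)
  qed
  have sub: "A \<subseteq> ?X \<and> m \<notin> A" if "A \<in> downs ?X C'" for A C' using that m by (auto simp: downs_def)
  have D01: "A \<in> downs ?X C \<and> A \<in> downs ?X (C - {m} \<union> ?M)" if "A \<in> downs ?X (C \<union> ?M)" for A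
    using that by (auto simp: downs_def)
  have l0: "linked (downs ?X C) I J"
  proof (rule linked_pullback[OF l])
    fix A assume A: "A \<in> downs ?X C"
    show "A \<in> ?L" using D0[of A] sub[OF A] A by simp
  qed
  have l1: "linked (downs ?X (C - {m} \<union> ?M)) ?I1 ?J1"
  proof (rule linked_insert[OF l])
    fix A assume A: "A \<in> downs ?X (C - {m} \<union> ?M)"
    show "insert m A \<in> ?L \<and> m \<notin> A" using D1[of A] sub[OF A] A by simp
  qed
  have l01: "linked (downs ?X (C \<union> ?M)) ?I1 J"
  proof (rule linked_edge[OF l])
    fix A assume A: "A \<in> downs ?X (C \<union> ?M)"
    then show "A \<in> ?L \<and> insert m A \<in> ?L \<and> m \<notin> A"
      using D01[OF A] sub[OF A] D0[of A] D1[of A] by simp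
  qed
  have S0: "A \<in> F \<longleftrightarrow> A \<in> downs ?X C \<and> A \<in> I \<and> A \<in> J" if "A \<subseteq> ?X" for A
    using F[of A] D0[OF that] that by blast
  have S1: "A \<in> slice m F \<longleftrightarrow> A \<in> downs ?X (C - {m} \<union> ?M) \<and> A \<in> ?I1 \<and> A \<in> ?J1" if "A \<subseteq> ?X" for A
    using F[of "insert m A"] D1[OF that] that unfolding slice_def by blast
  have S01: "A \<in> F \<inter> slice m F \<longleftrightarrow> A \<in> downs ?X (C \<union> ?M) \<and> A \<in> ?I1 \<and> A \<in> J" if A: "A \<subseteq> ?X" for A
  proof
    assume "A \<in> F \<inter> slice m F"
    then have "A \<in> downs ?X C" "A \<in> downs ?X (C - {m} \<union> ?M)" "A \<in> ?I1" "A \<in> J"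
      using S0[OF A] S1[OF A] by simp_all
    then show "A \<in> downs ?X (C \<union> ?M) \<and> A \<in> ?I1 \<and> A \<in> J" by (auto simp: downs_def)
  next
    assume r: "A \<in> downs ?X (C \<union> ?M) \<and> A \<in> ?I1 \<and> A \<in> J"
    then have L: "A \<in> ?L" "insert m A \<in> ?L" using D01[of A] D0[OF A] D1[OF A] by simp_all
    then have "A \<in> I" "insert m A \<in> J"
      using linkedD(1)[OF l L] linkedD(2)[OF l L] r by (simp_all add: subset_insertI)
    then show "A \<in> F \<inter> slice m F" using S0[OF A] S1[OF A] r D01[of A] by simp
  qed
  have "\<exists>E\<in>F \<inter> slice m F. A \<inter> B \<subseteq> E \<and> E \<subseteq> A \<union> B"
    if AB: "A \<in> F" "B \<in> slice m F" "A \<subseteq> ?X" "B \<subseteq> ?X" for A B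
  proof -
    \<comment> \<open>Interpolation takes place in the lattice of edges. The elements below
      \<open>m\<close> are added so that \<open>?S\<close> is the lower end of an edge; they all lie
      in \<open>B\<close>, so \<open>?S\<close> stays below the union. The lower bound is in
      \<open>?I1\<close> because of \<open>B\<close>, the upper bound in \<open>J\<close> because of
      \<open>A\<close>.\<close>
    let ?S = "A \<inter> B \<union> ?M"
    have a: "A \<in> downs ?X C" "A \<in> J" and b: "B \<in> downs ?X (C - {m} \<union> ?M)" "B \<in> ?I1"
      using AB S0[OF AB(3)] S1[OF AB(4)] by simp_all
    have "C \<subseteq> A" "C - {m} \<subseteq> B" "?M \<subseteq> B" using a(1) b(1) by (auto simp: downs_def)
    moreover have "m \<notin> C" using m AB(3) \<open>C \<subseteq> A\<close> by blast
    ultimately have CB: "C \<subseteq> A \<inter> B" by blast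
    have down: "s \<in> A" if "t \<in> A" "s \<in> ?X" "s \<le> t" for s t using a(1) that by (simp add: downs_def)
    have down': "s \<in> B" if "t \<in> B" "s \<in> ?X" "s \<le> t" for s t using b(1) that by (simp add: downs_def)
    have Sd: "?S \<in> downs ?X (C \<union> ?M)"
      unfolding downs_def using CB AB(3) down down' by (auto intro: order_trans)
    have Ud: "A \<union> B \<in> downs ?X (C \<union> ?M)"
      unfolding downs_def using CB \<open>?M \<subseteq> B\<close> AB(3,4) down down' by auto
    have "?S \<in> downs ?X (C - {m} \<union> ?M)" using D01[OF Sd] by simp
    moreover have "?S \<subseteq> ?X" using AB(3) by blast
    ultimately have "insert m ?S \<in> ?L" "insert m B \<in> ?L" using D1[of ?S] D1[OF AB(4)] b(1) by simp_all
    moreover have "insert m ?S \<subseteq> insert m B" using \<open>?M \<subseteq> B\<close> by blast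
    ultimately have "?S \<in> ?I1" using linkedD(1)[OF l, of "insert m ?S" "insert m B"] b(2) by simp
    moreover have "A \<union> B \<in> J"
      using linkedD(2)[OF l0 a(1), of "A \<union> B"] D01[OF Ud] a(2) by simp
    moreover have "?S \<subseteq> A \<union> B" using \<open>?M \<subseteq> B\<close> by blast
    ultimately have "\<exists>E\<in>downs ?X (C \<union> ?M) \<inter> ?I1 \<inter> J. ?S \<subseteq> E \<and> E \<subseteq> A \<union> B"
      by (intro linked_interpolate[OF l01 finite_set Sd Ud])
    then obtain E where E: "E \<in> downs ?X (C \<union> ?M) \<inter> ?I1 \<inter> J" "?S \<subseteq> E" "E \<subseteq> A \<union> B"
      by (elim bexE conjE)
    moreover have "E \<subseteq> ?X" using E(3) AB(3,4) by blast
    ultimately have "E \<in> F \<inter> slice m F" using S01[of E] E(1) by simp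
    then show ?thesis using E by blast
  qed
  then show ?case
    using Cons.IH[OF sorted l0 S0] Cons.IH[OF sorted l1 S1] Cons.IH[OF sorted l01 S01] by auto
qed simp

text \<open>A reversed linear extension, obtained by peeling off maximal elements.\<close>

lemma exists_sorted_enum:
  fixes X :: "'a::order set"
  assumes "finite X"
  shows "\<exists>xs. set xs = X \<and> sorted_wrt (\<lambda>m s. \<not> m \<le> s) xs"
  using assms
proof (induction "card X" arbitrary: X)
  case (Suc n)
  then have "X \<noteq> {}" by auto
  obtain m where m: "m \<in> X" "\<And>s. s \<in> X \<Longrightarrow> m \<le> s \<Longrightarrow> m = s"
    using finite_has_maximal[OF Suc.prems \<open>X \<noteq> {}\<close>] by blast
  have "n = card (X - {m})" using Suc m(1) by simp
  then obtain xs where "set xs = X - {m}" "sorted_wrt (\<lambda>m s. \<not> m \<le> s) xs"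
    using Suc.hyps(1)[of "X - {m}"] Suc.prems by blast
  then show ?case using m by (intro exI[of _ "m # xs"]) auto
qed simp

section \<open>Finite distributive lattices\<close>

lemma le_bigmeet_iff:
  fixes x :: "'a::{finite, distrib_lattice, bounded_lattice}"
  shows "x \<le> bigmeet A \<longleftrightarrow> (\<forall>a\<in>A. x \<le> a)"
proof -
  interpret comp_fun_idem "inf :: 'a \<Rightarrow> 'a \<Rightarrow> 'a" by (rule comp_fun_idem_inf)
  have "finite A" by simp
  then show ?thesis unfolding bigmeet_def by (induction A rule: finite_induct) auto
qed

lemma bigjoin_le_iff:
  fixes x :: "'a::{finite, distrib_lattice, bounded_lattice}"
  shows "bigjoin A \<le> x \<longleftrightarrow> (\<forall>a\<in>A. a \<le> x)"
proof -
  interpret comp_fun_idem "sup :: 'a \<Rightarrow> 'a \<Rightarrow> 'a" by (rule comp_fun_idem_sup)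
  have "finite A" by simp
  then show ?thesis unfolding bigjoin_def by (induction A rule: finite_induct) auto
qed

lemma lower_nbr_above:
  fixes x p :: "'a::{finite, distrib_lattice, bounded_lattice}"
  assumes "x < p"
  obtains q where "q \<in> lower_nbrs p" "x \<le> q"
proof -
  have "finite {z. x \<le> z \<and> z < p}" "{z. x \<le> z \<and> z < p} \<noteq> {}" using assms by auto
  from finite_has_maximal[OF this]
  obtain q where q: "x \<le> q" "q < p" "\<And>z. x \<le> z \<Longrightarrow> z < p \<Longrightarrow> q \<le> z \<Longrightarrow> q = z" by auto
  have "\<not> (\<exists>z. q < z \<and> z < p)"
  proof
    assume "\<exists>z. q < z \<and> z < p"
    then obtain z where z: "q < z" "z < p" by blast
    then have "q = z" using q(1) by (intro q(3)) auto
    then show False using z by simp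
  qed
  then show thesis using q that unfolding lower_nbrs_def by blast
qed

lemma join_irred_lower:
  fixes t :: "'a::{finite, distrib_lattice, bounded_lattice}"
  assumes "t \<in> join_irred"
  obtains c where "\<And>x. x < t \<longleftrightarrow> x \<le> c"
proof -
  obtain c where c: "lower_nbrs t = {c}" using assms card_1_singletonE[of "lower_nbrs t"] unfolding join_irred_def mem_Collect_eq by blast
  have "x < t \<longleftrightarrow> x \<le> c" for x
  proof
    assume "x < t"
    then show "x \<le> c" using c by (metis lower_nbr_above singletonD)
  next
    assume "x \<le> c"
    moreover have "c < t" using c unfolding lower_nbrs_def by blast
    ultimately show "x < t" by (rule order.strict_trans1)
  qed
  then show thesis by (rule that)
qed

text \<open>By distributivity \<open>t\<close> is the join of its meets with \<open>a\<close> and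
  \<open>b\<close>. Were both meets strictly below \<open>t\<close>, they and their join would lie
  below the unique lower neighbour of \<open>t\<close>.\<close>

lemma join_irred_prime:
  fixes t :: "'a::{finite, distrib_lattice, bounded_lattice}"
  assumes "t \<in> join_irred" "t \<le> sup a b"
  shows "t \<le> a \<or> t \<le> b"
proof (rule ccontr)
  assume n: "\<not> (t \<le> a \<or> t \<le> b)"
  obtain c where c: "\<And>x. x < t \<longleftrightarrow> x \<le> c" using join_irred_lower[OF assms(1)] by blast
  have "inf t a < t" "inf t b < t" using n by (metis inf.cobounded1 inf.absorb_iff1 order.not_eq_order_implies_strict)+
  then have "sup (inf t a) (inf t b) < t" using c by (metis sup_least)
  moreover have "sup (inf t a) (inf t b) = t"
    using assms(2) by (metis inf_sup_distrib1 inf.absorb1)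
  ultimately show False by simp
qed

lemma join_irred_not_bot: "(bot :: 'a::{finite, distrib_lattice, bounded_lattice}) \<notin> join_irred"
  using join_irred_lower by (metis bot.extremum not_less_bot)

text \<open>A minimal element \<open>t\<close> among those below \<open>a\<close> but not below
  \<open>b\<close> works: everything strictly below \<open>t\<close> is below \<open>b\<close>,
  while two distinct lower neighbours would have join \<open>t\<close>.\<close>

lemma join_irred_separates:
  fixes a b :: "'a::{finite, distrib_lattice, bounded_lattice}"
  assumes "\<not> a \<le> b"
  obtains t where "t \<in> join_irred" "t \<le> a" "\<not> t \<le> b"
proof -
  have "finite {z. z \<le> a \<and> \<not> z \<le> b}" "{z. z \<le> a \<and> \<not> z \<le> b} \<noteq> {}" using assms by auto
  from finite_has_minimal[OF this]
  obtain t where t: "t \<le> a" "\<not> t \<le> b" "\<And>z. z \<le> a \<Longrightarrow> \<not> z \<le> b \<Longrightarrow> z \<le> t \<Longrightarrow> t = z" by auto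
  have below: "z \<le> b" if "z < t" for z
  proof (rule ccontr)
    assume "\<not> z \<le> b"
    moreover have "z \<le> a" using that t(1) by simp
    ultimately have "t = z" using that by (intro t(3)) auto
    then show False using that by simp
  qed
  have "bot < t" using t(2) by (metis bot.extremum bot.not_eq_extremum)
  then obtain q where q: "q \<in> lower_nbrs t" using lower_nbr_above by blast
  have "q' = q" if q': "q' \<in> lower_nbrs t" for q'
  proof (rule ccontr)
    assume "q' \<noteq> q"
    have lt: "q < t" "q' < t" "\<not> (\<exists>z. q < z \<and> z < t)" "\<not> (\<exists>z. q' < z \<and> z < t)"
      using q q' unfolding lower_nbrs_def by blast+
    have "sup q q' < t \<or> sup q q' = t" using lt(1,2) by (simp add: order.strict_iff_order)
    then have "sup q q' = t"
    proof
      assume "sup q q' < t"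
      then have "\<not> q < sup q q'" "\<not> q' < sup q q'" using lt by blast+
      then show "sup q q' = t" using \<open>q' \<noteq> q\<close> by (metis order.not_eq_order_implies_strict sup_ge1 sup_ge2)
    qed
    then show False using t(2) below[OF lt(1)] below[OF lt(2)] by (metis sup_least)
  qed
  then have "lower_nbrs t = {q}" using q by blast
  then have "t \<in> join_irred" by (simp add: join_irred_def)
  then show thesis using t that by blast
qed

lemma lset_subset_iff: "lset (a:: 'a::{finite, distrib_lattice, bounded_lattice}) \<subseteq> lset b \<longleftrightarrow> a \<le> b"
proof
  assume s: "lset a \<subseteq> lset b"
  show "a \<le> b"
  proof (rule ccontr)
    assume "\<not> a \<le> b"
    then obtain t where "t \<in> join_irred" "t \<le> a" "\<not> t \<le> b" by (rule join_irred_separates)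
    then show False using s by (auto simp: lset_def)
  qed
qed (auto simp: lset_def)

lemma lset_mono: "(a:: 'a::{finite, distrib_lattice, bounded_lattice}) \<le> b \<Longrightarrow> lset a \<subseteq> lset b"
  by (simp add: lset_subset_iff)

lemma lset_eq_iff: "lset (a:: 'a::{finite, distrib_lattice, bounded_lattice}) = lset b \<longleftrightarrow> a = b"
  by (metis lset_subset_iff order_antisym order_refl)

lemma join_irred_le_bigjoin:
  fixes t :: "'a::{finite, distrib_lattice, bounded_lattice}"
  assumes "t \<in> join_irred" "t \<le> bigjoin A"
  shows "\<exists>a\<in>A. t \<le> a"
proof -
  interpret comp_fun_idem "sup :: 'a \<Rightarrow> 'a \<Rightarrow> 'a" by (rule comp_fun_idem_sup)
  have "finite A" by simp
  then show ?thesis using assms(2) unfolding bigjoin_def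
  proof (induction A rule: finite_induct)
    case empty
    then have "t = bot" by (simp add: bot_unique)
    then show ?case using assms(1) by (simp add: join_irred_not_bot)
  next
    case (insert x A)
    then show ?case using join_irred_prime[OF assms(1)] by auto
  qed
qed

text \<open>Birkhoff representation: a down-set comes from its join, and primeness keeps further
  join-irreducible elements out.\<close>

lemma range_lset: "range (lset :: 'a::{finite, distrib_lattice, bounded_lattice} \<Rightarrow> 'a set) = downs join_irred {}"
proof (intro set_eqI iffI)
  fix A :: "'a set" assume "A \<in> downs join_irred {}"
  then have A: "A \<subseteq> join_irred" "\<And>t s. t \<in> A \<Longrightarrow> s \<in> join_irred \<Longrightarrow> s \<le> t \<Longrightarrow> s \<in> A"
    by (auto simp: downs_def)
  have "lset (bigjoin A) = A"
  proof (intro set_eqI iffI)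
    fix t assume "t \<in> lset (bigjoin A)"
    then have t: "t \<in> join_irred" "t \<le> bigjoin A" by (auto simp: lset_def)
    then obtain a where "a \<in> A" "t \<le> a" using join_irred_le_bigjoin by blast
    then show "t \<in> A" using A t by blast
  next
    fix t assume "t \<in> A"
    then show "t \<in> lset (bigjoin A)" using A(1) bigjoin_le_iff[of A "bigjoin A"] by (auto simp: lset_def)
  qed
  then show "A \<in> range lset" by (metis rangeI)
qed (auto simp: lset_def downs_def)

lemma lset_insert_covers:
  fixes r q :: "'a::{finite, distrib_lattice, bounded_lattice}"
  assumes "lset q = insert t (lset r)" "t \<notin> lset r"
  shows "r < q" "\<not> (\<exists>z. r < z \<and> z < q)"
proof -
  have "lset r \<subseteq> lset q" "lset r \<noteq> lset q" using assms by blast+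
  then show "r < q" unfolding lset_subset_iff lset_eq_iff by (rule order.not_eq_order_implies_strict[rotated])
  show "\<not> (\<exists>z. r < z \<and> z < q)"
  proof
    assume "\<exists>z. r < z \<and> z < q"
    then obtain z where z: "r < z" "z < q" by blast
    then have "lset r \<subset> lset z" "lset z \<subset> lset q"
      unfolding psubset_eq lset_subset_iff lset_eq_iff by auto
    then obtain s where "s \<in> lset z" "s \<notin> lset r" by blast
    moreover have "lset z \<subseteq> insert t (lset r)" using \<open>lset z \<subset> lset q\<close> unfolding assms(1) by blast
    ultimately have "t \<in> lset z" by blast
    then have "insert t (lset r) \<subseteq> lset z" using \<open>lset r \<subset> lset z\<close> by blast
    then show False using \<open>lset z \<subset> lset q\<close> unfolding assms(1) by blast
  qed
qed

section \<open>Boolean intervals and conditions (2) and (3)\<close>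

lemma cell_lset:
  fixes B T :: "'a::{finite, distrib_lattice, bounded_lattice} set"
  assumes "is_cell (range lset) B T" "U \<subseteq> T"
  obtains p where "lset p = B \<union> U"
  using assms unfolding is_cell_def by (metis imageE)

text \<open>Any part of the difference may be added to \<open>lset r\<close>, because whatever lies
  strictly below an added element is already below \<open>r\<close>.\<close>

lemma cell_lset_downI:
  fixes r p :: "'a::{finite, distrib_lattice, bounded_lattice}"
  assumes "r \<le> p" and "\<And>s t. t \<in> join_irred \<Longrightarrow> s \<in> join_irred \<Longrightarrow> t \<le> p \<Longrightarrow> \<not> t \<le> r \<Longrightarrow> s < t \<Longrightarrow> s \<le> r"
  shows "is_cell (range lset) (lset r) (lset p - lset r)"
  unfolding is_cell_def range_lset
proof (intro conjI allI impI)
  fix U assume U: "U \<subseteq> lset p - lset r"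
  show "lset r \<union> U \<in> downs join_irred {}"
    unfolding downs_def
  proof (intro CollectI conjI ballI impI)
    fix t s assume ts: "t \<in> lset r \<union> U" "s \<in> join_irred" "s \<le> t"
    show "s \<in> lset r \<union> U"
    proof (cases "t \<in> lset r")
      case True
      then show ?thesis using ts by (auto simp: lset_def)
    next
      case False
      then have t: "t \<in> U" "t \<in> join_irred" "t \<le> p" "\<not> t \<le> r" using ts U by (auto simp: lset_def)
      show ?thesis
      proof (cases "s = t")
        case False
        then show ?thesis using assms(2)[OF t(2) ts(2) t(3,4)] ts by (auto simp: lset_def)
      qed (use t in simp)
    qed
  qed (use U in \<open>auto simp: lset_def\<close>)
qed blast

lemma less_sup_iff_not_le: "(q:: 'a::{finite, distrib_lattice, bounded_lattice}) < sup q t \<longleftrightarrow> \<not> t \<le> q"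
  by (auto simp: order.strict_iff_order sup.absorb_iff1[symmetric] eq_commute[of q])

lemma sup_lower_nbr:
  fixes p :: "'a::{finite, distrib_lattice, bounded_lattice}"
  assumes "q \<in> lower_nbrs p" "t \<le> p" "\<not> t \<le> q"
  shows "sup q t = p"
proof (rule ccontr)
  assume "sup q t \<noteq> p"
  moreover have "q \<le> p" using assms(1) by (auto simp: lower_nbrs_def)
  ultimately have "sup q t < p" using assms(2) by (simp add: order.strict_iff_order)
  moreover have "q < sup q t" using assms(3) by (simp add: less_sup_iff_not_le)
  ultimately show False using assms(1) by (auto simp: lower_nbrs_def)
qed

lemma sup_upper_nbr:
  fixes r :: "'a::{finite, distrib_lattice, bounded_lattice}"
  assumes "q \<in> upper_nbrs r" "t \<le> q" "\<not> t \<le> r"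
  shows "sup r t = q"
proof (rule ccontr)
  assume "sup r t \<noteq> q"
  moreover have "r \<le> q" using assms(1) by (auto simp: upper_nbrs_def)
  ultimately have "sup r t < q" using assms(2) by (simp add: order.strict_iff_order)
  moreover have "r < sup r t" using assms(3) by (simp add: less_sup_iff_not_le)
  ultimately show False using assms(1) by (auto simp: upper_nbrs_def)
qed

text \<open>Suppose \<open>s < t\<close> and some lower neighbour \<open>q\<close> of
  \<open>p\<close> is not above \<open>s\<close>. Then the join of \<open>q\<close> and
  \<open>s\<close> is \<open>p\<close>, hence above \<open>t\<close>, and primeness puts
  \<open>t\<close> below \<open>q\<close> or below \<open>s\<close>, both impossible.\<close>

lemma cell_lower_nbrs:
  fixes p :: "'a::{finite, distrib_lattice, bounded_lattice}"
  assumes "lower_nbrs p \<noteq> {}"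
  shows "is_cell (range lset) (lset (bigmeet (lower_nbrs p))) (lset p - lset (bigmeet (lower_nbrs p)))"
    and "bigmeet (lower_nbrs p) \<le> p"
proof -
  obtain q where q: "q \<in> lower_nbrs p" using assms by blast
  have "bigmeet (lower_nbrs p) \<le> q" using q le_bigmeet_iff[of "bigmeet (lower_nbrs p)"] by blast
  also have "q \<le> p" using q by (auto simp: lower_nbrs_def)
  finally show le: "bigmeet (lower_nbrs p) \<le> p" .
  show "is_cell (range lset) (lset (bigmeet (lower_nbrs p))) (lset p - lset (bigmeet (lower_nbrs p)))"
  proof (rule cell_lset_downI[OF le])
    fix s t assume st: "t \<in> join_irred" "s \<in> join_irred" "t \<le> p" "\<not> t \<le> bigmeet (lower_nbrs p)" "s < t"
    show "s \<le> bigmeet (lower_nbrs p)"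
      unfolding le_bigmeet_iff
    proof (rule ccontr)
      assume "\<not> (\<forall>q\<in>lower_nbrs p. s \<le> q)"
      then obtain q where q: "q \<in> lower_nbrs p" "\<not> s \<le> q" by blast
      have "s \<le> p" using st(5,3) by (rule order_trans[OF order.strict_implies_order])
      then have "t \<le> sup q s" using sup_lower_nbr[OF q(1) _ q(2)] st(3) by simp
      then have "t \<le> q \<or> t \<le> s" by (rule join_irred_prime[OF st(1)])
      moreover have "s \<le> t" "\<not> t \<le> s" using st(5) by (auto simp: less_le_not_le)
      ultimately show False using q(2) order_trans[of s t q] by blast
    qed
  qed
qed

text \<open>Not the formal dual of \<open>cell_lower_nbrs\<close>, as join-irreducible elements
  occur in both. Primeness puts \<open>t\<close> below a single upper neighbour \<open>q\<close>; if
  \<open>s\<close> were not below \<open>r\<close>, the join of \<open>r\<close> and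
  \<open>s\<close> would be \<open>q\<close>, forcing \<open>t\<close> below \<open>r\<close> or
  \<open>s\<close>.\<close>

lemma cell_upper_nbrs:
  fixes r :: "'a::{finite, distrib_lattice, bounded_lattice}"
  assumes "upper_nbrs r \<noteq> {}"
  shows "is_cell (range lset) (lset r) (lset (bigjoin (upper_nbrs r)) - lset r)"
    and "r \<le> bigjoin (upper_nbrs r)"
proof -
  obtain q where q: "q \<in> upper_nbrs r" using assms by blast
  then have "r \<le> q" by (auto simp: upper_nbrs_def)
  also have "q \<le> bigjoin (upper_nbrs r)" using q bigjoin_le_iff[of _ "bigjoin (upper_nbrs r)"] by blast
  finally show le: "r \<le> bigjoin (upper_nbrs r)" .
  show "is_cell (range lset) (lset r) (lset (bigjoin (upper_nbrs r)) - lset r)"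
  proof (rule cell_lset_downI[OF le])
    fix s t assume st: "t \<in> join_irred" "s \<in> join_irred" "t \<le> bigjoin (upper_nbrs r)" "\<not> t \<le> r" "s < t"
    obtain q where q: "q \<in> upper_nbrs r" "t \<le> q" using join_irred_le_bigjoin[OF st(1,3)] by blast
    show "s \<le> r"
    proof (rule ccontr)
      assume "\<not> s \<le> r"
      moreover have "s \<le> q" using st(5) q(2) by (rule order_trans[OF order.strict_implies_order])
      ultimately have "t \<le> sup r s" using sup_upper_nbr[OF q(1)] q(2) by simp
      then have "t \<le> r \<or> t \<le> s" by (rule join_irred_prime[OF st(1)])
      then show False using st by auto
    qed
  qed
qed

lemma lower_nbrs_empty: "lower_nbrs p = {} \<Longrightarrow> p = (bot :: 'a::{finite, distrib_lattice, bounded_lattice})"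
  by (metis bot.not_eq_extremum empty_iff lower_nbr_above)

lemma upper_nbrs_empty:
  assumes "upper_nbrs r = {}"
  shows "r = (top :: 'a::{finite, distrib_lattice, bounded_lattice})"
proof (rule ccontr)
  assume "r \<noteq> top"
  then have "finite {z. r < z}" "{z. r < z} \<noteq> {}" using top.not_eq_extremum by auto
  from finite_has_minimal[OF this]
  obtain q where q: "r < q" "\<And>z. r < z \<Longrightarrow> z \<le> q \<Longrightarrow> q = z" by auto
  have "\<not> (\<exists>z. r < z \<and> z < q)"
  proof
    assume "\<exists>z. r < z \<and> z < q"
    then obtain z where z: "r < z" "z < q" by blast
    then have "q = z" by (intro q(2)) auto
    then show False using z by simp
  qed
  then have "q \<in> upper_nbrs r" using q(1) unfolding upper_nbrs_def by blast
  then show False using assms by blast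
qed

lemma linked_lset_iff:
  fixes I J :: "'a::{finite, distrib_lattice, bounded_lattice} set"
  assumes "poset_ideal I" "poset_coideal J"
  shows "linked (range lset) (lset ` I) (lset ` J) \<longleftrightarrow>
    (\<forall>B T. is_cell (range lset) B T \<longrightarrow> B \<union> T \<in> lset ` I \<or> B \<in> lset ` J)"
proof -
  have i: "\<forall>A\<in>range lset. \<forall>B\<in>range lset. A \<subseteq> B \<longrightarrow> B \<in> lset ` I \<longrightarrow> A \<in> lset ` I"
    using assms(1) by (auto simp: poset_ideal_def lset_subset_iff lset_eq_iff)
  have j: "\<forall>A\<in>range lset. \<forall>B\<in>range lset. A \<subseteq> B \<longrightarrow> A \<in> lset ` J \<longrightarrow> B \<in> lset ` J"
    using assms(2) by (auto simp: poset_coideal_def lset_subset_iff lset_eq_iff)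
  show ?thesis
  proof
    assume "linked (range lset) (lset ` I) (lset ` J)"
    then show "\<forall>B T. is_cell (range lset) B T \<longrightarrow> B \<union> T \<in> lset ` I \<or> B \<in> lset ` J"
      unfolding linked_def by (elim conjE)
  next
    assume "\<forall>B T. is_cell (range lset) B T \<longrightarrow> B \<union> T \<in> lset ` I \<or> B \<in> lset ` J"
    then show "linked (range lset) (lset ` I) (lset ` J)"
      unfolding linked_def by (intro conjI i j)
  qed
qed

lemma lset_image_iff: "lset (a :: 'a::{finite, distrib_lattice, bounded_lattice}) \<in> lset ` I \<longleftrightarrow> a \<in> I"
  by (auto simp: lset_eq_iff)

text \<open>Among the cells with top \<open>p\<close> the one starting at the meet of the lower
  neighbours is the largest, and J is closed upwards, so testing this cell suffices.\<close>

lemma linked_iff_bigmeet: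
  fixes I J :: "'a::{finite, distrib_lattice, bounded_lattice} set"
  assumes I: "poset_ideal I" and J: "poset_coideal J" and IJ: "I \<union> J = UNIV"
  shows "linked (range lset) (lset ` I) (lset ` J) \<longleftrightarrow> (\<forall>p. p \<in> I \<or> bigmeet (lower_nbrs p) \<in> J)"
  unfolding linked_lset_iff[OF I J]
proof (intro iffI allI impI)
  fix p assume c: "\<forall>B T. is_cell (range lset) B T \<longrightarrow> B \<union> T \<in> lset ` I \<or> B \<in> lset ` J"
  show "p \<in> I \<or> bigmeet (lower_nbrs p) \<in> J"
  proof (cases "lower_nbrs p = {}")
    case True
    \<comment> \<open>The least element is exceptional: it lies in every nonempty ideal, and if I is
      empty then J is everything.\<close>
    then have "p = bot" by (rule lower_nbrs_empty)
    then have "p \<in> I \<or> I = {}" using I unfolding poset_ideal_def by (metis bot.extremum ex_in_conv)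
    then show ?thesis using IJ by auto
  next
    case False
    let ?m = "bigmeet (lower_nbrs p)"
    have e: "lset ?m \<union> (lset p - lset ?m) = lset p"
      using lset_mono[OF cell_lower_nbrs(2)[OF False]] by blast
    show ?thesis using c[rule_format, OF cell_lower_nbrs(1)[OF False]] unfolding e lset_image_iff .
  qed
next
  fix B T assume c: "\<forall>p. p \<in> I \<or> bigmeet (lower_nbrs p) \<in> J" and cell: "is_cell (range (lset :: 'a \<Rightarrow> _)) B T"
  obtain p :: 'a where p: "lset p = B \<union> T" using cell_lset[OF cell, of T] by blast
  obtain r :: 'a where r: "lset r = B" using cell_lset[OF cell, of "{}"] by auto
  have BT: "B \<inter> T = {}" using cell by (simp add: is_cell_def)
  have "r \<in> J" if "p \<notin> I"
  proof (cases "lower_nbrs p = {}")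
    case True
    then have "p = bot" by (rule lower_nbrs_empty)
    then have "I = {}" using I that unfolding poset_ideal_def by (metis bot.extremum ex_in_conv)
    then show ?thesis using IJ by auto
  next
    case False
    let ?m = "bigmeet (lower_nbrs p)"
    have "?m \<in> J" using c that by blast
    moreover have "lset ?m \<subseteq> lset r"
    proof
      fix t assume t: "t \<in> lset ?m"
      then have "t \<in> lset p" using lset_mono[OF cell_lower_nbrs(2)[OF False]] by blast
      show "t \<in> lset r"
      proof (rule ccontr)
        assume "t \<notin> lset r"
        then have "t \<in> T" "t \<notin> B" using \<open>t \<in> lset p\<close> p r by blast+
        \<comment> \<open>Removing \<open>t\<close> from the top gives a lower neighbour of
          \<open>p\<close> that is not above \<open>t\<close>, so \<open>t\<close> cannot be below
          the meet.\<close>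
        obtain q :: 'a where q: "lset q = B \<union> (T - {t})" using cell_lset[OF cell, of "T - {t}"] by blast
        have tq: "t \<notin> lset q" using q \<open>t \<notin> B\<close> by blast
        have "lset p = insert t (lset q)" using p q \<open>t \<in> T\<close> by blast
        from lset_insert_covers[OF this tq] have "q \<in> lower_nbrs p" by (simp add: lower_nbrs_def)
        then have "?m \<le> q" using le_bigmeet_iff[of ?m] by blast
        then show False using t tq lset_mono by blast
      qed
    qed
    ultimately show ?thesis using J[unfolded poset_coideal_def, rule_format, of ?m r] by (simp add: lset_subset_iff)
  qed
  then show "B \<union> T \<in> lset ` I \<or> B \<in> lset ` J" using lset_image_iff[of p I] lset_image_iff[of r J] unfolding p r by blast
qed

text \<open>Among the cells with bottom \<open>r\<close> the one ending at the join of the upper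
  neighbours is the largest, and I is closed downwards.\<close>

lemma linked_iff_bigjoin:
  fixes I J :: "'a::{finite, distrib_lattice, bounded_lattice} set"
  assumes I: "poset_ideal I" and J: "poset_coideal J" and IJ: "I \<union> J = UNIV"
  shows "linked (range lset) (lset ` I) (lset ` J) \<longleftrightarrow> (\<forall>r. r \<in> J \<or> bigjoin (upper_nbrs r) \<in> I)"
  unfolding linked_lset_iff[OF I J]
proof (intro iffI allI impI)
  fix r assume c: "\<forall>B T. is_cell (range lset) B T \<longrightarrow> B \<union> T \<in> lset ` I \<or> B \<in> lset ` J"
  show "r \<in> J \<or> bigjoin (upper_nbrs r) \<in> I"
  proof (cases "upper_nbrs r = {}")
    case True
    then have "r = top" by (rule upper_nbrs_empty)
    then have "r \<in> J \<or> J = {}" using J unfolding poset_coideal_def by (metis ex_in_conv top.extremum)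
    then show ?thesis using IJ by auto
  next
    case False
    let ?j = "bigjoin (upper_nbrs r)"
    have e: "lset r \<union> (lset ?j - lset r) = lset ?j"
      using lset_mono[OF cell_upper_nbrs(2)[OF False]] by blast
    show ?thesis using c[rule_format, OF cell_upper_nbrs(1)[OF False]] unfolding e lset_image_iff by (rule disj_commute[THEN iffD1])
  qed
next
  fix B T assume c: "\<forall>r. r \<in> J \<or> bigjoin (upper_nbrs r) \<in> I" and cell: "is_cell (range (lset :: 'a \<Rightarrow> _)) B T"
  obtain p :: 'a where p: "lset p = B \<union> T" using cell_lset[OF cell, of T] by blast
  obtain r :: 'a where r: "lset r = B" using cell_lset[OF cell, of "{}"] by auto
  have BT: "B \<inter> T = {}" using cell by (simp add: is_cell_def)
  have "p \<in> I" if "r \<notin> J"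
  proof (cases "T = {}")
    case True
    then have "p = r" using p r lset_eq_iff by blast
    then show ?thesis using that IJ by blast
  next
    case False
    let ?j = "bigjoin (upper_nbrs r)"
    have nb: "\<exists>q\<in>upper_nbrs r. t \<in> lset q" if "t \<in> T" for t
    proof -
      obtain q :: 'a where q: "lset q = B \<union> {t}" using cell_lset[OF cell, of "{t}"] \<open>t \<in> T\<close> by blast
      have "lset q = insert t (lset r)" "t \<notin> lset r" using q r BT \<open>t \<in> T\<close> by blast+
      from lset_insert_covers[OF this] have "q \<in> upper_nbrs r" by (simp add: upper_nbrs_def)
      then show ?thesis using q by blast
    qed
    have le: "lset q \<subseteq> lset ?j" if "q \<in> upper_nbrs r" for q
      using that bigjoin_le_iff[of _ ?j] unfolding lset_subset_iff by blast
    have "upper_nbrs r \<noteq> {}" using nb False by blast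
    then have "lset r \<subseteq> lset ?j" using cell_upper_nbrs(2) unfolding lset_subset_iff by blast
    moreover have "T \<subseteq> lset ?j" using nb le by blast
    ultimately have "lset p \<subseteq> lset ?j" using p r by blast
    moreover have "?j \<in> I" using c that by blast
    ultimately show ?thesis using I[unfolded poset_ideal_def, rule_format, of ?j p] by (simp add: lset_subset_iff)
  qed
  then show "B \<union> T \<in> lset ` I \<or> B \<in> lset ` J" using lset_image_iff[of p I] lset_image_iff[of r J] unfolding p r by blast
qed

section \<open>Cells outside both the ideal and the coideal\<close>

text \<open>The sign of the permutation that sorts the list by \<open>h\<close>, computed from
  inversions and extended by zero to lists with repetitions.\<close>

fun inv_sign :: "('a \<Rightarrow> nat) \<Rightarrow> 'a list \<Rightarrow> 'k::comm_ring_1" where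
  "inv_sign h [] = 1"
| "inv_sign h (x # xs) = (if x \<in> set xs then 0 else (- 1) ^ card {y \<in> set xs. h y < h x} * inv_sign h xs)"

text \<open>Exchanging two distinct neighbours changes exactly one of their inversion counts, by
  one; entries before them see the same set of later entries.\<close>

lemma inv_sign_swap:
  assumes "inj h"
  shows "inv_sign h (us @ a # b # ws) = - inv_sign h (us @ b # a # ws)"
proof (induction us)
  case Nil
  show ?case
  proof (cases "a = b \<or> a \<in> set ws \<or> b \<in> set ws")
    case False
    have ins: "card {y \<in> insert x (set ws). h y < n} = card {y \<in> set ws. h y < n} + (if h x < n then 1 else 0)"
      if "x \<notin> set ws" for x n
    proof (cases "h x < n")
      case True
      then have "{y \<in> insert x (set ws). h y < n} = insert x {y \<in> set ws. h y < n}" by auto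
      then show ?thesis using True that by simp
    next
      case False
      then have "{y \<in> insert x (set ws). h y < n} = {y \<in> set ws. h y < n}" by auto
      then show ?thesis using False by simp
    qed
    have "h a \<noteq> h b" using False assms by (auto dest: injD)
    then show ?thesis using False ins[of b "h a"] ins[of a "h b"]
      by (cases "h a < h b") (auto simp: power_add)
  qed auto
next
  case (Cons u us)
  have "set (us @ a # b # ws) = set (us @ b # a # ws)" by auto
  then show ?case using Cons by (simp only: append_Cons inv_sign.simps) auto
qed

lemma inv_sign_not_distinct: "\<not> distinct xs \<Longrightarrow> inv_sign h xs = 0"
  by (induction xs) auto

lemma inv_sign_nonzero: "distinct xs \<Longrightarrow> inv_sign h xs \<noteq> (0 :: 'k::field)"
  by (induction xs) auto

section \<open>Exponent vectors of the generators and membership in their ideal\<close>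

lemma lookup_uexps:
  assumes "finite X"
  shows "lk (uexps X A) (t, b) = (if t \<in> X \<and> b = (t \<in> A) then 1 else 0)"
proof -
  have "lk (uexps X A) (t, b) = (\<Sum>m\<in>X. if m = t then (if b = (t \<in> A) then 1 else 0) else 0)"
    unfolding uexps_def lookup_sum lookup_single by (intro sum.cong) (auto simp: when_def)
  then show ?thesis using assms by simp
qed

lemma mdeg_uexps: "mdeg (uexps X A) = card X"
  by (simp add: uexps_def mdeg_sum)

lemma keys_uexps: "finite X \<Longrightarrow> Poly_Mapping.keys (uexps X A) \<subseteq> X \<times> UNIV"
  by (auto simp: in_keys_iff lookup_uexps split: if_splits)

text \<open>The linear syzygy between neighbouring generators; it makes the contributions of
  adjacent facets multiples of one monomial.\<close>

lemma uexps_insert: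
  assumes "finite X" "t \<in> X" "t \<notin> A"
  shows "Poly_Mapping.single (t, False) 1 + uexps X (insert t A) = Poly_Mapping.single (t, True) 1 + uexps X A"
proof (rule poly_mapping_eqI)
  fix k :: "'a \<times> bool"
  obtain s b where "k = (s, b)" by fastforce
  then show "lk (Poly_Mapping.single (t, False) 1 + uexps X (insert t A)) k
      = lk (Poly_Mapping.single (t, True) 1 + uexps X A) k"
    using assms by (auto simp: lookup_add lookup_single lookup_uexps when_def)
qed

lemma uexps_factor:
  assumes "finite X" "\<And>t. t \<in> X \<Longrightarrow> lk n (t, t \<in> A) > 0"
  shows "\<exists>r. n = uexps X A + r"
proof
  show "n = uexps X A + (n - uexps X A)"
  proof (rule poly_mapping_eqI)
    fix k :: "'a \<times> bool"
    obtain s b where k: "k = (s, b)" by fastforce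
    show "lk n k = lk (uexps X A + (n - uexps X A)) k"
      using assms(2)[of s] unfolding k
      by (auto simp: lookup_add lookup_minus lookup_uexps[OF assms(1)])
  qed
qed

definition usq :: "'a set \<Rightarrow> 'a set \<Rightarrow> ('a \<times> bool, 'k::comm_ring_1) mpoly" where
  "usq X A = Poly_Mapping.single (uexps X A) 1"

lemma gen_ideal_usq_keys:
  assumes "f \<in> gen_ideal V (usq X ` S)" "lk f n \<noteq> 0" "finite X"
  shows "\<exists>A\<in>S. \<forall>t\<in>X. lk n (t, t \<in> A) > 0"
proof -
  obtain F c where F: "finite F" "F \<subseteq> usq X ` S" "f = (\<Sum>g\<in>F. c g * g)"
    using assms(1) unfolding gen_ideal_def by blast
  then obtain g where g: "g \<in> F" "lk (c g * g) n \<noteq> 0"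
    using assms(2) by (metis (no_types, lifting) lookup_sum sum.neutral)
  then obtain A where A: "A \<in> S" "g = usq X A" using F(2) by blast
  have "lk (Poly_Mapping.single (uexps X A) 1 * c g) n \<noteq> 0"
    using g(2) unfolding A(2) usq_def by (simp only: mult.commute not_False_eq_True)
  from lookup_single_mult_nz[OF this] obtain r where "n = uexps X A + r" by (elim exE conjE)
  then have "\<forall>t\<in>X. lk n (t, t \<in> A) > 0" using assms(3) by (simp add: lookup_add lookup_uexps)
  then show ?thesis using A(1) by blast
qed

lemma gen_ideal_mult_gen:
  assumes "g \<in> G" "c \<in> polyR V"
  shows "c * g \<in> gen_ideal V G"
  unfolding gen_ideal_def using assms
  by (intro CollectI exI[of _ "{g}"] exI[of _ "\<lambda>_. c"]) auto

lemma gen_ideal_zero: "0 \<in> gen_ideal V G"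
  unfolding gen_ideal_def by (intro CollectI exI[of _ "{}"] exI[of _ "\<lambda>_. 0"]) auto

text \<open>Later arguments ask only whether a coefficient is zero, so the sign of the move is left
  open.\<close>

lemma alt_move: "alt f \<Longrightarrow> f (xs @ v # ys) = f (v # xs @ ys) \<or> f (xs @ v # ys) = - f (v # xs @ ys)"
proof (induction xs arbitrary: ys rule: rev_induct)
  case (snoc x xs)
  have "f ((xs @ [x]) @ v # ys) = - f (xs @ v # x # ys)"
    using alt_swap[OF snoc.prems, of xs x v ys] by simp
  then show ?case using snoc.IH[OF snoc.prems, of "x # ys"] by auto
qed simp

text \<open>To be used with the down-sets of I \<inter> J as \<open>S\<close> and of I - J as
  \<open>K\<close>. Along an edge of the cell one leaves \<open>K\<close> only into
  \<open>S\<close>; \<open>up\<close> will come from the hypothesis on H and \<open>down\<close>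
  from I being an ideal.\<close>

locale separated_cell =
  fixes P B T :: "'a::finite set" and S K :: "'a set set"
  assumes BT: "B \<inter> T = {}" "B \<union> T \<subseteq> P" and SP: "\<And>A. A \<in> S \<Longrightarrow> A \<subseteq> P"
    and KS: "K \<inter> S = {}" and bot_in: "B \<in> K" and top_out: "B \<union> T \<notin> K" "B \<union> T \<notin> S"
    and up: "\<And>U t. U \<subseteq> T \<Longrightarrow> t \<in> T \<Longrightarrow> t \<notin> U \<Longrightarrow> B \<union> U \<in> K \<Longrightarrow> B \<union> insert t U \<notin> K \<Longrightarrow> B \<union> insert t U \<in> S"
    and down: "\<And>U t. U \<subseteq> T \<Longrightarrow> t \<in> T \<Longrightarrow> t \<notin> U \<Longrightarrow> B \<union> insert t U \<in> K \<Longrightarrow> B \<union> U \<notin> K \<Longrightarrow> B \<union> U \<in> S"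
    and S_ne: "S \<noteq> {}"
begin

definition V :: "('a \<times> bool) set" where "V = P \<times> UNIV"

definition hh :: "'a \<Rightarrow> nat" where "hh = (SOME h. inj h)"

lemma inj_hh: "inj hh"
proof -
  have "\<exists>h :: 'a \<Rightarrow> nat. inj h" using finite_imp_inj_to_nat_seg[OF finite_UNIV] by blast
  then show ?thesis unfolding hh_def by (rule someI_ex)
qed

definition lowers :: "('a \<times> bool) list \<Rightarrow> 'a set" where
  "lowers w = {t \<in> T. (t, False) \<in> set w}"

text \<open>The part of the fundamental cycle of the cross polytope on \<open>T\<close> supported on the facets
  indexed by \<open>K\<close>; the facet of \<open>U \<subseteq> T\<close> consists of the variables \<open>(t, t \<notin> U)\<close>
  complementary to \<open>u\<^sub>B\<^sub>\<union>\<^sub>U\<close>.\<close>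
definition cyc :: "('a \<times> bool) list \<Rightarrow> ('a \<times> bool, 'k::field) mpoly" where
  "cyc w = (if set (map fst w) = T \<and> B \<union> lowers w \<in> K
     then Poly_Mapping.single (uexps P (B \<union> lowers w)) (inv_sign hh (map fst w) * (- 1) ^ card (lowers w))
     else 0)"

lemma T_ne: "T \<noteq> {}"
  using bot_in top_out by auto

lemma form_cyc: "form V (card P) (card T) (cyc :: _ \<Rightarrow> ('a \<times> bool, 'k::field) mpoly)"
  unfolding form_def
proof (intro conjI allI impI)
  show "alt (cyc :: _ \<Rightarrow> ('a \<times> bool, 'k) mpoly)"
    unfolding alt_def
  proof (intro conjI allI)
    fix us a b ws
    have e: "set (map fst (us @ a # b # ws)) = set (map fst (us @ b # a # ws))"
      "lowers (us @ a # b # ws) = lowers (us @ b # a # ws)" by (auto simp: lowers_def)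
    have s: "inv_sign hh (map fst (us @ a # b # ws)) = (- inv_sign hh (map fst (us @ b # a # ws)) :: 'k)"
      using inv_sign_swap[OF inj_hh, of "map fst us" "fst a" "fst b" "map fst ws"] by simp
    show "cyc (us @ a # b # ws) = - (cyc (us @ b # a # ws) :: ('a \<times> bool, 'k) mpoly)"
      unfolding cyc_def e s
      by (cases "set (map fst (us @ b # a # ws)) = T \<and> B \<union> lowers (us @ b # a # ws) \<in> K")
        (simp_all only: if_True if_False mult_minus_left single_uminus minus_zero simp_thms)
  next
    fix us ws :: "('a \<times> bool) list" and a
    have "inv_sign hh (map fst (us @ a # a # ws)) = (0 :: 'k)"
      by (rule inv_sign_not_distinct) simp
    then show "cyc (us @ a # a # ws) = (0 :: ('a \<times> bool, 'k) mpoly)"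
      unfolding cyc_def by (simp only: mult_zero_left single_zero if_cancel)
  qed
  fix w
  show "(cyc w :: ('a \<times> bool, 'k) mpoly) \<in> polyR V"
    using keys_uexps[of P] by (auto simp: cyc_def V_def intro!: polyR_single)
  show "homog (card P) (cyc w :: ('a \<times> bool, 'k) mpoly)"
    by (auto simp: cyc_def mdeg_uexps intro!: homog_single)
  assume nz: "(cyc w :: ('a \<times> bool, 'k) mpoly) \<noteq> 0"
  then have w: "set (map fst w) = T" by (auto simp: cyc_def split: if_splits)
  have "inv_sign hh (map fst w) \<noteq> (0 :: 'k)"
  proof
    assume "inv_sign hh (map fst w) = (0 :: 'k)"
    then show False using nz unfolding cyc_def by (simp only: mult_zero_left single_zero if_cancel simp_thms)
  qed
  then have "distinct (map fst w)" using inv_sign_not_distinct by blast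
  then show "length w = card T" using w distinct_card by fastforce
  show "set w \<subseteq> V" using w BT(2) unfolding V_def by force
qed

lemma cyc_Cons_nz:
  assumes "(cyc (v # w) :: ('a \<times> bool, 'k::field) mpoly) \<noteq> 0"
  shows "fst v \<in> T" "set (map fst w) = T - {fst v}"
proof -
  have s: "set (map fst (v # w)) = T" using assms by (auto simp: cyc_def split: if_splits)
  have "length (v # w) = card T" using form_cyc assms unfolding form_def by blast
  then have "distinct (map fst (v # w))" using s by (metis card_distinct length_map)
  then have "fst v \<notin> set (map fst w)" by simp
  moreover have "insert (fst v) (set (map fst w)) = T" using s by simp
  ultimately show "fst v \<in> T" "set (map fst w) = T - {fst v}" by blast+
qed

text \<open>A ridge of the cross polytope lies in two facets, those of \<open>U\<close> and
  \<open>insert t U\<close>, and both contribute the same monomial with opposite signs. If both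
  facets are indexed by \<open>K\<close> the terms cancel; if just one is, the other vertex lies in
  \<open>S\<close> and its generator divides the monomial.\<close>

lemma kd_cyc_mem: "(kd V cyc w :: ('a \<times> bool, 'k::field) mpoly) \<in> gen_ideal V (usq P ` S)"
proof (cases "\<exists>v. (cyc (v # w) :: ('a \<times> bool, 'k) mpoly) \<noteq> 0")
  case False
  then have "cyc (v # w) = (0 :: ('a \<times> bool, 'k) mpoly)" for v by blast
  then have "kd V cyc w = (0 :: ('a \<times> bool, 'k) mpoly)" unfolding kd_def by simp
  then show ?thesis by (simp add: gen_ideal_zero)
next
  case True
  then obtain v where v: "(cyc (v # w) :: ('a \<times> bool, 'k) mpoly) \<noteq> 0" by blast
  define t where "t = fst v"
  have t: "t \<in> T" and w: "set (map fst w) = T - {t}"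
    using cyc_Cons_nz[OF v] by (simp_all add: t_def)
  have tP: "t \<in> P" "t \<notin> B" using t BT by auto
  let ?U = "lowers w" and ?s = "inv_sign hh (t # map fst w) :: 'k"
  have U: "?U \<subseteq> T" "t \<notin> ?U" using w by (force simp: lowers_def)+
  have other: "cyc (v' # w) = (0 :: ('a \<times> bool, 'k) mpoly)" if "fst v' \<noteq> t" for v'
  proof (rule ccontr)
    assume n: "cyc (v' # w) \<noteq> (0 :: ('a \<times> bool, 'k) mpoly)"
    show False using cyc_Cons_nz[OF n] w t that by blast
  qed
  let ?p = "cyc ((t, True) # w) :: ('a \<times> bool, 'k) mpoly" and ?q = "cyc ((t, False) # w) :: ('a \<times> bool, 'k) mpoly"
  have tV: "(t, True) \<in> V" "(t, False) \<in> V" using tP by (auto simp: V_def)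
  have "kd V cyc w = (\<Sum>v\<in>{(t, True), (t, False)}. var v * (cyc (v # w) :: ('a \<times> bool, 'k) mpoly))"
    unfolding kd_def
  proof (rule sum.mono_neutral_right)
    show "\<forall>i\<in>V - {(t, True), (t, False)}. var i * cyc (i # w) = (0 :: ('a \<times> bool, 'k) mpoly)"
    proof
      fix i assume "i \<in> V - {(t, True), (t, False)}"
      then have "fst i \<noteq> t" by (cases i) auto
      then show "var i * cyc (i # w) = (0 :: ('a \<times> bool, 'k) mpoly)" using other by simp
    qed
  qed (use tV in auto)
  then have kd: "kd V cyc w = var (t, True) * ?p + var (t, False) * ?q" by simp
  have ins: "insert t (set (map fst w)) = T" using w t by blast
  have lo: "lowers ((t, True) # w) = ?U" "lowers ((t, False) # w) = insert t ?U"
    using t by (auto simp: lowers_def)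
  let ?m = "Poly_Mapping.single (t, True) 1 + uexps P (B \<union> ?U)"
  have m: "Poly_Mapping.single (t, False) 1 + uexps P (B \<union> insert t ?U) = ?m"
    using uexps_insert[of P t "B \<union> ?U"] tP U by simp
  let ?c = "?s * (- 1) ^ card ?U"
  have p: "var (t, True) * ?p = (if B \<union> ?U \<in> K then Poly_Mapping.single ?m ?c else 0)"
    using ins by (simp add: cyc_def lo mult_single)
  have "card (insert t ?U) = Suc (card ?U)" using U by simp
  then have q: "var (t, False) * ?q = (if B \<union> insert t ?U \<in> K then Poly_Mapping.single ?m (- ?c) else 0)"
    unfolding m[symmetric] using ins by (simp add: cyc_def lo mult_single)
  have single_mem: "Poly_Mapping.single ?m c \<in> gen_ideal V (usq P ` S)" if "B \<union> ?U \<in> S" for c :: 'k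
  proof -
    have "Poly_Mapping.single ?m c = Poly_Mapping.single (Poly_Mapping.single (t, True) 1) c * usq P (B \<union> ?U)"
      by (simp add: usq_def mult_single)
    then show ?thesis using that tV(1) by (auto intro!: gen_ideal_mult_gen polyR_single)
  qed
  have single_mem': "Poly_Mapping.single ?m c \<in> gen_ideal V (usq P ` S)" if "B \<union> insert t ?U \<in> S" for c :: 'k
  proof -
    have "Poly_Mapping.single ?m c = Poly_Mapping.single (Poly_Mapping.single (t, False) 1) c * usq P (B \<union> insert t ?U)"
      unfolding m[symmetric] by (simp add: usq_def mult_single)
    then show ?thesis using that tV(2) by (auto intro!: gen_ideal_mult_gen polyR_single)
  qed
  show ?thesis
  proof (cases "B \<union> ?U \<in> K")
    case True
    show ?thesis
    proof (cases "B \<union> insert t ?U \<in> K")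
      case K: True
      have "kd V cyc w = (0 :: ('a \<times> bool, 'k) mpoly)"
        unfolding kd p q if_P[OF True] if_P[OF K] single_uminus by simp
      then show ?thesis by (simp add: gen_ideal_zero)
    next
      case False
      then show ?thesis unfolding kd p q using True up[OF U(1) t U(2)] single_mem' by simp
    qed
  next
    case False
    show ?thesis
    proof (cases "B \<union> insert t ?U \<in> K")
      case K: True
      then show ?thesis unfolding kd p q using False down[OF U(1) t U(2)] single_mem by simp
    next
      case False': False
      then show ?thesis unfolding kd p q using False by (simp add: gen_ideal_zero)
    qed
  qed
qed

lemma no_lin_res: "\<not> lin_res V (gen_ideal V (usq P ` S) :: ('a \<times> bool, 'k::field) mpoly set)"
proof
  let ?H = "gen_ideal V (usq P ` S) :: ('a \<times> bool, 'k) mpoly set"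
  let ?c = "cyc :: _ \<Rightarrow> ('a \<times> bool, 'k) mpoly"
  assume lin: "lin_res V ?H"
  have finP: "finite P" and finV: "finite V" by simp_all
  obtain k where k: "card T = Suc k" using T_ne by (metis card_gt_0_iff finite gr0_conv_Suc)
  have fc: "form V (card P) (Suc k) ?c" using form_cyc unfolding k .
  obtain A0 where A0: "A0 \<in> S" using S_ne by blast
  have "\<exists>g. form V (card P) (Suc k) g \<and> (\<forall>w. g w \<in> ?H) \<and> kd V g = kd V ?c"
  proof (rule lin_res_koszul_exact[OF lin finV])
    fix f m assume f: "f \<in> ?H" "m \<in> Poly_Mapping.keys f"
    then obtain A where "\<And>t. t \<in> P \<Longrightarrow> lk m (t, t \<in> A) > 0"
      using gen_ideal_usq_keys[OF f(1) _ finP, of m] by (auto simp: in_keys_iff)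
    then obtain r where "m = uexps P A + r" using uexps_factor[OF finP, of m A] by blast
    then show "card P \<le> mdeg m" by (simp add: mdeg_plus mdeg_uexps)
  next
    have "1 * usq P A0 \<in> ?H" using A0 by (intro gen_ideal_mult_gen) auto
    then show "usq P A0 \<in> ?H" by simp
    show "(usq P A0 :: ('a \<times> bool, 'k) mpoly) \<noteq> 0"
      unfolding usq_def by (metis lookup_single_eq lookup_zero zero_neq_one)
    show "homog (card P) (usq P A0 :: ('a \<times> bool, 'k) mpoly)"
      unfolding usq_def by (rule homog_single) (rule mdeg_uexps)
  next
    show "form V (Suc (card P)) k (kd V ?c)" by (rule form_kd[OF fc])
    show "kd V ?c w \<in> ?H" for w by (rule kd_cyc_mem)
    show "kd V (kd V ?c) w = 0" for w
      using fc finV by (intro kd_kd) (simp_all add: form_def)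
  qed
  then obtain g where g: "form V (card P) (Suc k) g" "\<And>w. g w \<in> ?H" "kd V g = kd V ?c" by blast
  define e where "e w = ?c w - g w" for w
  have alt_e: "alt e" using form_diff[OF fc g(1)] by (simp add: form_def e_def[abs_def])
  have kd_e: "kd V e w = 0" for w
    using g(3) by (simp add: e_def[abs_def] kd_diff)
  \<comment> \<open>The ideal is generated in degree \<open>card P\<close>, so in that degree it
    contains only combinations of the generators themselves.\<close>
  have g_coeff: "lk (g w) (uexps P A) = 0" if "A \<notin> S" "A \<subseteq> P" for w A
  proof (rule ccontr)
    assume "lk (g w) (uexps P A) \<noteq> 0"
    from gen_ideal_usq_keys[OF g(2) this finP]
    obtain A' where A': "A' \<in> S" "\<And>t. t \<in> P \<Longrightarrow> lk (uexps P A) (t, t \<in> A') > 0" by blast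
    have "(t \<in> A') = (t \<in> A)" if "t \<in> P" for t
      using A'(2)[OF that] by (simp add: lookup_uexps split: if_splits)
    then have "A' = A" using SP[OF A'(1)] \<open>A \<subseteq> P\<close> by blast
    then show False using A'(1) that(1) by simp
  qed
  have e_keys: "\<exists>A. \<forall>t\<in>P. lk r (t, t \<in> A) > 0" if "lk (e w) r \<noteq> 0" for w r
  proof (cases "lk (g w) r = 0")
    case True
    then have "lk (?c w) r \<noteq> 0" using that by (simp add: e_def lookup_minus)
    then have "r = uexps P (B \<union> lowers w)"
      by (auto simp: cyc_def lookup_single when_def split: if_splits)
    then show ?thesis by (intro exI[of _ "B \<union> lowers w"]) (simp add: lookup_uexps)
  next
    case False
    then show ?thesis using gen_ideal_usq_keys[OF g(2) False finP] by blast
  qed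
  obtain ts where ts: "set ts = T" "distinct ts" using finite_distinct_list[of T] by auto
  define W where "W U = map (\<lambda>t. (t, t \<notin> U)) ts" for U
  have W: "map fst (W U) = ts" for U by (simp add: W_def comp_def)
  have lowers_W: "lowers (W U) = U" if "U \<subseteq> T" for U using that ts by (auto simp: lowers_def W_def)
  \<comment> \<open>The coefficient that the chain \<open>e\<close> has at the facet of
    \<open>U\<close> on the monomial of the vertex B \<union> U. The ridge shared by two facets
    relates neighbouring values.\<close>
  define a where "a U = lk (e (W U)) (uexps P (B \<union> U))" for U
  have a0: "a {} \<noteq> 0"
  proof -
    have "lk (g (W {})) (uexps P B) = 0" using KS bot_in BT(2) by (intro g_coeff) auto
    moreover have "lk (?c (W {})) (uexps P B) = inv_sign hh ts"
      using bot_in by (simp add: cyc_def W lowers_W ts)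
    ultimately show ?thesis using inv_sign_nonzero[OF ts(2)] by (simp add: a_def e_def lookup_minus)
  qed
  have step: "a (insert t U) \<noteq> 0" if aU: "a U \<noteq> 0" and t: "t \<in> T" "t \<notin> U" and U: "U \<subseteq> T" for t U
  proof -
    obtain xs ys where xy: "ts = xs @ t # ys" using t(1) ts(1) by (metis split_list)
    let ?f = "\<lambda>s. (s, s \<notin> U)"
    let ?w = "map ?f xs @ map ?f ys"
    have "t \<notin> set xs" "t \<notin> set ys" using ts(2) xy by auto
    then have WU: "W U = map ?f xs @ (t, True) # map ?f ys"
      "W (insert t U) = map ?f xs @ (t, False) # map ?f ys"
      using t(2) by (auto simp: W_def xy)
    \<comment> \<open>The common value of x_t times the monomial of B \<union> U and y_t times that
      of B \<union> U with \<open>t\<close> added. Its coefficient in \<open>kd V e\<close> at the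
      ridge \<open>?w\<close> is to involve these two facets only.\<close>
    let ?N = "Poly_Mapping.single (t, True) 1 + uexps P (B \<union> U)"
    have tP: "t \<in> P" "t \<notin> B" using t BT by auto
    have N: "Poly_Mapping.single (t, False) 1 + uexps P (B \<union> insert t U) = ?N"
      using uexps_insert[of P t "B \<union> U"] tP t by simp
    \<comment> \<open>In \<open>?N\<close> the two exponents at a position
      \<open>s \<noteq> t\<close> add up to 1. Dividing by a variable at \<open>s\<close> would
      leave none there, but every monomial occurring in \<open>e\<close> has a positive exponent at
      each position of \<open>P\<close>.\<close>
    have other: "lk (var v * e (v # ?w)) ?N = 0" if v: "v \<notin> {(t, True), (t, False)}" "v \<in> V" for v
    proof (rule ccontr)
      assume "lk (var v * e (v # ?w)) ?N \<noteq> 0"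
      from lookup_single_mult_nz[OF this]
      obtain r where r: "?N = Poly_Mapping.single v 1 + r" "lk (e (v # ?w)) r \<noteq> 0" by (elim exE conjE)
      obtain A where A: "\<forall>t\<in>P. lk r (t, t \<in> A) > 0" using e_keys[OF r(2)] by blast
      obtain s b where s: "v = (s, b)" by fastforce
      have sP: "s \<in> P" using v(2) s by (simp add: V_def)
      have "s \<noteq> t" using v(1) s by auto
      have eq: "lk ?N (s, b') = lk (Poly_Mapping.single v 1 + r) (s, b')" for b' using r(1) by simp
      have "lk ?N (s, b) + lk ?N (s, \<not> b) = 1"
        using \<open>s \<noteq> t\<close> sP by (auto simp: lookup_add lookup_single when_def lookup_uexps)
      moreover have "lk (Poly_Mapping.single v 1 + r) (s, b) + lk (Poly_Mapping.single v 1 + r) (s, \<not> b)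
          = 1 + (lk r (s, b) + lk r (s, \<not> b))"
        by (simp add: lookup_add lookup_single when_def s)
      ultimately have "lk r (s, b) = 0" "lk r (s, \<not> b) = 0" unfolding eq by simp_all
      moreover have "(s \<in> A) = b \<or> (s \<in> A) = (\<not> b)" by blast
      ultimately show False using A[rule_format, OF sP] by auto
    qed
    have tV: "(t, True) \<in> V" "(t, False) \<in> V" using tP by (auto simp: V_def)
    have "0 = (\<Sum>v\<in>V. lk (var v * e (v # ?w)) ?N)"
      using kd_e[of ?w] unfolding kd_def lookup_sum[symmetric] by simp
    also have "\<dots> = (\<Sum>v\<in>{(t, True), (t, False)}. lk (var v * e (v # ?w)) ?N)"
      by (rule sum.mono_neutral_right) (use tV other finV in auto)
    also have "\<dots> = lk (var (t, True) * e ((t, True) # ?w)) ?N + lk (var (t, False) * e ((t, False) # ?w)) ?N"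
      by simp
    also have "lk (var (t, True) * e ((t, True) # ?w)) ?N = lk (e ((t, True) # ?w)) (uexps P (B \<union> U))"
      by (simp only: lookup_single_mult mult_1)
    also have "lk (var (t, False) * e ((t, False) # ?w)) ?N = lk (e ((t, False) # ?w)) (uexps P (B \<union> insert t U))"
      unfolding N[symmetric] by (simp only: lookup_single_mult mult_1)
    finally have sum0: "lk (e ((t, True) # ?w)) (uexps P (B \<union> U)) + lk (e ((t, False) # ?w)) (uexps P (B \<union> insert t U)) = 0"
      by simp
    have "lk (e ((t, True) # ?w)) (uexps P (B \<union> U)) \<noteq> 0"
      using aU alt_move[OF alt_e, of "map ?f xs" "(t, True)" "map ?f ys"] unfolding a_def WU
      by (auto simp del: map_append)
    then have "lk (e ((t, False) # ?w)) (uexps P (B \<union> insert t U)) \<noteq> 0"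
      using sum0 by (metis add.right_neutral)
    then show ?thesis
      using alt_move[OF alt_e, of "map ?f xs" "(t, False)" "map ?f ys"] unfolding a_def WU
      by (auto simp del: map_append)
  qed
  have "a U \<noteq> 0" if "U \<subseteq> T" for U
  proof -
    have "finite U" by simp
    then show ?thesis using that
    proof (induction U rule: finite_induct)
      case (insert t U)
      then show ?case using step by blast
    qed (rule a0)
  qed
  then have "a T \<noteq> 0" by blast
  moreover have "a T = 0"
  proof -
    have "lk (g (W T)) (uexps P (B \<union> T)) = 0" using top_out BT(2) by (intro g_coeff)
    then show ?thesis using top_out by (simp add: a_def e_def lookup_minus cyc_def lowers_W)
  qed
  ultimately show False by blast
qed

end

section \<open>The ideals H\<close>

lemma uexp_eq_uexps:
  fixes q :: "'a::{finite, order}"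
  shows "uexp q = uexps join_irred (lset q)"
proof -
  let ?s = "\<lambda>m. Poly_Mapping.single (m, m \<in> lset q) (1::nat)"
  have "lset q \<subseteq> join_irred" by (auto simp: lset_def)
  then have "uexps join_irred (lset q) = sum ?s (lset q) + sum ?s (join_irred - lset q)"
    unfolding uexps_def by (subst sum.subset_diff[of "lset q"]) (simp_all add: add.commute)
  also have "sum ?s (lset q) = (\<Sum>p\<in>lset q. Poly_Mapping.single (p, True) 1)"
    by (rule sum.cong) auto
  also have "sum ?s (join_irred - lset q) = (\<Sum>p\<in>join_irred - lset q. Poly_Mapping.single (p, False) 1)"
    by (rule sum.cong) auto
  finally show ?thesis by (simp add: uexp_def)
qed

lemma Hid_eq:
  "Hid S = (gen_ideal hvars (usq join_irred ` lset ` S) :: ('a::{finite, order} \<times> bool, 'k::comm_ring_1) mpoly set)"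
proof -
  have "umon q = (usq join_irred (lset q) :: ('a \<times> bool, 'k) mpoly)" for q :: 'a
    by (simp add: umon_def usq_def uexp_eq_uexps)
  then show ?thesis unfolding Hid_def image_image by simp
qed

lemma linked_imp_lin_res:
  fixes I J :: "'a::{finite, distrib_lattice, bounded_lattice} set"
  assumes "linked (range lset) (lset ` I) (lset ` J)"
  shows "lin_res hvars (Hid (I \<inter> J) :: ('a \<times> bool, 'k::comm_ring_1) mpoly set)"
proof -
  obtain xs :: "'a list" where xs: "set xs = join_irred" "sorted_wrt (\<lambda>m s. \<not> m \<le> s) xs"
    using exists_sorted_enum[of "join_irred :: 'a set"] by auto
  have dist: "distinct xs" using xs(2) by (induction xs) auto
  have IJ: "lset ` (I \<inter> J) = lset ` I \<inter> lset ` J"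
    by (rule image_Int) (simp add: inj_def lset_eq_iff)
  have "good xs (lset ` (I \<inter> J))"
  proof (rule good_linked[OF xs(2)])
    show "linked (downs (set xs) {}) (lset ` I) (lset ` J)"
      using assms by (simp add: xs(1) range_lset)
    show "A \<in> lset ` (I \<inter> J) \<longleftrightarrow> A \<in> downs (set xs) {} \<and> A \<in> lset ` I \<and> A \<in> lset ` J" for A
      unfolding IJ xs(1) range_lset[symmetric] by auto
  qed
  moreover have "set xs \<times> UNIV \<subseteq> (hvars :: ('a \<times> bool) set)" by (simp add: hvars_def xs(1))
  ultimately have "lin_res hvars (gen_ideal hvars ((\<lambda>A. Poly_Mapping.single (uexps (set xs) A) (1::'k)) `
      {A \<in> lset ` (I \<inter> J). A \<subseteq> set xs}))"
    by (rule good_lin_res[OF dist])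
  moreover have "{A \<in> lset ` (I \<inter> J). A \<subseteq> set xs} = lset ` (I \<inter> J)"
    unfolding xs(1) by (auto simp: lset_def)
  moreover have "(\<lambda>A. Poly_Mapping.single (uexps (set xs) A) (1::'k)) = usq join_irred"
    by (rule ext) (simp add: usq_def xs(1))
  ultimately show ?thesis by (simp only: Hid_eq)
qed

text \<open>The product u_p u_q lies in both ideals, so some u_s with s in I \<inter> J divides it.
  It contains no y_t for \<open>t\<close> below \<open>p\<close> and no x_t for \<open>t\<close> not
  below \<open>q\<close>, which places \<open>s\<close> between them.\<close>

lemma Hid_interpolate:
  fixes I J :: "'a::{finite, distrib_lattice, bounded_lattice} set"
  assumes H: "(Hid (I \<inter> J) :: ('a \<times> bool, 'k::comm_ring_1) mpoly set) = Hid I \<inter> Hid J"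
    and pq: "p \<in> I" "q \<in> J" "p \<le> q"
  shows "\<exists>s\<in>I \<inter> J. p \<le> s \<and> s \<le> q"
proof -
  let ?up = "usq join_irred (lset p) :: ('a \<times> bool, 'k) mpoly" and ?uq = "usq join_irred (lset q) :: ('a \<times> bool, 'k) mpoly"
  let ?n = "uexps join_irred (lset p) + uexps join_irred (lset q)"
  have R: "?up \<in> polyR hvars" "?uq \<in> polyR hvars"
    unfolding usq_def hvars_def by (intro polyR_single keys_uexps finite)+
  have "?uq * ?up \<in> Hid I" "?up * ?uq \<in> Hid J"
    unfolding Hid_eq using pq R by (auto intro!: gen_ideal_mult_gen)
  then have "?up * ?uq \<in> Hid (I \<inter> J)" unfolding H by (simp add: mult.commute)
  moreover have "lk (?up * ?uq) ?n \<noteq> 0" by (simp add: usq_def mult_single)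
  ultimately obtain s where s: "s \<in> I \<inter> J" "\<forall>t\<in>join_irred. lk ?n (t, t \<in> lset s) > 0"
    unfolding Hid_eq using gen_ideal_usq_keys[of "?up * ?uq" hvars join_irred "lset ` (I \<inter> J)" ?n] by auto
  have sub: "lset p \<subseteq> lset q" using pq(3) by (simp add: lset_subset_iff)
  have "(t \<in> lset p \<longrightarrow> t \<in> lset s) \<and> (t \<in> lset s \<longrightarrow> t \<in> lset q)" if "t \<in> join_irred" for t
    using s(2)[rule_format, OF that] that sub
    by (auto simp: lookup_add lookup_uexps split: if_splits)
  then have "lset p \<subseteq> lset s" "lset s \<subseteq> lset q" by (auto simp: lset_def)
  then show ?thesis using s(1) by (auto simp: lset_subset_iff)
qed

lemma lin_res_imp_linked:
  fixes I J :: "'a::{finite, distrib_lattice, bounded_lattice} set"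
  assumes I: "poset_ideal I" and J: "poset_coideal J" and IJ: "I \<union> J = UNIV"
    and H: "(Hid (I \<inter> J) :: ('a \<times> bool, 'k::field) mpoly set) = Hid I \<inter> Hid J"
    and lin: "lin_res hvars (Hid (I \<inter> J) :: ('a \<times> bool, 'k) mpoly set)"
  shows "linked (range lset) (lset ` I) (lset ` J)"
proof (rule ccontr)
  assume "\<not> linked (range lset) (lset ` I) (lset ` J)"
  then obtain B T where cell: "is_cell (range (lset :: 'a \<Rightarrow> 'a set)) B T"
    and out: "B \<union> T \<notin> lset ` I" "B \<notin> lset ` J"
    unfolding linked_lset_iff[OF I J] by blast
  obtain r :: 'a where r: "lset r = B" using cell_lset[OF cell, of "{}"] by auto
  obtain p :: 'a where p: "lset p = B \<union> T" using cell_lset[OF cell, of T] by blast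
  have rI: "r \<in> I" "r \<notin> J" and pJ: "p \<in> J" "p \<notin> I"
    using out IJ lset_image_iff[of r J] lset_image_iff[of p I] r p by auto
  have "r \<le> p" using r p lset_subset_iff[of r p] by simp
  \<comment> \<open>This makes the ideal nonzero, so that the degree of its generators is
    determined.\<close>
  then obtain s where s: "s \<in> I \<inter> J" using Hid_interpolate[OF H rI(1) pJ(1)] by blast
  let ?S = "lset ` (I \<inter> J)" and ?K = "lset ` (I - J)"
  have mem: "lset a \<in> ?S \<longleftrightarrow> a \<in> I \<inter> J" "lset a \<in> ?K \<longleftrightarrow> a \<in> I - J" for a :: 'a
    by (rule lset_image_iff)+
  have "separated_cell join_irred B T ?S ?K"
  proof
    show "B \<inter> T = {}" using cell by (simp add: is_cell_def)
    show "B \<union> T \<subseteq> join_irred" unfolding p[symmetric] by (auto simp: lset_def)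
    show "A \<subseteq> join_irred" if "A \<in> ?S" for A using that by (auto simp: lset_def)
    show "?K \<inter> ?S = {}" by (auto simp: lset_eq_iff)
    show "B \<in> ?K" unfolding r[symmetric] mem using rI by blast
    show "B \<union> T \<notin> ?K" "B \<union> T \<notin> ?S" unfolding p[symmetric] mem using pJ by blast+
    show "?S \<noteq> {}" using s by blast
  next
    fix U t assume U: "U \<subseteq> T" "t \<in> T" "t \<notin> U"
    obtain a :: 'a where a: "lset a = B \<union> U" using cell_lset[OF cell U(1)] by blast
    obtain c :: 'a where c: "lset c = B \<union> insert t U" using cell_lset[OF cell, of "insert t U"] U by blast
    have ac: "a \<le> c" using a c lset_subset_iff[of a c] by auto
    {
      assume "B \<union> U \<in> ?K" "B \<union> insert t U \<notin> ?K"
      then have h: "a \<in> I" "a \<notin> J" "c \<notin> I - J" unfolding a[symmetric] c[symmetric] mem by blast+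
      then have cJ: "c \<in> J" using IJ by blast
      \<comment> \<open>As \<open>c\<close> covers \<open>a\<close>, the interpolating element is
        one of the two, and \<open>a\<close> is not in J.\<close>
      obtain x where x: "x \<in> I \<inter> J" "a \<le> x" "x \<le> c" using Hid_interpolate[OF H h(1) cJ ac] by blast
      have "t \<notin> B" using U cell by (auto simp: is_cell_def)
      then have tc: "lset c = insert t (lset a)" "t \<notin> lset a" using a c U by auto
      have "x = a \<or> x = c"
        using lset_insert_covers(2)[OF tc] x(2,3) by (metis order.not_eq_order_implies_strict)
      then have "c \<in> I \<inter> J" using x(1) h by blast
      then show "B \<union> insert t U \<in> ?S" unfolding c[symmetric] mem .
    next
      assume "B \<union> insert t U \<in> ?K" "B \<union> U \<notin> ?K"
      then have h: "c \<in> I" "a \<notin> I - J" unfolding a[symmetric] c[symmetric] mem by blast+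
      then have "a \<in> I" using I ac unfolding poset_ideal_def by blast
      then have "a \<in> I \<inter> J" using h by blast
      then show "B \<union> U \<in> ?S" unfolding a[symmetric] mem .
    }
  qed
  then interpret separated_cell join_irred B T ?S ?K .
  have "V = (hvars :: ('a \<times> bool) set)" by (simp add: V_def hvars_def)
  then show False using no_lin_res[where 'k = 'k] lin by (simp only: Hid_eq)
qed

theorem theorem3p9:
  fixes I J :: "'a::{finite, distrib_lattice, bounded_lattice} set"
  assumes "poset_ideal I" and "poset_coideal J" and "I \<union> J = UNIV"
    and "(Hid (I \<inter> J) :: ('a \<times> bool, 'k::field) mpoly set) = Hid I \<inter> Hid J"
  shows "(lin_res hvars (Hid I \<inter> Hid J :: ('a \<times> bool, 'k) mpoly set)
            \<longleftrightarrow> (\<forall>p. p \<in> I \<or> bigmeet (lower_nbrs p) \<in> J))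
       \<and> ((\<forall>p. p \<in> I \<or> bigmeet (lower_nbrs p) \<in> J)
            \<longleftrightarrow> (\<forall>r. r \<in> J \<or> bigjoin (upper_nbrs r) \<in> I))"
  using lin_res_imp_linked[OF assms] linked_imp_lin_res[of I J, where 'k = 'k]
    linked_iff_bigmeet[OF assms(1-3)] linked_iff_bigjoin[OF assms(1-3)]
  unfolding assms(4) by blast

end
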